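(* Let $\omega$ be a non-quasianalytic weight function satisfying $\log(1+t)=o(\omega(t))$ as $t\to\infty$. Then the convolution operator $C\colon\mathcal{O}'_{M,\omega}(\mathbb{R}^N)\times\mathcal{O}'_{M,\omega}(\mathbb{R}^N)\to\mathcal{O}'_{M,\omega}(\mathbb{R}^N)$, $(T,S)\mapsto T\star S$, is discontinuous (i.e. not jointly continuous for the product topology).
   Context: Weights. A non-quasianalytic weight function is a continuous increasing function $\omega:[0,\infty)\to[0,\infty)$ such that: ($\alpha$) there is $K\ge 1$ with $\omega(2t)\le K(1+\omega(t))$ for all $t\ge 0$; ($\beta$) $\int_1^\infty \frac{\omega(t)}{1+t^2}\,dt<\infty$; ($\gamma$) there are $a\in\mathbb{R}$, $b>0$ with $\omega(t)\ge a+b\log(1+t)$ for all $t\ge 0$; ($\delta$) $\varphi_\omega(t)=\omega(e^t)$ is convex. It is assumed (normalization) that $\omega$ vanishes on $[0,1]$. For $x\in\mathbb{R}^N$, $\omega(x):=\omega(|x|)$. The Young conjugate is $\varphi^*_\omega(s):=\sup_{t\ge 0}\{st-\varphi_\omega(t)\}$, $s\ge 0$ (the value $+\infty$ is allowed, with $\exp(-\infty)=0$). Spaces. $\mathcal{S}_\omega(\mathbb{R}^N)$ is the set of all $f\in L^1(\mathbb{R}^N)$ such that $f,\hat f\in C^\infty(\mathbb{R}^N)$ and $\|\exp(\lambda\omega)\partial^\alpha f\|_\infty<\infty$, $\|\exp(\lambda\omega)\partial^\alpha\hat f\|_\infty<\infty$ for all $\lambda>0$, $\alpha\in\mathbb{N}_0^N$;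 it is a Fréchet space with the norms $q_{m,n}(f):=\sup_{\alpha}\|\exp(n\omega)\partial^\alpha f\|_\infty\exp\left(-m\varphi^*_\omega\left(\frac{|\alpha|}{m}\right)\right)$, $m,n\in\mathbb{N}$. For $m,n\in\mathbb{N}$ let $\mathcal{O}^m_{n,\omega}(\mathbb{R}^N)$ be the space of all $f\in C^\infty(\mathbb{R}^N)$ with $r_{m,n}(f):=\sup_{\alpha\in\mathbb{N}_0^N}\sup_{x\in\mathbb{R}^N}|\partial^\alpha f(x)|\exp\left(-n\omega(x)-m\varphi^*_\omega\left(\frac{|\alpha|}{m}\right)\right)<\infty$, with norm $r_{m,n}$. Set $\mathcal{O}_{M,\omega}(\mathbb{R}^N):=\bigcap_{m}\bigcup_{n}\mathcal{O}^m_{n,\omega}(\mathbb{R}^N)$ with the topology of the projective limit over $m$ of the locally convex inductive limits $\mathrm{ind}_{n}\,\mathcal{O}^m_{n,\omega}(\mathbb{R}^N)$. $\mathcal{O}'_{M,\omega}(\mathbb{R}^N)$ and $\mathcal{S}'_\omega(\mathbb{R}^N)$ are the strong duals. The inclusion $\mathcal{S}_\omega(\mathbb{R}^N)\hookrightarrow\mathcal{O}_{M,\omega}(\mathbb{R}^N)$ is continuous with dense range, so by restriction $\mathcal{O}'_{M,\omega}(\mathbb{R}^N)\subset\mathcal{S}'_\omega(\mathbb{R}^N)$. Convolution. For a functional $R$ and a function $f$, $(R\star f)(x):=\langle R_y,f(x-y)\rangle$. Put $\check f(x):=f(-x)$ and $\check T(f):=T(\check f)$. For $T,S\in\mathcal{O}'_{M,\omega}(\mathbb{R}^N)$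 one has $\check T\star f\in\mathcal{S}_\omega(\mathbb{R}^N)$ for $f\in\mathcal{S}_\omega(\mathbb{R}^N)$, and $T\star S$ is defined by $\langle T\star S,f\rangle:=\langle S,\check T\star f\rangle$, $f\in\mathcal{S}_\omega(\mathbb{R}^N)$; under the stated hypothesis on $\omega$ this functional extends (uniquely) to an element of $\mathcal{O}'_{M,\omega}(\mathbb{R}^N)$, so the map $C$ is well-defined. *)

theory Defs
  imports "HOL-Analysis.Analysis" "HOL-Library.Landau_Symbols" "HOL-Library.FuncSet"
begin

section \<open>Weight functions\<close>

text \<open>
  A weight function is a function on the reals of which only the restriction to
  \<open>[0, \<infinity>)\<close> is ever used; on \<open>\<real>\<^sup>N\<close> it is evaluated at \<open>norm x\<close>.
\<close>

definition nonquasianalytic_weight :: "(real \<Rightarrow> real) \<Rightarrow> bool" where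
  "nonquasianalytic_weight \<omega> \<longleftrightarrow>
     continuous_on {0..} \<omega> \<and> mono_on {0..} \<omega> \<and> (\<forall>t\<ge>0. 0 \<le> \<omega> t) \<and>
     (\<exists>K\<ge>1. \<forall>t\<ge>0. \<omega> (2 * t) \<le> K * (1 + \<omega> t)) \<and>
     set_integrable lborel {1..} (\<lambda>t. \<omega> t / (1 + t\<^sup>2)) \<and>
     (\<exists>a. \<exists>b>0. \<forall>t\<ge>0. a + b * ln (1 + t) \<le> \<omega> t) \<and>
     convex_on UNIV (\<lambda>t. \<omega> (exp t)) \<and>
     (\<forall>t\<in>{0..1}. \<omega> t = 0)"

definition young_conj :: "(real \<Rightarrow> real) \<Rightarrow> real \<Rightarrow> ereal" where
  "young_conj \<omega> s = (SUP t\<in>{0..}. ereal (s * t - \<omega> (exp t)))"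

text \<open>\<open>exp (- a)\<close> with \<open>exp (- \<infinity>) = 0\<close>; it is only applied to \<open>a > - \<infinity>\<close>.\<close>

definition exp_neg :: "ereal \<Rightarrow> real" where
  "exp_neg a = (if a = \<infinity> then 0 else exp (- real_of_ereal a))"

section \<open>Partial derivatives\<close>

definition partial_deriv :: "'n \<Rightarrow> (real ^ 'n \<Rightarrow> complex) \<Rightarrow> real ^ 'n \<Rightarrow> complex" where
  "partial_deriv i f = (\<lambda>x. frechet_derivative f (at x) (axis i 1))"

definition smooth :: "(real ^ 'n \<Rightarrow> complex) \<Rightarrow> bool" where
  "smooth f \<longleftrightarrow> (\<forall>is x. foldr partial_deriv is f differentiable (at x))"

text \<open>
  An arbitrary enumeration of the coordinates. The order is irrelevant, because
  multi-index derivatives are only applied to smooth functions.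
\<close>

definition coords :: "'n::finite list" where
  "coords = (SOME is. distinct is \<and> set is = UNIV)"

definition multi_deriv :: "('n \<Rightarrow> nat) \<Rightarrow> (real ^ 'n \<Rightarrow> complex) \<Rightarrow> real ^ 'n \<Rightarrow> complex" where
  "multi_deriv \<alpha> f = foldr (\<lambda>i. partial_deriv i ^^ \<alpha> i) coords f"

definition multi_order :: "('n::finite \<Rightarrow> nat) \<Rightarrow> nat" where
  "multi_order \<alpha> = (\<Sum>i\<in>UNIV. \<alpha> i)"

section \<open>Function spaces\<close>

definition fourier :: "(real ^ 'n \<Rightarrow> complex) \<Rightarrow> real ^ 'n \<Rightarrow> complex" where
  "fourier f \<xi> = (LINT x|lborel. cis (- (x \<bullet> \<xi>)) * f x)"

definition S_space :: "(real \<Rightarrow> real) \<Rightarrow> (real ^ 'n \<Rightarrow> complex) set" where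
  "S_space \<omega> = {f. integrable lborel f \<and> smooth f \<and> smooth (fourier f) \<and>
     (\<forall>l>0. \<forall>\<alpha>. bounded (range (\<lambda>x. exp (l * \<omega> (norm x)) *\<^sub>R multi_deriv \<alpha> f x)) \<and>
       bounded (range (\<lambda>\<xi>. exp (l * \<omega> (norm \<xi>)) *\<^sub>R multi_deriv \<alpha> (fourier f) \<xi>)))}"

definition O_weighted ::
  "(real \<Rightarrow> real) \<Rightarrow> nat \<Rightarrow> nat \<Rightarrow> (real ^ 'n \<Rightarrow> complex) \<Rightarrow> ('n \<Rightarrow> nat) \<Rightarrow> real ^ 'n \<Rightarrow> real" where
  "O_weighted \<omega> m n f \<alpha> x =
     cmod (multi_deriv \<alpha> f x) * exp (- real n * \<omega> (norm x)) *
     exp_neg (ereal (real m) * young_conj \<omega> (real (multi_order \<alpha>) / real m))"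

definition O_step :: "(real \<Rightarrow> real) \<Rightarrow> nat \<Rightarrow> nat \<Rightarrow> (real ^ 'n \<Rightarrow> complex) set" where
  "O_step \<omega> m n = {f. smooth f \<and> bdd_above (range (\<lambda>(\<alpha>, x). O_weighted \<omega> m n f \<alpha> x))}"

definition O_norm :: "(real \<Rightarrow> real) \<Rightarrow> nat \<Rightarrow> nat \<Rightarrow> (real ^ 'n \<Rightarrow> complex) \<Rightarrow> real" where
  "O_norm \<omega> m n f = (SUP (\<alpha>, x). O_weighted \<omega> m n f \<alpha> x)"

definition OM_space :: "(real \<Rightarrow> real) \<Rightarrow> (real ^ 'n \<Rightarrow> complex) set" where
  "OM_space \<omega> = (\<Inter>m\<in>{1..}. \<Union>n\<in>{1..}. O_step \<omega> m n)"

section \<open>Locally convex inductive limits\<close>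

definition seminorm_on :: "('x \<Rightarrow> complex) set \<Rightarrow> (('x \<Rightarrow> complex) \<Rightarrow> real) \<Rightarrow> bool" where
  "seminorm_on V p \<longleftrightarrow>
     (\<forall>f\<in>V. \<forall>g\<in>V. p (\<lambda>x. f x + g x) \<le> p f + p g) \<and>
     (\<forall>c. \<forall>f\<in>V. p (\<lambda>x. c * f x) = cmod c * p f)"

text \<open>
  For an increasing sequence \<open>E 1, E 2, \<dots>\<close> of function spaces normed by \<open>r 1, r 2, \<dots>\<close>, the
  locally convex inductive limit topology on the union is the one given by all seminorms
  whose restriction to every step is continuous. This family of seminorms is closed under
  sums and nonnegative multiples, so the unit balls of single seminorms form a basis of
  neighbourhoods of \<open>0\<close>.
\<close>

definition ind_seminorm ::
  "(nat \<Rightarrow> ('x \<Rightarrow> complex) set) \<Rightarrow> (nat \<Rightarrow> ('x \<Rightarrow> complex) \<Rightarrow> real) \<Rightarrow>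
   (('x \<Rightarrow> complex) \<Rightarrow> real) \<Rightarrow> bool" where
  "ind_seminorm E r p \<longleftrightarrow>
     seminorm_on (\<Union>n\<in>{1..}. E n) p \<and> (\<forall>n\<ge>1. \<exists>C. \<forall>f\<in>E n. p f \<le> C * r n f)"

definition ind_limit_topology ::
  "(nat \<Rightarrow> ('x \<Rightarrow> complex) set) \<Rightarrow> (nat \<Rightarrow> ('x \<Rightarrow> complex) \<Rightarrow> real) \<Rightarrow>
   ('x \<Rightarrow> complex) topology" where
  "ind_limit_topology E r = topology (\<lambda>U. U \<subseteq> (\<Union>n\<in>{1..}. E n) \<and>
     (\<forall>f\<in>U. \<exists>p. ind_seminorm E r p \<and>
        {g \<in> (\<Union>n\<in>{1..}. E n). p (\<lambda>x. g x - f x) < 1} \<subseteq> U))"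

lemma ind_seminorm_add:
  assumes "ind_seminorm E r p" "ind_seminorm E r q"
  shows "ind_seminorm E r (\<lambda>f. p f + q f)"
  unfolding ind_seminorm_def
proof (intro conjI allI impI)
  have s: "seminorm_on (\<Union>n\<in>{1..}. E n) p" "seminorm_on (\<Union>n\<in>{1..}. E n) q"
    using assms by (simp_all add: ind_seminorm_def)
  show "seminorm_on (\<Union>n\<in>{1..}. E n) (\<lambda>f. p f + q f)"
    unfolding seminorm_on_def
  proof (intro conjI ballI allI)
    fix f g assume "f \<in> (\<Union>n\<in>{1..}. E n)" "g \<in> (\<Union>n\<in>{1..}. E n)"
    then have "p (\<lambda>x. f x + g x) \<le> p f + p g" "q (\<lambda>x. f x + g x) \<le> q f + q g"
      using s unfolding seminorm_on_def by blast+
    then show "p (\<lambda>x. f x + g x) + q (\<lambda>x. f x + g x) \<le> p f + q f + (p g + q g)"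
      by linarith
  next
    fix c f assume "f \<in> (\<Union>n\<in>{1..}. E n)"
    then have "p (\<lambda>x. c * f x) = cmod c * p f" "q (\<lambda>x. c * f x) = cmod c * q f"
      using s unfolding seminorm_on_def by blast+
    then show "p (\<lambda>x. c * f x) + q (\<lambda>x. c * f x) = cmod c * (p f + q f)"
      by (simp add: distrib_left)
  qed
next
  fix n :: nat assume "1 \<le> n"
  then obtain C D where "\<forall>f\<in>E n. p f \<le> C * r n f" "\<forall>f\<in>E n. q f \<le> D * r n f"
    using assms unfolding ind_seminorm_def by meson
  then show "\<exists>C. \<forall>f\<in>E n. p f + q f \<le> C * r n f"
    by (intro exI[of _ "C + D"]) (auto simp: distrib_right intro: add_mono)
qed

lemma seminorm_on_nonneg:
  assumes "seminorm_on V p" "f \<in> V" "(\<lambda>x. - f x) \<in> V"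
  shows "0 \<le> p f"
proof -
  have "p (\<lambda>x. f x + - f x) \<le> p f + p (\<lambda>x. - f x)"
    using bspec[OF bspec[OF conjunct1[OF assms(1)[unfolded seminorm_on_def]] assms(2)] assms(3)]
    by simp
  moreover have "p (\<lambda>x. 0 * f x) = cmod 0 * p f" "p (\<lambda>x. -1 * f x) = cmod (-1) * p f"
    using assms(1,2) unfolding seminorm_on_def by blast+
  ultimately show ?thesis by simp
qed

section \<open>The topology of the multiplier space and its strong dual\<close>

definition OM_step_topology :: "(real \<Rightarrow> real) \<Rightarrow> nat \<Rightarrow> (real ^ 'n \<Rightarrow> complex) topology" where
  "OM_step_topology \<omega> m = ind_limit_topology (O_step \<omega> m) (O_norm \<omega> m)"

text \<open>The projective limit: the initial topology for the inclusions into the inductive limits.\<close>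

definition OM_topology :: "(real \<Rightarrow> real) \<Rightarrow> (real ^ 'n \<Rightarrow> complex) topology" where
  "OM_topology \<omega> =
     topology_generated_by {OM_space \<omega> \<inter> U | U m. 1 \<le> m \<and> openin (OM_step_topology \<omega> m) U}"

text \<open>Von Neumann boundedness: every neighbourhood of \<open>0\<close> absorbs \<open>B\<close>.\<close>

definition vn_bounded :: "('x \<Rightarrow> complex) topology \<Rightarrow> ('x \<Rightarrow> complex) set \<Rightarrow> bool" where
  "vn_bounded X B \<longleftrightarrow> B \<subseteq> topspace X \<and>
     (\<forall>U. openin X U \<and> (\<lambda>x. 0) \<in> U \<longrightarrow>
        (\<exists>s>0. \<forall>t\<ge>s. \<forall>f\<in>B. (\<lambda>x. f x / complex_of_real t) \<in> U))"

text \<open>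
  Functionals are extensional (\<open>undefined\<close> outside the space), so that they are
  determined by their values on it.
\<close>

definition dual_space :: "('x \<Rightarrow> complex) topology \<Rightarrow> (('x \<Rightarrow> complex) \<Rightarrow> complex) set" where
  "dual_space X = {T. T \<in> extensional (topspace X) \<and> continuous_map X euclidean T \<and>
     (\<forall>f\<in>topspace X. \<forall>g\<in>topspace X. T (\<lambda>x. f x + g x) = T f + T g) \<and>
     (\<forall>c. \<forall>f\<in>topspace X. T (\<lambda>x. c * f x) = c * T f)}"

definition strong_dual_topology ::
  "('x \<Rightarrow> complex) topology \<Rightarrow> (('x \<Rightarrow> complex) \<Rightarrow> complex) topology" where
  "strong_dual_topology X = topology (\<lambda>U. U \<subseteq> dual_space X \<and>
     (\<forall>T\<in>U. \<exists>B e. vn_bounded X B \<and> 0 < e \<and>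
        {S \<in> dual_space X. \<forall>f\<in>B. cmod (S f - T f) \<le> e} \<subseteq> U))"

definition OM_dual :: "(real \<Rightarrow> real) \<Rightarrow> ((real ^ 'n \<Rightarrow> complex) \<Rightarrow> complex) set" where
  "OM_dual \<omega> = dual_space (OM_topology \<omega>)"

definition OM_dual_topology ::
  "(real \<Rightarrow> real) \<Rightarrow> ((real ^ 'n \<Rightarrow> complex) \<Rightarrow> complex) topology" where
  "OM_dual_topology \<omega> = strong_dual_topology (OM_topology \<omega>)"

lemma openin_ind_limit_topology:
  "openin (ind_limit_topology E r) U \<longleftrightarrow> U \<subseteq> (\<Union>n\<in>{1..}. E n) \<and>
     (\<forall>f\<in>U. \<exists>p. ind_seminorm E r p \<and>
        {g \<in> (\<Union>n\<in>{1..}. E n). p (\<lambda>x. g x - f x) < 1} \<subseteq> U)"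
  if diff: "\<And>f g. f \<in> (\<Union>n\<in>{1..}. E n) \<Longrightarrow> g \<in> (\<Union>n\<in>{1..}. E n) \<Longrightarrow>
     (\<lambda>x. f x - g x) \<in> (\<Union>n\<in>{1..}. E n)"
proof -
  let ?V = "\<Union>n\<in>{1..}. E n"
  let ?P = "\<lambda>U. U \<subseteq> ?V \<and> (\<forall>f\<in>U. \<exists>p. ind_seminorm E r p \<and>
     {g \<in> ?V. p (\<lambda>x. g x - f x) < 1} \<subseteq> U)"
  have nonneg: "0 \<le> p (\<lambda>x. g x - f x)"
    if "ind_seminorm E r p" "f \<in> ?V" "g \<in> ?V" for p f g
  proof (rule seminorm_on_nonneg[where V = ?V and p = p])
    show "seminorm_on ?V p" using that(1) by (simp add: ind_seminorm_def)
    show "(\<lambda>x. g x - f x) \<in> ?V" using that diff by blast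
    show "(\<lambda>x. - (g x - f x)) \<in> ?V" using diff[OF that(2,3)] by simp
  qed
  have "istopology ?P"
    unfolding istopology_def
  proof (intro conjI allI impI)
    fix U W assume U: "?P U" and W: "?P W"
    show "U \<inter> W \<subseteq> ?V" using U by blast
    show "\<forall>f\<in>U \<inter> W. \<exists>p. ind_seminorm E r p \<and>
            {g \<in> ?V. p (\<lambda>x. g x - f x) < 1} \<subseteq> U \<inter> W"
    proof
      fix f assume f: "f \<in> U \<inter> W"
      then have fV: "f \<in> ?V" using U by blast
      obtain p where p: "ind_seminorm E r p" "{g \<in> ?V. p (\<lambda>x. g x - f x) < 1} \<subseteq> U"
        using U f by blast
      obtain q where q: "ind_seminorm E r q" "{g \<in> ?V. q (\<lambda>x. g x - f x) < 1} \<subseteq> W"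
        using W f by blast
      have "{g \<in> ?V. p (\<lambda>x. g x - f x) + q (\<lambda>x. g x - f x) < 1} \<subseteq> U \<inter> W"
      proof
        fix g assume "g \<in> {g \<in> ?V. p (\<lambda>x. g x - f x) + q (\<lambda>x. g x - f x) < 1}"
        then have g: "g \<in> ?V" "p (\<lambda>x. g x - f x) + q (\<lambda>x. g x - f x) < 1" by auto
        have "p (\<lambda>x. g x - f x) < 1" "q (\<lambda>x. g x - f x) < 1"
          using nonneg[OF p(1) fV g(1)] nonneg[OF q(1) fV g(1)] g(2) by linarith+
        then show "g \<in> U \<inter> W" using p(2) q(2) g(1) by blast
      qed
      then show "\<exists>p. ind_seminorm E r p \<and> {g \<in> ?V. p (\<lambda>x. g x - f x) < 1} \<subseteq> U \<inter> W"
        using ind_seminorm_add[OF p(1) q(1)] by blast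
    qed
  next
    fix \<K> assume K: "\<forall>K\<in>\<K>. ?P K"
    show "\<Union>\<K> \<subseteq> ?V" using K by blast
    show "\<forall>f\<in>\<Union>\<K>. \<exists>p. ind_seminorm E r p \<and>
            {g \<in> ?V. p (\<lambda>x. g x - f x) < 1} \<subseteq> \<Union>\<K>"
    proof
      fix f assume "f \<in> \<Union>\<K>"
      then obtain K where "K \<in> \<K>" "f \<in> K" by blast
      then show "\<exists>p. ind_seminorm E r p \<and> {g \<in> ?V. p (\<lambda>x. g x - f x) < 1} \<subseteq> \<Union>\<K>"
        using K by (meson Union_upper order_trans)
    qed
  qed
  then show ?thesis
    by (simp add: ind_limit_topology_def topology_inverse')
qed

lemma vn_bounded_Un:
  assumes "vn_bounded X A" "vn_bounded X B"
  shows "vn_bounded X (A \<union> B)"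
  unfolding vn_bounded_def
proof (intro conjI allI impI)
  show "A \<union> B \<subseteq> topspace X" using assms by (simp add: vn_bounded_def)
next
  fix U assume U: "openin X U \<and> (\<lambda>x. 0) \<in> U"
  obtain s where s: "s > 0" "\<forall>t\<ge>s. \<forall>f\<in>A. (\<lambda>x. f x / complex_of_real t) \<in> U"
    using assms(1) U unfolding vn_bounded_def by blast
  obtain s' where s': "s' > 0" "\<forall>t\<ge>s'. \<forall>f\<in>B. (\<lambda>x. f x / complex_of_real t) \<in> U"
    using assms(2) U unfolding vn_bounded_def by blast
  show "\<exists>s>0. \<forall>t\<ge>s. \<forall>f\<in>A \<union> B. (\<lambda>x. f x / complex_of_real t) \<in> U"
    using s s' by (intro exI[of _ "max s s'"]) auto
qed

lemma openin_strong_dual_topology: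
  "openin (strong_dual_topology X) U \<longleftrightarrow> U \<subseteq> dual_space X \<and>
     (\<forall>T\<in>U. \<exists>B e. vn_bounded X B \<and> 0 < e \<and>
        {S \<in> dual_space X. \<forall>f\<in>B. cmod (S f - T f) \<le> e} \<subseteq> U)"
proof -
  let ?N = "\<lambda>T B e. {S \<in> dual_space X. \<forall>f\<in>B. cmod (S f - T f) \<le> e}"
  let ?P = "\<lambda>U. U \<subseteq> dual_space X \<and>
     (\<forall>T\<in>U. \<exists>B e. vn_bounded X B \<and> 0 < e \<and> ?N T B e \<subseteq> U)"
  have "istopology ?P"
    unfolding istopology_def
  proof (intro conjI allI impI)
    fix U W assume U: "?P U" and W: "?P W"
    show "U \<inter> W \<subseteq> dual_space X" using U by blast
    show "\<forall>T\<in>U \<inter> W. \<exists>B e. vn_bounded X B \<and> 0 < e \<and> ?N T B e \<subseteq> U \<inter> W"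
    proof
      fix T assume T: "T \<in> U \<inter> W"
      obtain A d where A: "vn_bounded X A" "0 < d" "?N T A d \<subseteq> U"
        using U T by blast
      obtain B e where B: "vn_bounded X B" "0 < e" "?N T B e \<subseteq> W"
        using W T by blast
      have "?N T (A \<union> B) (min d e) \<subseteq> ?N T A d \<inter> ?N T B e" by auto
      then have "?N T (A \<union> B) (min d e) \<subseteq> U \<inter> W" using A(3) B(3) by blast
      then show "\<exists>B e. vn_bounded X B \<and> 0 < e \<and> ?N T B e \<subseteq> U \<inter> W"
        using vn_bounded_Un[OF A(1) B(1)] A(2) B(2)
        by (intro exI[of _ "A \<union> B"] exI[of _ "min d e"]) simp
    qed
  next
    fix \<K> assume K: "\<forall>K\<in>\<K>. ?P K"
    show "\<Union>\<K> \<subseteq> dual_space X" using K by blast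
    show "\<forall>T\<in>\<Union>\<K>. \<exists>B e. vn_bounded X B \<and> 0 < e \<and> ?N T B e \<subseteq> \<Union>\<K>"
    proof
      fix T assume "T \<in> \<Union>\<K>"
      then obtain K where "K \<in> \<K>" "T \<in> K" by blast
      then show "\<exists>B e. vn_bounded X B \<and> 0 < e \<and> ?N T B e \<subseteq> \<Union>\<K>"
        using K by (meson Union_upper order_trans)
    qed
  qed
  then show ?thesis
    by (simp add: strong_dual_topology_def topology_inverse')
qed

lemma topspace_strong_dual_topology [simp]:
  "topspace (strong_dual_topology X) = dual_space X"
proof
  show "topspace (strong_dual_topology X) \<subseteq> dual_space X"
    using openin_topspace[of "strong_dual_topology X"]
    unfolding openin_strong_dual_topology by blast
  have "vn_bounded X {}" by (auto simp: vn_bounded_def intro: exI[of _ "1::real"])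
  then have "openin (strong_dual_topology X) (dual_space X)"
    unfolding openin_strong_dual_topology
    by (intro conjI ballI exI[of _ "{}"] exI[of _ "1::real"]) auto
  then show "dual_space X \<subseteq> topspace (strong_dual_topology X)"
    by (rule openin_subset)
qed

section \<open>Convolution\<close>

definition convol_fun ::
  "((real ^ 'n \<Rightarrow> complex) \<Rightarrow> complex) \<Rightarrow> (real ^ 'n \<Rightarrow> complex) \<Rightarrow> real ^ 'n \<Rightarrow> complex" where
  "convol_fun R f = (\<lambda>x. R (\<lambda>y. f (x - y)))"

definition reflect ::
  "((real ^ 'n \<Rightarrow> complex) \<Rightarrow> complex) \<Rightarrow> (real ^ 'n \<Rightarrow> complex) \<Rightarrow> complex" where
  "reflect T = (\<lambda>f. T (\<lambda>x. f (- x)))"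

text \<open>
  The extension to \<open>OM_space \<omega>\<close> of the functional defined on \<open>S_space \<omega>\<close>; it is unique,
  because \<open>S_space \<omega>\<close> is dense in \<open>OM_space \<omega>\<close>.
\<close>

definition convol ::
  "(real \<Rightarrow> real) \<Rightarrow> ((real ^ 'n \<Rightarrow> complex) \<Rightarrow> complex) \<Rightarrow>
   ((real ^ 'n \<Rightarrow> complex) \<Rightarrow> complex) \<Rightarrow> (real ^ 'n \<Rightarrow> complex) \<Rightarrow> complex" where
  "convol \<omega> T S =
     (SOME R. R \<in> OM_dual \<omega> \<and> (\<forall>f\<in>S_space \<omega>. R f = S (convol_fun (reflect T) f)))"

end

theory Submission
  imports Defs "HOL-Probability.Characteristic_Functions" "HOL-Probability.Sinc_Integral"
begin

text \<open>
  Point functionals suffice to violate continuity at \<open>(0, 0)\<close>. If \<open>T\<close> is a multiple of the derivative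
  \<open>\<partial>\<^sub>i\<^sup>k\<close> at \<open>0\<close> and \<open>S\<close> a multiple of evaluation at \<open>x\<close>, then \<open>T \<star> S\<close> is a multiple of \<open>\<partial>\<^sub>i\<^sup>k\<close> at \<open>x\<close>.
  A bounded set \<open>E\<close> allows pointwise growth \<open>exp (n \<omega>)\<close> for one fixed \<open>n\<close>, and then any bounded set \<open>D\<close>
  satisfies estimates of order \<open>m = n + 1\<close> on its derivatives at \<open>0\<close>. Test \<open>T \<star> S\<close> against the
  Gaussian wave packets of frequency \<open>v\<close> centred at \<open>x = v e\<^sub>i\<close>, which form a bounded set and whose
  \<open>k\<close>-th derivative at \<open>x\<close> is at least \<open>v\<^sup>k\<close>. Continuity would give
  \<open>v\<^sup>k exp (- n \<omega> v) \<le> c W k\<close> for all \<open>k\<close> and \<open>v \<ge> 1\<close>, where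
  \<open>W k = exp (m \<phi>\<^sup>* (k / m))\<close> is the supremum of \<open>t\<^sup>k exp (- m \<omega> t)\<close> over \<open>t \<ge> 1\<close>. But a
  near-maximiser \<open>t\<close> of the latter tends to infinity with \<open>k\<close>, and taking \<open>v = t\<close> the left side exceeds
  \<open>W k\<close> by a factor of order \<open>exp (\<omega> t)\<close>.

  That the convolution is defined by its formula on all of \<open>S_space \<omega>\<close> needs \<open>S_space \<omega> \<subseteq> OM_space \<omega>\<close>,
  which comes from Fourier inversion.
\<close>

section \<open>Weight functions\<close>

text \<open>The order of quantifiers shapes the proof. Membership in the multiplier space asks, for
  each derivative order \<open>m\<close>, for some growth order \<open>n\<close>; so a bounded set
  obeys all \<open>m\<close>, but its values obey only some \<open>n\<close> that cannot be
  prescribed. Continuity at the zero pair supplies \<open>D\<close> and \<open>E\<close> as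
  adversaries: \<open>E\<close> reveals its \<open>n\<close>, and \<open>m\<close> is chosen
  afterwards. The packets exploit the same freedom: tying the frequency to the position of the
  centre makes derivatives of order \<open>m\<close> cost growth of order about
  \<open>m * K\<close>, with \<open>K\<close> a dilation constant of \<omega>, and this dependence
  of \<open>n\<close> on \<open>m\<close> is allowed.

  Bounded sets are handled through one-sided tests. Uniform bounds in one step for each
  \<open>m\<close> imply boundedness, which serves the packets; suprema of functionals that are
  uniformly bounded on every step give necessary conditions, which serve \<open>D\<close> and
  \<open>E\<close>.

  The values of \<open>convol\<close> are prescribed on test functions, so the packets must be test
  functions. This dictates Gaussians, a family closed under the Fourier transform whose derivatives
  are explicit through Hermite polynomials.\<close>

text \<open>The reciprocal of the supremum of \<open>t\<^sup>k exp (- m \<omega> t)\<close> over \<open>t \<ge> 1\<close>.\<close>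

definition deriv_weight :: "(real \<Rightarrow> real) \<Rightarrow> nat \<Rightarrow> nat \<Rightarrow> real" where
  "deriv_weight \<omega> m k = exp_neg (ereal (real m) * young_conj \<omega> (real k / real m))"

lemma exp_diff_nat_mult: "exp (real k * u - b) = exp u ^ k * exp (- b)"
  by (simp add: exp_diff exp_minus exp_of_nat_mult divide_inverse)

lemma less_mult_exp_minus: "a * exp x < b \<longleftrightarrow> a < b * exp (- x :: real)"
  by (simp add: exp_minus field_simps)

lemma le_mult_exp_minus: "a \<le> b * exp x \<Longrightarrow> a * exp (- x :: real) \<le> b"
  by (simp add: exp_minus field_simps)

lemma diff_quotient_le:
  assumes "m \<ge> 1" "real k * u - real m * w \<le> l"
  shows "(real k / real m) * u - w \<le> l / real m"
  using divide_right_mono[OF assms(2), of "real m"] assms(1) by (simp add: diff_divide_distrib)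

locale weight =
  fixes \<omega> :: "real \<Rightarrow> real"
  assumes weight: "nonquasianalytic_weight \<omega>"
    and ln_smallo: "(\<lambda>t. ln (1 + t)) \<in> o[at_top](\<omega>)"
begin

lemma nonneg: "0 \<le> t \<Longrightarrow> 0 \<le> \<omega> t"
  using weight by (simp add: nonquasianalytic_weight_def)

lemma mono: "0 \<le> s \<Longrightarrow> s \<le> t \<Longrightarrow> \<omega> s \<le> \<omega> t"
  using weight by (auto simp: nonquasianalytic_weight_def mono_on_def)

lemma eq_0: "0 \<le> t \<Longrightarrow> t \<le> 1 \<Longrightarrow> \<omega> t = 0"
  using weight by (simp add: nonquasianalytic_weight_def)

text \<open>Four applications of the doubling condition. The packet estimate needs the factor 16:
  one 4 to beat \<open>exp 1\<close>, another to replace a sum of four terms by their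
  maximum.\<close>

lemma dilation_bound:
  obtains K where "K \<ge> 1" "\<And>t. 0 \<le> t \<Longrightarrow> \<omega> (16 * t) \<le> K * (1 + \<omega> t)"
proof -
  obtain K where K: "K \<ge> 1" "\<And>t. 0 \<le> t \<Longrightarrow> \<omega> (2 * t) \<le> K * (1 + \<omega> t)"
    using weight by (auto simp: nonquasianalytic_weight_def)
  have step: "\<exists>L\<ge>1. \<forall>t\<ge>0. \<omega> (2 ^ j * t) \<le> L * (1 + \<omega> t)" for j
  proof (induction j)
    case 0
    show ?case by (intro exI[of _ 1]) auto
  next
    case (Suc j)
    then obtain L where L: "L \<ge> 1" "\<And>t. t \<ge> 0 \<Longrightarrow> \<omega> (2 ^ j * t) \<le> L * (1 + \<omega> t)" by blast
    have "\<omega> (2 ^ Suc j * t) \<le> (K * (2 * L)) * (1 + \<omega> t)" if "t \<ge> 0" for t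
    proof -
      have "1 * 1 \<le> L * (1 + \<omega> t)" using L(1) nonneg[OF that] by (intro mult_mono) auto
      then have "1 + \<omega> (2 ^ j * t) \<le> 2 * L * (1 + \<omega> t)" using L(2)[OF that] by simp
      then have "K * (1 + \<omega> (2 ^ j * t)) \<le> K * (2 * L * (1 + \<omega> t))"
        using K(1) by (intro mult_left_mono) auto
      then show ?thesis using K(2)[of "2 ^ j * t"] that by (simp add: mult.assoc)
    qed
    moreover have "1 * 1 \<le> K * (2 * L)" using K(1) L(1) by (intro mult_mono) auto
    ultimately show ?case by (intro exI[of _ "K * (2 * L)"]) auto
  qed
  from step[of 4] show ?thesis using that by auto
qed

text \<open>By monotonicity the integral of \<open>\<omega> s / (1 + s^2)\<close> over
  \<open>{t..2 * t}\<close> is at least \<open>\<omega> t / (5 * t)\<close>, as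
  \<open>1 + s^2 \<le> 5 * t^2\<close> there for \<open>t > 1\<close>. Nonquasianalyticity bounds
  it, so \<omega> grows at most linearly and Gaussians beat
  \<open>exp (l * \<omega>)\<close>.\<close>

lemma linear_bound:
  obtains A where "A \<ge> 0" "\<And>t. 0 \<le> t \<Longrightarrow> \<omega> t \<le> A * (1 + t)"
proof -
  have int: "set_integrable lborel {1..} (\<lambda>t. \<omega> t / (1 + t\<^sup>2))"
    using weight by (simp add: nonquasianalytic_weight_def)
  define I where "I = (LINT t:{1..}|lborel. \<omega> t / (1 + t\<^sup>2))"
  have I0: "I \<ge> 0"
    unfolding I_def set_lebesgue_integral_def
    by (intro integral_nonneg_AE) (auto simp: indicator_def nonneg)
  have "\<omega> t \<le> 5 * I * (1 + t)" if t: "t \<ge> 0" for t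
  proof (cases "t \<le> 1")
    case True
    then show ?thesis using eq_0[OF t] I0 t by simp
  next
    case False
    have "(LINT s:{t..2*t}|lborel. \<omega> t / (5 * t\<^sup>2)) \<le> I"
      unfolding I_def set_lebesgue_integral_def
    proof (intro integral_mono)
      show "integrable lborel (\<lambda>x. indicator {t..2 * t} x *\<^sub>R (\<omega> t / (5 * t\<^sup>2)))"
        by (intro integrable_scaleR_left integrable_real_indicator) (auto simp: emeasure_lborel_Icc_eq)
      show "integrable lborel (\<lambda>t. indicator {1..} t *\<^sub>R (\<omega> t / (1 + t\<^sup>2)))"
        using int by (simp add: set_integrable_def)
      fix s :: real
      show "indicator {t..2 * t} s *\<^sub>R (\<omega> t / (5 * t\<^sup>2)) \<le> indicator {1..} s *\<^sub>R (\<omega> s / (1 + s\<^sup>2))"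
      proof (cases "s \<in> {t..2*t}")
        case True
        then have s: "t \<le> s" "s \<le> 2 * t" by auto
        have "s\<^sup>2 \<le> (2 * t)\<^sup>2" using s False by (intro power_mono) auto
        moreover have "1 \<le> t\<^sup>2" using False by simp
        ultimately have "1 + s\<^sup>2 \<le> 5 * t\<^sup>2" by (simp add: power_mult_distrib)
        then have "\<omega> t / (5 * t\<^sup>2) \<le> \<omega> s / (1 + s\<^sup>2)"
          using mono[OF t s(1)] nonneg[OF t] by (intro frac_le) (auto simp: add_pos_nonneg)
        then show ?thesis using True False s by simp
      next
        case False
        then show ?thesis using nonneg[of s] by (auto simp: indicator_def)
      qed
    qed
    moreover have "(LINT s:{t..2*t}|lborel. \<omega> t / (5 * t\<^sup>2)) = \<omega> t / (5 * t)"
      unfolding set_lebesgue_integral_def using False by (simp add: power2_eq_square)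
    ultimately have "\<omega> t / (5 * t) \<le> I" by simp
    then have "\<omega> t \<le> 5 * I * t" using False by (simp add: field_simps)
    then show ?thesis using I0 by (simp add: algebra_simps)
  qed
  then show ?thesis using that[of "5 * I"] I0 by simp
qed

text \<open>The lower bound of \<omega> by \<open>a + b * ln (1 + t)\<close>, multiplied by
  \<open>p / b\<close> and exponentiated.\<close>

lemma power_bound:
  obtains C q where "C > 0" "\<And>t. 0 \<le> t \<Longrightarrow> (1 + t) ^ p \<le> C * exp (real q * \<omega> t)"
proof -
  obtain a b where ab: "b > 0" "\<And>t. t \<ge> 0 \<Longrightarrow> a + b * ln (1 + t) \<le> \<omega> t"
    using weight by (auto simp: nonquasianalytic_weight_def)
  obtain q :: nat where q: "real p / b \<le> real q" using real_arch_simple by blast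
  have "(1 + t) ^ p \<le> exp (- (a * (real p / b))) * exp (real q * \<omega> t)" if t: "t \<ge> 0" for t
  proof -
    have "real p * ln (1 + t) = (real p / b) * (b * ln (1 + t))" using ab(1) by simp
    also have "\<dots> \<le> (real p / b) * (\<omega> t - a)" using ab(1) ab(2)[OF t] by (intro mult_left_mono) auto
    also have "\<dots> = (real p / b) * \<omega> t - a * (real p / b)"
      by (simp add: right_diff_distrib mult.commute[of a])
    also have "\<dots> \<le> real q * \<omega> t - a * (real p / b)"
      using mult_right_mono[OF q nonneg[OF t]] by simp
    finally have "exp (real p * ln (1 + t)) \<le> exp (real q * \<omega> t - a * (real p / b))" by simp
    moreover have "exp (real p * ln (1 + t)) = (1 + t) ^ p" using t by (simp add: exp_of_nat_mult)
    ultimately show ?thesis by (simp add: exp_add[symmetric])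
  qed
  then show ?thesis using that[of "exp (- (a * (real p / b)))" q] by simp
qed

lemma unbounded: obtains t where "t \<ge> 1" "\<omega> t > c"
proof -
  obtain C q where C: "C > 0" "\<And>t. 0 \<le> t \<Longrightarrow> (1 + t) ^ 1 \<le> C * exp (real q * \<omega> t)"
    using power_bound[of 1] by blast
  define t where "t = C * exp (real q * \<bar>c\<bar>) + 1"
  have t1: "t \<ge> 1" using C(1) by (simp add: t_def)
  have "\<omega> t > c"
  proof (rule ccontr)
    assume "\<not> \<omega> t > c"
    then have "real q * \<omega> t \<le> real q * \<bar>c\<bar>" by (intro mult_left_mono) auto
    then have "C * exp (real q * \<omega> t) \<le> C * exp (real q * \<bar>c\<bar>)" using C(1) by simp
    then show False using C(2)[of t] t1 by (simp add: t_def)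
  qed
  then show ?thesis using that t1 by blast
qed

text \<open>This is the only place where the hypothesis \<open>ln (1 + t) = o(\<omega> t)\<close> enters: it makes the
  Young conjugate finite.\<close>

lemma power_exp_bounded:
  assumes "m \<ge> 1"
  obtains C where "\<And>t. t \<ge> 1 \<Longrightarrow> t ^ k * exp (- real m * \<omega> t) \<le> C"
proof -
  \<comment> \<open>Beyond \<open>t0\<close> this gives
    \<open>(k + 1) * ln (1 + t) \<le> m * \<omega> t\<close>, so the product is at most 1; the
    \<open>+ 1\<close> keeps the denominator nonzero for \<open>k = 0\<close>.\<close>
  define e where "e = real m / real (k + 1)"
  have e: "e > 0" using assms by (simp add: e_def)
  obtain t0 where t0: "\<And>t. t \<ge> t0 \<Longrightarrow> norm (ln (1 + t)) \<le> e * norm (\<omega> t)"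
    using landau_o.smallD[OF ln_smallo e] by (auto simp: eventually_at_top_linorder)
  have "t ^ k * exp (- real m * \<omega> t) \<le> (1 + \<bar>t0\<bar>) ^ k" if t: "t \<ge> 1" for t
  proof (cases "t \<ge> t0")
    case True
    have "ln (1 + t) \<le> e * \<omega> t" using t0[OF True] t nonneg[of t] by simp
    then have "real (k + 1) * ln (1 + t) \<le> real (k + 1) * (e * \<omega> t)"
      by (intro mult_left_mono) auto
    moreover have "real (k + 1) * e = real m" by (simp add: e_def)
    ultimately have "real (k + 1) * ln (1 + t) \<le> real m * \<omega> t" by (metis mult.assoc)
    moreover have "real k * ln t \<le> real (k + 1) * ln (1 + t)"
      using t by (intro mult_mono) auto
    ultimately have "real k * ln t - real m * \<omega> t \<le> 0" by simp
    then have "exp (real k * ln t + - real m * \<omega> t) \<le> 1" by simp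
    then have "t ^ k * exp (- real m * \<omega> t) \<le> 1" using t by (simp only: exp_add) (simp add: exp_of_nat_mult)
    also have "1 \<le> (1 + \<bar>t0\<bar>) ^ k" by simp
    finally show ?thesis .
  next
    case False
    have "t ^ k * exp (- real m * \<omega> t) \<le> (1 + \<bar>t0\<bar>) ^ k * 1"
      using False t nonneg[of t] by (intro mult_mono power_mono) auto
    then show ?thesis by simp
  qed
  then show ?thesis using that by blast
qed

text \<open>The substitution \<open>t = exp u\<close> turns the previous bound into finiteness of
  the Young conjugate. The two properties of its real value \<open>r\<close> are exported so that
  later estimates stay in the reals.\<close>

lemma deriv_weight_aux:
  assumes m: "m \<ge> 1"
  obtains r where "deriv_weight \<omega> m k = exp (- (real m * r))"
    "\<And>u. u \<ge> 0 \<Longrightarrow> (real k / real m) * u - \<omega> (exp u) \<le> r"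
    "\<And>b. (\<And>u. u \<ge> 0 \<Longrightarrow> (real k / real m) * u - \<omega> (exp u) \<le> b) \<Longrightarrow> r \<le> b"
proof -
  let ?g = "\<lambda>u. (real k / real m) * u - \<omega> (exp u)"
  obtain C where C: "\<And>t. t \<ge> 1 \<Longrightarrow> t ^ k * exp (- real m * \<omega> t) \<le> C"
    using power_exp_bounded[OF m] by blast
  have gC: "?g u \<le> ln C / real m" if u: "u \<ge> 0" for u
  proof -
    have "exp (real k * u - real m * \<omega> (exp u)) \<le> C"
      using C[of "exp u"] u by (simp add: exp_diff_nat_mult)
    moreover from this have "C > 0" by (meson exp_gt_zero less_le_trans)
    ultimately have "real k * u - real m * \<omega> (exp u) \<le> ln C" by (simp add: ln_ge_iff)
    then show ?thesis using diff_quotient_le[OF m] by blast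
  qed
  have bdd: "bdd_above (?g ` {0..})" using gC by (intro bdd_aboveI2) auto
  define r where "r = (SUP u\<in>{0..}. ?g u)"
  have *: "?g u \<le> r" if "u \<ge> 0" for u
    unfolding r_def using that bdd by (intro cSUP_upper) auto
  have least: "r \<le> b" if "\<And>u. u \<ge> 0 \<Longrightarrow> ?g u \<le> b" for b
    unfolding r_def using that by (intro cSUP_least) auto
  have "young_conj \<omega> (real k / real m) = ereal r"
    unfolding young_conj_def
  proof (rule antisym)
    show "(SUP t\<in>{0..}. ereal (?g t)) \<le> ereal r" using * by (intro SUP_least) auto
    show "ereal r \<le> (SUP t\<in>{0..}. ereal (?g t))"
    proof (rule ereal_le_epsilon2)
      fix e :: real assume "e > 0"
      then have "\<exists>u\<in>{0..}. r - e < ?g u"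
        unfolding r_def using bdd by (subst less_cSUP_iff[symmetric]) auto
      then obtain u where u: "u \<ge> 0" "r < ?g u + e" by (auto simp: algebra_simps)
      then have "ereal r \<le> ereal (?g u) + ereal e" by simp
      also have "\<dots> \<le> (SUP t\<in>{0..}. ereal (?g t)) + ereal e"
        using u by (intro add_right_mono SUP_upper2[of u]) auto
      finally show "ereal r \<le> (SUP t\<in>{0..}. ereal (?g t)) + ereal e" .
    qed
  qed
  then have "deriv_weight \<omega> m k = exp (- (real m * r))"
    by (simp add: deriv_weight_def exp_neg_def)
  then show ?thesis using that * least by blast
qed

lemma deriv_weight_pos: "m \<ge> 1 \<Longrightarrow> 0 < deriv_weight \<omega> m k"
  by (metis deriv_weight_aux exp_gt_zero)

lemma deriv_weight_upper:
  assumes "m \<ge> 1" "t \<ge> 1"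
  shows "t ^ k * deriv_weight \<omega> m k \<le> exp (real m * \<omega> t)"
proof -
  obtain r where r: "deriv_weight \<omega> m k = exp (- (real m * r))"
    "\<And>u. u \<ge> 0 \<Longrightarrow> (real k / real m) * u - \<omega> (exp u) \<le> r"
    using deriv_weight_aux[OF assms(1), where k = k] by metis
  have "(real k / real m) * ln t - \<omega> t \<le> r" using r(2)[of "ln t"] assms by simp
  then have "real k * ln t - real m * \<omega> t \<le> real m * r" using assms by (simp add: field_simps)
  then have "exp (real k * ln t + - (real m * r)) \<le> exp (real m * \<omega> t)" by simp
  then show ?thesis unfolding r(1) using assms(2) by (simp only: exp_add) (simp add: exp_of_nat_mult)
qed

text \<open>The least-upper-bound half of the reciprocal supremum. It is used contrapositively:
  \<open>b * deriv_weight \<omega> m k < 1\<close> yields a \<open>t\<close> at which the expression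
  exceeds \<open>b\<close>.\<close>

lemma deriv_weight_lower:
  assumes "m \<ge> 1" "\<And>t. t \<ge> 1 \<Longrightarrow> t ^ k * exp (- (real m * \<omega> t)) \<le> c"
  shows "1 \<le> c * deriv_weight \<omega> m k"
proof -
  obtain r where r: "deriv_weight \<omega> m k = exp (- (real m * r))"
    "\<And>b. (\<And>u. u \<ge> 0 \<Longrightarrow> (real k / real m) * u - \<omega> (exp u) \<le> b) \<Longrightarrow> r \<le> b"
    using deriv_weight_aux[OF assms(1), where k = k] by metis
  \<comment> \<open>The value at \<open>t = 1\<close> makes \<open>c\<close> positive, which
    \<open>ln c\<close> needs.\<close>
  have "0 < 1 ^ k * exp (- (real m * \<omega> 1))" by simp
  also have "\<dots> \<le> c" using assms(2)[of 1] by simp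
  finally have c: "c > 0" .
  have "r \<le> ln c / real m"
  proof (rule r(2))
    fix u :: real assume u: "u \<ge> 0"
    have "exp (real k * u - real m * \<omega> (exp u)) \<le> c"
      using assms(2)[of "exp u"] u by (simp add: exp_diff_nat_mult)
    then have "real k * u - real m * \<omega> (exp u) \<le> ln c" using c by (simp add: ln_ge_iff)
    then show "(real k / real m) * u - \<omega> (exp u) \<le> ln c / real m"
      using diff_quotient_le[OF assms(1)] by blast
  qed
  then have "0 \<le> ln c - real m * r" using assms(1) by (simp add: field_simps)
  then have "1 \<le> exp (ln c + - (real m * r))" by simp
  then show ?thesis unfolding r(1) exp_add using c by simp
qed

lemma deriv_weight_le_1: "m \<ge> 1 \<Longrightarrow> deriv_weight \<omega> m k \<le> 1"
  using deriv_weight_upper[of m 1 k] eq_0[of 1] by simp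

lemma deriv_weight_0: "m \<ge> 1 \<Longrightarrow> deriv_weight \<omega> m 0 = 1"
  using deriv_weight_lower[of m 0 1] deriv_weight_le_1[of m 0] by (simp add: nonneg)

lemma power_le_deriv_weight:
  assumes "m \<ge> 1" "t \<ge> 0"
  shows "t ^ k * deriv_weight \<omega> m k \<le> exp (real m * \<omega> t)"
proof (cases "t \<ge> 1")
  case False
  have "t ^ k * deriv_weight \<omega> m k \<le> 1 * 1"
    using False assms deriv_weight_le_1 deriv_weight_pos[of m k]
    by (intro mult_mono power_le_one) auto
  also have "\<dots> \<le> exp (real m * \<omega> t)" using assms nonneg by simp
  finally show ?thesis .
qed (use assms deriv_weight_upper in auto)

text \<open>At a maximiser up to a factor 2, \<open>t ^ k * deriv_weight \<omega> (Suc n) k\<close>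
  exceeds half of \<open>exp (Suc n * \<omega> t)\<close>. The surplus over order \<open>n\<close>
  is \<open>exp (\<omega> t)\<close>, which beats any constant once \<open>t\<close> is large, and a
  large \<open>k\<close> forces \<open>t\<close> to be large.\<close>

lemma deriv_weight_growth:
  fixes n :: nat
  shows "\<exists>k t. t \<ge> 1 \<and> c * exp (real n * \<omega> t) < t ^ k * deriv_weight \<omega> (Suc n) k"
proof -
  define d where "d = max c 1"
  obtain M where M: "M \<ge> 1" "\<omega> M > ln (2 * d)" using unbounded by blast
  have d: "d \<ge> 1" by (simp add: d_def)
  have expM: "2 * d < exp (\<omega> M)" using M(2) d by (subst ln_less_cancel_iff[symmetric]) auto
  \<comment> \<open>Such a \<open>k\<close> makes the value at \<open>2 * M\<close> exceed
    \<open>M ^ k\<close>, which bounds all values at \<open>t \<le> M\<close>; good points therefore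
    lie beyond \<open>M\<close>.\<close>
  obtain k where "exp (real (Suc n) * \<omega> (2 * M)) < 2 ^ k"
    using real_arch_pow[of 2] by auto
  then have "M ^ k * exp (real (Suc n) * \<omega> (2 * M)) < M ^ k * 2 ^ k"
    using M by (intro mult_strict_left_mono) auto
  then have big: "M ^ k < (2 * M) ^ k * exp (- (real (Suc n) * \<omega> (2 * M)))"
    unfolding power_mult_distrib[of 2] by (subst less_mult_exp_minus[symmetric]) (simp add: mult.commute)
  define D where "D = deriv_weight \<omega> (Suc n) k"
  have D: "D > 0" unfolding D_def by (rule deriv_weight_pos) simp
  have "(2 * M) ^ k * D \<le> exp (real (Suc n) * \<omega> (2 * M))"
    unfolding D_def using M(1) by (intro deriv_weight_upper) auto
  then have "(2 * M) ^ k * exp (- (real (Suc n) * \<omega> (2 * M))) * D \<le> 1"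
    using le_mult_exp_minus[of "(2 * M) ^ k * D" 1 "real (Suc n) * \<omega> (2 * M)"] by (simp add: mult_ac)
  then have MD: "M ^ k * D < 1" using mult_strict_right_mono[OF big D] by simp
  \<comment> \<open>The first entry forces \<open>t > M\<close>, the second makes \<open>t\<close> a
    maximiser up to a factor 2; both are below the supremum \<open>1 / D\<close>.\<close>
  define b where "b = max (M ^ k) (1 / (2 * D))"
  have "b * D < 1" using MD D by (simp add: b_def max_def)
  then obtain t where t: "t \<ge> 1" "t ^ k * exp (- (real (Suc n) * \<omega> t)) > b"
    using deriv_weight_lower[of "Suc n" k b] unfolding D_def by fastforce
  have "t ^ k * exp (- (real (Suc n) * \<omega> t)) \<le> t ^ k * 1"
    using t(1) nonneg[of t] by (intro mult_left_mono) auto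
  then have "M ^ k < t ^ k" using t(2) by (simp add: b_def)
  then have "M < t" using M t(1) by (metis less_le_not_le linorder_not_less order.trans power_mono zero_le_one)
  then have "2 * d < exp (\<omega> t)" using expM mono[of M t] M(1) by (smt (verit) exp_le_cancel_iff)
  have "1 / 2 < t ^ k * D * exp (- (real (Suc n) * \<omega> t))"
    using t(2) D by (simp add: b_def field_simps)
  then have "exp (real (Suc n) * \<omega> t) < 2 * (t ^ k * D)"
    unfolding less_mult_exp_minus[symmetric] by simp
  then have "exp (\<omega> t) * exp (real n * \<omega> t) < 2 * (t ^ k * D)"
    by (simp add: exp_add[symmetric] algebra_simps)
  moreover have "2 * d * exp (real n * \<omega> t) \<le> exp (\<omega> t) * exp (real n * \<omega> t)"
    using \<open>2 * d < exp (\<omega> t)\<close> by (intro mult_right_mono) auto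
  moreover have "c * exp (real n * \<omega> t) \<le> d * exp (real n * \<omega> t)"
    by (simp add: d_def)
  ultimately have "c * exp (real n * \<omega> t) < t ^ k * D" by linarith
  then show ?thesis using t(1) unfolding D_def by blast
qed

end

section \<open>Iterated partial derivatives\<close>

abbreviation pderivs :: "'n list \<Rightarrow> (real ^ 'n::finite \<Rightarrow> complex) \<Rightarrow> real ^ 'n \<Rightarrow> complex" where
  "pderivs is f \<equiv> foldr partial_deriv is f"

text \<open>As a list of directions, a multi-index derivative becomes \<open>pderivs\<close>, the
  form in which \<open>smooth\<close> is stated and on which list induction runs.\<close>

definition word :: "('n::finite \<Rightarrow> nat) \<Rightarrow> 'n list" where
  "word \<alpha> = concat (map (\<lambda>i. replicate (\<alpha> i) i) coords)"

lemma coords: "distinct (coords :: 'n::finite list)" "set (coords :: 'n list) = UNIV"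
proof -
  have "\<exists>is :: 'n list. distinct is \<and> set is = UNIV"
    using finite_distinct_list[of "UNIV :: 'n set"] by auto
  then show "distinct (coords :: 'n list)" "set (coords :: 'n list) = UNIV"
    unfolding coords_def by (metis (mono_tags, lifting) someI_ex)+
qed

lemma multi_deriv_word: "multi_deriv \<alpha> f = pderivs (word \<alpha>) f"
proof -
  have "foldr (\<lambda>i. partial_deriv i ^^ \<alpha> i) is f = pderivs (concat (map (\<lambda>i. replicate (\<alpha> i) i) is)) f" for "is"
    by (induction "is") auto
  then show ?thesis by (simp add: multi_deriv_def word_def)
qed

lemma length_word: "length (word \<alpha>) = multi_order \<alpha>"
  by (simp add: word_def multi_order_def length_concat o_def sum_list_distinct_conv_sum_set coords)

lemma word_single: "word (\<lambda>j. if j = i then k else 0) = replicate k i"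
proof -
  have "concat (map (\<lambda>j. replicate (if j = i then k else 0) j) is) =
      (if i \<in> set is then replicate k i else [])" if "distinct is" for "is"
    using that by (induction "is") auto
  then show ?thesis by (simp add: word_def coords)
qed

lemma smooth_pderivs: "smooth f \<Longrightarrow> smooth (pderivs is f)"
  unfolding smooth_def by (metis foldr_append comp_apply)

lemma smooth_differentiable: "smooth f \<Longrightarrow> f differentiable (at x)"
  unfolding smooth_def by (metis foldr.simps(1) id_apply)

lemma smooth_continuous: "smooth f \<Longrightarrow> continuous_on UNIV f"
  by (meson continuous_at_imp_continuous_on differentiable_imp_continuous_within smooth_differentiable)

lemma partial_deriv_eqI: "(f has_derivative f') (at x) \<Longrightarrow> partial_deriv i f x = f' (axis i 1)"
  unfolding partial_deriv_def by (metis frechet_derivative_at)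

lemma pderivs_linear:
  assumes "smooth f" "smooth g"
  shows "pderivs is (\<lambda>x. a * f x + b * g x) = (\<lambda>x. a * pderivs is f x + b * pderivs is g x)"
proof (induction "is")
  case (Cons i "is")
  have "partial_deriv i (\<lambda>x. a * pderivs is f x + b * pderivs is g x) x =
      a * partial_deriv i (pderivs is f) x + b * partial_deriv i (pderivs is g) x" for x
  proof -
    have "(pderivs is f has_derivative frechet_derivative (pderivs is f) (at x)) (at x)"
      "(pderivs is g has_derivative frechet_derivative (pderivs is g) (at x)) (at x)"
      using assms unfolding smooth_def by (simp_all add: frechet_derivative_works[symmetric])
    then have "((\<lambda>x. a * pderivs is f x + b * pderivs is g x) has_derivative
      (\<lambda>h. a * frechet_derivative (pderivs is f) (at x) h + b * frechet_derivative (pderivs is g) (at x) h)) (at x)"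
      by (intro derivative_intros)
    from partial_deriv_eqI[OF this] show ?thesis by (simp add: partial_deriv_def)
  qed
  then show ?case unfolding foldr.simps o_apply Cons.IH by (rule ext)
qed simp

lemma smooth_linear:
  assumes "smooth f" "smooth g"
  shows "smooth (\<lambda>x. a * f x + b * g x)"
  using assms unfolding smooth_def pderivs_linear[OF assms]
  by (intro allI differentiable_add differentiable_mult differentiable_const) auto

lemma pderivs_translate:
  assumes "smooth f"
  shows "pderivs is (\<lambda>y. f (x + y)) = (\<lambda>y. pderivs is f (x + y))"
proof (induction "is")
  case (Cons i "is")
  have "partial_deriv i (\<lambda>y. pderivs is f (x + y)) y = partial_deriv i (pderivs is f) (x + y)" for y
  proof -
    have "(pderivs is f has_derivative frechet_derivative (pderivs is f) (at (x + y))) (at (x + y))"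
      using assms unfolding smooth_def by (simp add: frechet_derivative_works[symmetric])
    moreover have "((\<lambda>y. x + y) has_derivative (\<lambda>h. h)) (at y)"
      by (auto intro!: derivative_eq_intros)
    ultimately have "((\<lambda>y. pderivs is f (x + y)) has_derivative frechet_derivative (pderivs is f) (at (x + y))) (at y)"
      by (rule has_derivative_compose[where f' = "\<lambda>h. h", rotated])
    from partial_deriv_eqI[OF this] show ?thesis by (simp add: partial_deriv_def)
  qed
  then show ?case unfolding foldr.simps o_apply Cons.IH by (rule ext)
qed simp

lemma smooth_translate:
  assumes "smooth f"
  shows "smooth (\<lambda>y. f (x + y))"
  unfolding smooth_def pderivs_translate[OF assms]
proof (intro allI)
  fix "is" y
  have "pderivs is f differentiable (at (x + y))" using assms by (simp add: smooth_def)
  then show "(\<lambda>y. pderivs is f (x + y)) differentiable at y"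
    by (intro differentiable_compose[of "pderivs is f" "\<lambda>y. x + y"]) auto
qed

section \<open>Continuity and boundedness in the multiplier space\<close>

abbreviation step_union :: "(real \<Rightarrow> real) \<Rightarrow> nat \<Rightarrow> (real ^ 'n \<Rightarrow> complex) set" where
  "step_union \<omega> m \<equiv> \<Union>n\<in>{1..}. O_step \<omega> m n"

definition linear_on :: "('x \<Rightarrow> complex) set \<Rightarrow> (('x \<Rightarrow> complex) \<Rightarrow> complex) \<Rightarrow> bool" where
  "linear_on V L \<longleftrightarrow> (\<forall>f\<in>V. \<forall>g\<in>V. L (\<lambda>x. f x + g x) = L f + L g) \<and> (\<forall>c. \<forall>f\<in>V. L (\<lambda>x. c * f x) = c * L f)"

lemma linear_on_add: "linear_on V L \<Longrightarrow> f \<in> V \<Longrightarrow> g \<in> V \<Longrightarrow> L (\<lambda>x. f x + g x) = L f + L g"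
  and linear_on_scale: "linear_on V L \<Longrightarrow> f \<in> V \<Longrightarrow> L (\<lambda>x. c * f x) = c * L f"
  by (simp_all add: linear_on_def)

lemma O_weighted_alt:
  "O_weighted \<omega> m n f \<alpha> x =
     cmod (pderivs (word \<alpha>) f x) * exp (- real n * \<omega> (norm x)) * deriv_weight \<omega> m (length (word \<alpha>))"
  by (simp add: O_weighted_def multi_deriv_word deriv_weight_def length_word)

text \<open>The estimates below hold for arbitrary lists, so canonical words need no separate
  treatment.\<close>

lemma O_step_I:
  assumes "smooth f"
    and "\<And>is x. cmod (pderivs is f x) * exp (- real n * \<omega> (norm x)) * deriv_weight \<omega> m (length is) \<le> C"
  shows "f \<in> O_step \<omega> m n" "O_norm \<omega> m n f \<le> C"
  using assms unfolding O_step_def O_norm_def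
  by (auto simp: O_weighted_alt intro!: bdd_aboveI2[where M = C] cSUP_least)

lemma O_weighted_le_O_norm:
  assumes "f \<in> O_step \<omega> m n"
  shows "O_weighted \<omega> m n f \<alpha> x \<le> O_norm \<omega> m n f"
  using assms cSUP_upper[of "(\<alpha>, x)" UNIV "\<lambda>(\<alpha>, x). O_weighted \<omega> m n f \<alpha> x"]
  by (simp add: O_step_def O_norm_def)

text \<open>A bound uniform over the family on each step, with a constant depending on the step, is
  what places the supremum among the seminorms that define the inductive limit.\<close>

lemma ind_seminorm_SUP:
  assumes J: "J \<noteq> {}" and lin: "\<And>j. j \<in> J \<Longrightarrow> linear_on (\<Union>n\<in>{1..}. E n) (L j)"
    and bound: "\<And>n. n \<ge> 1 \<Longrightarrow> \<exists>C. \<forall>j\<in>J. \<forall>f\<in>E n. cmod (L j f) \<le> C * r n f"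
  shows "ind_seminorm E r (\<lambda>f. SUP j\<in>J. cmod (L j f))"
    and "f \<in> (\<Union>n\<in>{1..}. E n) \<Longrightarrow> j \<in> J \<Longrightarrow> cmod (L j f) \<le> (SUP j\<in>J. cmod (L j f))"
proof -
  let ?V = "\<Union>n\<in>{1..}. E n"
  let ?p = "\<lambda>f. SUP j\<in>J. cmod (L j f)"
  have bdd: "bdd_above ((\<lambda>j. cmod (L j f)) ` J)" if f: "f \<in> ?V" for f
  proof -
    obtain n where n: "n \<ge> 1" "f \<in> E n" using f by auto
    obtain C where "\<forall>j\<in>J. \<forall>f\<in>E n. cmod (L j f) \<le> C * r n f" using bound[OF n(1)] by blast
    then show ?thesis using n(2) by (intro bdd_aboveI2[where M = "C * r n f"]) auto
  qed
  show up: "cmod (L j f) \<le> ?p f" if "f \<in> ?V" "j \<in> J" for f j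
    using bdd[OF that(1)] that(2) by (intro cSUP_upper) auto
  have pos: "0 \<le> ?p f" if "f \<in> ?V" for f
    using J up[OF that] by (meson all_not_in_conv norm_ge_zero order_trans)
  show "ind_seminorm E r ?p"
    unfolding ind_seminorm_def seminorm_on_def
  proof (intro conjI ballI allI impI)
    fix f g assume fg: "f \<in> ?V" "g \<in> ?V"
    show "?p (\<lambda>x. f x + g x) \<le> ?p f + ?p g"
    proof (rule cSUP_least[OF J])
      fix j assume j: "j \<in> J"
      have eq: "L j (\<lambda>x. f x + g x) = L j f + L j g" using lin[OF j] fg unfolding linear_on_def by blast
      show "cmod (L j (\<lambda>x. f x + g x)) \<le> ?p f + ?p g"
        unfolding eq using norm_triangle_ineq[of "L j f" "L j g"] up[OF fg(1) j] up[OF fg(2) j] by linarith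
    qed
  next
    fix c f assume f: "f \<in> ?V"
    have eq: "cmod (L j (\<lambda>x. c * f x)) = cmod c * cmod (L j f)" if "j \<in> J" for j
    proof -
      have "L j (\<lambda>x. c * f x) = c * L j f" using lin[OF that] f unfolding linear_on_def by blast
      then show ?thesis by (simp add: norm_mult)
    qed
    have 1: "(SUP j\<in>J. cmod c * cmod (L j f)) \<le> cmod c * ?p f"
      using up[OF f] by (intro cSUP_least[OF J] mult_left_mono) auto
    have 2: "cmod c * ?p f \<le> (SUP j\<in>J. cmod c * cmod (L j f))"
    proof (cases "c = 0")
      case True
      then show ?thesis using J by simp
    next
      case False
      have bdd': "bdd_above ((\<lambda>j. cmod c * cmod (L j f)) ` J)"
        using up[OF f] by (intro bdd_aboveI2[where M = "cmod c * ?p f"] mult_left_mono) auto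
      have "?p f \<le> (SUP j\<in>J. cmod c * cmod (L j f)) / cmod c"
      proof (rule cSUP_least[OF J])
        fix j assume "j \<in> J"
        then have "cmod c * cmod (L j f) \<le> (SUP j\<in>J. cmod c * cmod (L j f))"
          using bdd' by (intro cSUP_upper) auto
        then show "cmod (L j f) \<le> (SUP j\<in>J. cmod c * cmod (L j f)) / cmod c"
          using False by (simp add: field_simps)
      qed
      then show ?thesis using False by (simp add: field_simps)
    qed
    have "?p (\<lambda>x. c * f x) = (SUP j\<in>J. cmod c * cmod (L j f))"
      using eq by (intro SUP_cong) auto
    then show "?p (\<lambda>x. c * f x) = cmod c * ?p f" using 1 2 by linarith
  next
    fix n :: nat assume n: "1 \<le> n"
    obtain C where "\<forall>j\<in>J. \<forall>f\<in>E n. cmod (L j f) \<le> C * r n f" using bound[OF n] by blast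
    then have "\<forall>f\<in>E n. ?p f \<le> C * r n f" by (auto intro!: cSUP_least[OF J])
    then show "\<exists>C. \<forall>f\<in>E n. ?p f \<le> C * r n f" by blast
  qed
qed

lemma ind_seminorm_scale:
  assumes "ind_seminorm E r p" "f \<in> (\<Union>n\<in>{1..}. E n)"
  shows "p (\<lambda>x. c * f x) = cmod c * p f"
  using assms unfolding ind_seminorm_def seminorm_on_def by blast

lemma linear_on_pderivs:
  assumes "\<And>f. f \<in> V \<Longrightarrow> smooth f"
  shows "linear_on V (\<lambda>f. c * pderivs is f x)"
  unfolding linear_on_def
proof (intro conjI ballI allI)
  fix f g assume "f \<in> V" "g \<in> V"
  then have "pderivs is (\<lambda>x. 1 * f x + 1 * g x) = (\<lambda>x. 1 * pderivs is f x + 1 * pderivs is g x)"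
    by (intro pderivs_linear assms)
  then show "c * pderivs is (\<lambda>x. f x + g x) x = c * pderivs is f x + c * pderivs is g x"
    by (simp add: distrib_left)
next
  fix a f assume "f \<in> V"
  then have "pderivs is (\<lambda>x. a * f x + 0 * f x) = (\<lambda>x. a * pderivs is f x + 0 * pderivs is f x)"
    by (intro pderivs_linear assms)
  then show "c * pderivs is (\<lambda>x. a * f x) x = a * (c * pderivs is f x)"
    by simp
qed

context weight
begin

lemma O_weighted_antimono:
  assumes "m \<ge> 1" "n \<le> N"
  shows "O_weighted \<omega> m N f \<alpha> x \<le> O_weighted \<omega> m n f \<alpha> x"
proof -
  have "real n * \<omega> (norm x) \<le> real N * \<omega> (norm x)"
    using assms(2) nonneg by (intro mult_right_mono) auto
  then have "exp (- real N * \<omega> (norm x)) \<le> exp (- real n * \<omega> (norm x))" by simp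
  then show ?thesis
    unfolding O_weighted_alt using deriv_weight_pos[OF assms(1), of "length (word \<alpha>)"]
    by (intro mult_right_mono mult_left_mono) auto
qed

lemma O_step_combination:
  assumes m: "m \<ge> 1" and f: "f \<in> O_step \<omega> m n" and g: "g \<in> O_step \<omega> m n'" and N: "n \<le> N" "n' \<le> N"
  shows "(\<lambda>x. a * f x + b * g x) \<in> O_step \<omega> m N"
proof -
  have s: "smooth f" "smooth g" using f g by (auto simp: O_step_def)
  have "O_weighted \<omega> m N (\<lambda>x. a * f x + b * g x) \<alpha> x \<le> cmod a * O_norm \<omega> m n f + cmod b * O_norm \<omega> m n' g" for \<alpha> x
  proof -
    let ?w = "exp (- real N * \<omega> (norm x)) * deriv_weight \<omega> m (length (word \<alpha>))"
    let ?D = "\<lambda>f. cmod (pderivs (word \<alpha>) f x)"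
    have w: "?w \<ge> 0" using deriv_weight_pos[OF m, of "length (word \<alpha>)"] by simp
    have "?D (\<lambda>x. a * f x + b * g x) \<le> cmod a * ?D f + cmod b * ?D g"
      by (simp add: pderivs_linear s norm_mult[symmetric] norm_triangle_ineq)
    from mult_right_mono[OF this w]
    have "O_weighted \<omega> m N (\<lambda>x. a * f x + b * g x) \<alpha> x \<le>
        cmod a * O_weighted \<omega> m N f \<alpha> x + cmod b * O_weighted \<omega> m N g \<alpha> x"
      by (simp add: O_weighted_alt algebra_simps)
    moreover have "O_weighted \<omega> m N f \<alpha> x \<le> O_norm \<omega> m n f"
      using O_weighted_antimono[OF m N(1)] O_weighted_le_O_norm[OF f] by (rule order_trans)
    moreover have "O_weighted \<omega> m N g \<alpha> x \<le> O_norm \<omega> m n' g"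
      using O_weighted_antimono[OF m N(2)] O_weighted_le_O_norm[OF g] by (rule order_trans)
    ultimately show ?thesis
      by (meson add_mono mult_left_mono norm_ge_zero order_trans)
  qed
  then show ?thesis
    unfolding O_step_def using smooth_linear[OF s]
    by (auto intro!: bdd_aboveI2[where M = "cmod a * O_norm \<omega> m n f + cmod b * O_norm \<omega> m n' g"])
qed

lemma step_union_combination:
  assumes "m \<ge> 1" "f \<in> step_union \<omega> m" "g \<in> step_union \<omega> m"
  shows "(\<lambda>x. a * f x + b * g x) \<in> step_union \<omega> m"
proof -
  obtain n n' where "n \<ge> 1" "n' \<ge> 1" "f \<in> O_step \<omega> m n" "g \<in> O_step \<omega> m n'"
    using assms(2,3) by auto
  then have "(\<lambda>x. a * f x + b * g x) \<in> O_step \<omega> m (max n n')" "max n n' \<ge> 1"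
    using O_step_combination[OF assms(1), of f n g n' "max n n'"] by auto
  then show ?thesis by blast
qed

lemma step_union_diff:
  assumes "m \<ge> 1" "f \<in> step_union \<omega> m" "g \<in> step_union \<omega> m"
  shows "(\<lambda>x. f x - g x) \<in> step_union \<omega> m"
  using step_union_combination[OF assms, of 1 "-1"] by simp

lemma OM_space_eq: "OM_space \<omega> = (\<Inter>m\<in>{1..}. step_union \<omega> m)"
  by (simp add: OM_space_def)

lemma OM_spaceD: "f \<in> OM_space \<omega> \<Longrightarrow> m \<ge> 1 \<Longrightarrow> f \<in> step_union \<omega> m"
  by (simp add: OM_space_def)

lemma step_union_smooth: "f \<in> step_union \<omega> m \<Longrightarrow> smooth f"
  by (auto simp: O_step_def)

lemma OM_combination:
  "f \<in> OM_space \<omega> \<Longrightarrow> g \<in> OM_space \<omega> \<Longrightarrow> (\<lambda>x. a * f x + b * g x) \<in> OM_space \<omega>"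
  unfolding OM_space_eq by (intro INT_I step_union_combination) auto

lemma OM_add: "f \<in> OM_space \<omega> \<Longrightarrow> g \<in> OM_space \<omega> \<Longrightarrow> (\<lambda>x. f x + g x) \<in> OM_space \<omega>"
  using OM_combination[of f g 1 1] by simp

lemma OM_scale: "f \<in> OM_space \<omega> \<Longrightarrow> (\<lambda>x. c * f x) \<in> OM_space \<omega>"
  using OM_combination[of f f c 0] by simp

section \<open>Neighbourhoods, functionals and bounded sets in the multiplier space\<close>

lemma openin_OM_step_topology:
  assumes "m \<ge> 1"
  shows "openin (OM_step_topology \<omega> m) U \<longleftrightarrow> U \<subseteq> step_union \<omega> m \<and>
     (\<forall>f\<in>U. \<exists>p. ind_seminorm (O_step \<omega> m) (O_norm \<omega> m) p \<and>
        {g \<in> step_union \<omega> m. p (\<lambda>x. g x - f x) < 1} \<subseteq> U)"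
  unfolding OM_step_topology_def
  by (rule openin_ind_limit_topology) (rule step_union_diff[OF assms])

text \<open>Openness is tested by unit balls around each point, so at \<open>g\<close> the seminorm
  is rescaled by the slack \<open>d\<close> left below \<open>e\<close>; the triangle inequality
  does the rest.\<close>

lemma openin_seminorm_ball:
  fixes f :: "real ^ 'n \<Rightarrow> complex"
  assumes m: "m \<ge> 1" and p: "ind_seminorm (O_step \<omega> m) (O_norm \<omega> m) p"
    and f: "f \<in> step_union \<omega> m"
  shows "openin (OM_step_topology \<omega> m) {g \<in> step_union \<omega> m. p (\<lambda>x. g x - f x) < e}"
  unfolding openin_OM_step_topology[OF m]
proof (intro conjI ballI)
  fix g assume "g \<in> {g \<in> step_union \<omega> m. p (\<lambda>x. g x - f x) < e}"
  then have g: "g \<in> step_union \<omega> m" "p (\<lambda>x. g x - f x) < e" by auto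
  define d where "d = e - p (\<lambda>x. g x - f x)"
  have d: "d > 0" using g by (simp add: d_def)
  have sn: "seminorm_on (step_union \<omega> m) p" using p by (simp add: ind_seminorm_def)
  have "ind_seminorm (O_step \<omega> m) (O_norm \<omega> m) (\<lambda>h. p h / d)"
    unfolding ind_seminorm_def seminorm_on_def
  proof (intro conjI ballI allI impI)
    fix h k :: "real ^ 'n \<Rightarrow> complex" assume "h \<in> step_union \<omega> m" "k \<in> step_union \<omega> m"
    then have "p (\<lambda>x. h x + k x) \<le> p h + p k" using sn unfolding seminorm_on_def by blast
    then show "p (\<lambda>x. h x + k x) / d \<le> p h / d + p k / d"
      using d by (simp add: add_divide_distrib[symmetric] divide_right_mono)
  next
    fix c and h :: "real ^ 'n \<Rightarrow> complex" assume "h \<in> step_union \<omega> m"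
    then have "p (\<lambda>x. c * h x) = cmod c * p h" using sn unfolding seminorm_on_def by blast
    then show "p (\<lambda>x. c * h x) / d = cmod c * (p h / d)" by simp
  next
    fix n :: nat assume "1 \<le> n"
    then obtain C where C: "\<forall>f\<in>O_step \<omega> m n. p f \<le> C * O_norm \<omega> m n f"
      using p unfolding ind_seminorm_def by meson
    then show "\<exists>C. \<forall>f\<in>O_step \<omega> m n. p f / d \<le> C * O_norm \<omega> m n f"
      using d by (intro exI[of _ "C / d"]) (auto simp: divide_right_mono)
  qed
  moreover have "{h \<in> step_union \<omega> m. p (\<lambda>x. h x - g x) / d < 1}
      \<subseteq> {g \<in> step_union \<omega> m. p (\<lambda>x. g x - f x) < e}"
  proof
    fix h assume "h \<in> {h \<in> step_union \<omega> m. p (\<lambda>x. h x - g x) / d < 1}"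
    then have h: "h \<in> step_union \<omega> m" "p (\<lambda>x. h x - g x) < d" using d by auto
    have "p (\<lambda>x. (h x - g x) + (g x - f x)) \<le> p (\<lambda>x. h x - g x) + p (\<lambda>x. g x - f x)"
      using bspec[OF bspec[OF conjunct1[OF sn[unfolded seminorm_on_def]] step_union_diff[OF m h(1) g(1)]]
          step_union_diff[OF m g(1) f]] by simp
    then show "h \<in> {g \<in> step_union \<omega> m. p (\<lambda>x. g x - f x) < e}" using h by (simp add: d_def)
  qed
  ultimately show "\<exists>q. ind_seminorm (O_step \<omega> m) (O_norm \<omega> m) q \<and>
        {h \<in> step_union \<omega> m. q (\<lambda>x. h x - g x) < 1} \<subseteq> {g \<in> step_union \<omega> m. p (\<lambda>x. g x - f x) < e}"
    by (intro exI[of _ "\<lambda>h. p h / d"] conjI)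
qed blast

lemma openin_OM_seminorm_ball:
  assumes "m \<ge> 1" "ind_seminorm (O_step \<omega> m) (O_norm \<omega> m) p" "f \<in> OM_space \<omega>"
  shows "openin (OM_topology \<omega>) {g \<in> OM_space \<omega>. p (\<lambda>x. g x - f x) < e}"
proof -
  have "{g \<in> OM_space \<omega>. p (\<lambda>x. g x - f x) < e} =
      OM_space \<omega> \<inter> {g \<in> step_union \<omega> m. p (\<lambda>x. g x - f x) < e}"
    using OM_spaceD[OF _ assms(1)] by blast
  then show ?thesis
    unfolding OM_topology_def
    using openin_seminorm_ball[OF assms(1,2) OM_spaceD[OF assms(3,1)]] assms(1)
    by (intro topology_generated_by_Basis) blast
qed

lemma topspace_OM_topology [simp]: "topspace (OM_topology \<omega>) = (OM_space \<omega> :: (real ^ 'n \<Rightarrow> complex) set)"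
proof -
  \<comment> \<open>The zero seminorm shows that the whole union is open, which puts
    \<open>OM_space \<omega>\<close> itself among the generating sets.\<close>
  have "openin (OM_step_topology \<omega> 1) (step_union \<omega> 1 :: (real ^ 'n \<Rightarrow> complex) set)"
    unfolding openin_OM_step_topology[OF order_refl]
    by (auto intro!: exI[of _ "\<lambda>_. 0"] exI[of _ "0::real"] simp: ind_seminorm_def seminorm_on_def)
  moreover have "OM_space \<omega> \<subseteq> (step_union \<omega> 1 :: (real ^ 'n \<Rightarrow> complex) set)" using OM_spaceD by blast
  ultimately have "OM_space \<omega> \<in> {OM_space \<omega> \<inter> U |U m. 1 \<le> m \<and> openin (OM_step_topology \<omega> m) (U :: (real ^ 'n \<Rightarrow> complex) set)}"
    by blast
  then show ?thesis unfolding OM_topology_def topology_generated_by_topspace by blast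
qed

lemma zero_OM_step: "m \<ge> 1 \<Longrightarrow> (\<lambda>x. 0) \<in> O_step \<omega> m n"
proof -
  have d: "pderivs is (\<lambda>x. 0 :: complex) = (\<lambda>x. 0)" for "is" :: "'a list"
    by (induction "is") (auto simp: fun_eq_iff intro!: partial_deriv_eqI)
  then show ?thesis by (intro O_step_I[of _ _ _ _ 0]) (auto simp: smooth_def)
qed

lemma zero_OM: "(\<lambda>x. 0) \<in> OM_space \<omega>"
  using zero_OM_step by (auto simp: OM_space_def)

text \<open>The unit ball of the supremum of the family is a neighbourhood of 0, so it absorbs
  \<open>D\<close>; the absorbing scalar \<open>s\<close> is itself the bound.\<close>

lemma vn_bounded_family:
  assumes m: "m \<ge> 1" and J: "J \<noteq> {}" and lin: "\<And>j. j \<in> J \<Longrightarrow> linear_on (step_union \<omega> m) (L j)"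
    and bound: "\<And>n. n \<ge> 1 \<Longrightarrow> \<exists>C. \<forall>j\<in>J. \<forall>f\<in>O_step \<omega> m n. cmod (L j f) \<le> C * O_norm \<omega> m n f"
    and D: "vn_bounded (OM_topology \<omega>) D"
  shows "\<exists>C>0. \<forall>f\<in>D. \<forall>j\<in>J. cmod (L j f) \<le> C"
proof -
  define p where "p = (\<lambda>f. SUP j\<in>J. cmod (L j f))"
  have p: "ind_seminorm (O_step \<omega> m) (O_norm \<omega> m) p"
    and le: "\<And>f j. f \<in> step_union \<omega> m \<Longrightarrow> j \<in> J \<Longrightarrow> cmod (L j f) \<le> p f"
    unfolding p_def using ind_seminorm_SUP[OF J lin bound] by blast+
  have "p (\<lambda>x. 0 * 0) = cmod 0 * p (\<lambda>x. 0)"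
    using ind_seminorm_scale[OF p OM_spaceD[OF zero_OM m]] .
  then have p0: "p (\<lambda>x. 0) = 0" by simp
  let ?U = "{g \<in> OM_space \<omega>. p (\<lambda>x. g x - 0) < 1}"
  have "openin (OM_topology \<omega>) ?U" "(\<lambda>x. 0) \<in> ?U"
    using openin_OM_seminorm_ball[OF m p zero_OM] zero_OM p0 by auto
  then obtain s where s: "s > 0" "\<forall>t\<ge>s. \<forall>f\<in>D. (\<lambda>x. f x / complex_of_real t) \<in> ?U"
    using D unfolding vn_bounded_def by blast
  have "cmod (L j f) \<le> s" if f: "f \<in> D" and j: "j \<in> J" for f j
  proof -
    have fV: "f \<in> step_union \<omega> m"
      using D f OM_spaceD[OF _ m] by (auto simp: vn_bounded_def)
    have "p (\<lambda>x. f x / complex_of_real s) < 1" using s f by auto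
    moreover have "p (\<lambda>x. inverse (complex_of_real s) * f x) = cmod (inverse (complex_of_real s)) * p f"
      using ind_seminorm_scale[OF p fV] .
    then have "p (\<lambda>x. f x / complex_of_real s) = p f / s"
      using s by (simp add: divide_inverse mult.commute norm_inverse)
    ultimately have "p f < s" using s by simp
    then show ?thesis using le[OF fV j] by simp
  qed
  then show ?thesis using s by blast
qed

text \<open>Bounds on the steps of a single \<open>m\<close> suffice because the topology is initial
  for the inclusions into the inductive limits.\<close>

lemma restrict_in_OM_dual:
  fixes L :: "(real ^ 'n \<Rightarrow> complex) \<Rightarrow> complex"
  assumes m: "m \<ge> 1" and lin: "linear_on (step_union \<omega> m) L"
    and bound: "\<And>n. n \<ge> 1 \<Longrightarrow> \<exists>C. \<forall>f\<in>O_step \<omega> m n. cmod (L f) \<le> C * O_norm \<omega> m n f"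
  shows "restrict L (OM_space \<omega>) \<in> OM_dual \<omega>"
proof -
  have p: "ind_seminorm (O_step \<omega> m) (O_norm \<omega> m) (\<lambda>f. cmod (L f))"
    using ind_seminorm_SUP(1)[of "{()}" "O_step \<omega> m" "\<lambda>_. L"] lin bound by simp
  have V: "f \<in> step_union \<omega> m" if "f \<in> OM_space \<omega>" for f :: "real ^ 'n \<Rightarrow> complex"
    using OM_spaceD[OF that m] .
  have "continuous_map (OM_topology \<omega>) euclidean (restrict L (OM_space \<omega>))"
    unfolding continuous_map
  proof (intro conjI allI impI)
    fix U :: "complex set" assume "openin euclidean U"
    then have U: "open U" by simp
    let ?A = "{f \<in> topspace (OM_topology \<omega>). restrict L (OM_space \<omega>) f \<in> U}"
    show "openin (OM_topology \<omega>) ?A"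
    proof (subst openin_subopen, intro ballI)
      fix f assume "f \<in> ?A"
      then have f: "f \<in> OM_space \<omega>" "L f \<in> U" by auto
      obtain e where e: "e > 0" "ball (L f) e \<subseteq> U" using U f(2) open_contains_ball by blast
      have "{g \<in> OM_space \<omega>. cmod (L (\<lambda>x. g x - f x)) < e} \<subseteq> ?A"
      proof
        fix g assume "g \<in> {g \<in> OM_space \<omega>. cmod (L (\<lambda>x. g x - f x)) < e}"
        then have g: "g \<in> OM_space \<omega>" "cmod (L (\<lambda>x. g x - f x)) < e" by auto
        have "L (\<lambda>x. (g x - f x) + f x) = L (\<lambda>x. g x - f x) + L f"
          using linear_on_add[OF lin step_union_diff[OF m V[OF g(1)] V[OF f(1)]] V[OF f(1)]] .
        then have "dist (L f) (L g) < e" using g(2) by (simp add: dist_norm norm_minus_commute)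
        then show "g \<in> ?A" using e g by auto
      qed
      moreover have "cmod (L (\<lambda>x. f x - f x)) < e"
      proof -
        have "L (\<lambda>x. 0 * f x) = 0 * L f" using linear_on_scale[OF lin V[OF f(1)]] .
        then show ?thesis using e(1) by simp
      qed
      ultimately show "\<exists>T. openin (OM_topology \<omega>) T \<and> f \<in> T \<and> T \<subseteq> ?A"
        using openin_OM_seminorm_ball[OF m p f(1), of e] f by blast
    qed
  qed auto
  then show ?thesis
    unfolding OM_dual_def dual_space_def
    by (simp add: OM_add OM_scale linear_on_add[OF lin V V] linear_on_scale[OF lin V])
qed

text \<open>A uniform bound in one step bounds every admissible seminorm on \<open>B\<close>, so the
  generating neighbourhoods of 0 absorb \<open>B\<close>; absorption passes to finite intersections
  and unions.\<close>

lemma vn_boundedI: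
  fixes B :: "(real ^ 'n \<Rightarrow> complex) set"
  assumes sub: "B \<subseteq> OM_space \<omega>"
    and bound: "\<And>m. m \<ge> 1 \<Longrightarrow> \<exists>n\<ge>1. \<exists>C. \<forall>f\<in>B. f \<in> O_step \<omega> m n \<and> O_norm \<omega> m n f \<le> C"
  shows "vn_bounded (OM_topology \<omega>) B"
  unfolding vn_bounded_def
proof (intro conjI allI impI)
  show "B \<subseteq> topspace (OM_topology \<omega>)" using sub by simp
  have sc: "(\<lambda>x. f x / complex_of_real t) \<in> OM_space \<omega>" if "f \<in> OM_space \<omega>" for f :: "real ^ 'n \<Rightarrow> complex" and t
    using OM_scale[OF that, of "inverse (complex_of_real t)"]
    by (simp add: divide_inverse mult.commute)
  fix U :: "(real ^ 'n \<Rightarrow> complex) set" assume U: "openin (OM_topology \<omega>) U \<and> (\<lambda>x. 0) \<in> U"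
  then have "generate_topology_on {OM_space \<omega> \<inter> U |U m. 1 \<le> m \<and> openin (OM_step_topology \<omega> m) U} U" "(\<lambda>x. 0) \<in> U"
    by (simp_all add: OM_topology_def openin_topology_generated_by_iff)
  then show "\<exists>s>0. \<forall>t\<ge>s. \<forall>f\<in>B. (\<lambda>x. f x / complex_of_real t) \<in> U"
  proof (induction rule: generate_topology_on.induct)
    case Empty
    then show ?case by simp
  next
    case (Int a b)
    then obtain s s' where "s > 0" "\<forall>t\<ge>s. \<forall>f\<in>B. (\<lambda>x. f x / complex_of_real t) \<in> a"
      "s' > 0" "\<forall>t\<ge>s'. \<forall>f\<in>B. (\<lambda>x. f x / complex_of_real t) \<in> b" by blast
    then show ?case by (intro exI[of _ "max s s'"]) auto
  next
    case (UN K)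
    then obtain k where k: "k \<in> K" "(\<lambda>x. 0) \<in> k" by auto
    then obtain s where "s > 0" "\<forall>t\<ge>s. \<forall>f\<in>B. (\<lambda>x. f x / complex_of_real t) \<in> k"
      using UN.IH[OF k] by auto
    then show ?case using k(1) by (intro exI[of _ s]) auto
  next
    case (Basis s)
    then obtain W m where W: "s = OM_space \<omega> \<inter> W" "1 \<le> m" "openin (OM_step_topology \<omega> m) W" by auto
    then have "(\<lambda>x. 0) \<in> W" using Basis by simp
    then have "\<exists>p. ind_seminorm (O_step \<omega> m) (O_norm \<omega> m) p \<and>
        {g \<in> step_union \<omega> m. p (\<lambda>x. g x - 0) < 1} \<subseteq> W"
      by (rule bspec[OF conjunct2[OF W(3)[unfolded openin_OM_step_topology[OF W(2)]]]])
    then obtain p where p: "ind_seminorm (O_step \<omega> m) (O_norm \<omega> m) p"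
      "{g \<in> step_union \<omega> m. p (\<lambda>x. g x - 0) < 1} \<subseteq> W"
      by (elim exE conjE)
    obtain n C where n: "n \<ge> 1" "\<And>f. f \<in> B \<Longrightarrow> f \<in> O_step \<omega> m n \<and> O_norm \<omega> m n f \<le> C"
      using bound[OF W(2)] by blast
    obtain D where D: "\<forall>f\<in>O_step \<omega> m n. p f \<le> D * O_norm \<omega> m n f"
      using p(1) n(1) unfolding ind_seminorm_def by blast
    \<comment> \<open>\<open>D\<close> and \<open>C\<close> may be negative, hence the absolute
      values; the added 1 makes \<open>t\<close> positive and \<open>p f < t\<close> strict.\<close>
    have "(\<lambda>x. f x / complex_of_real t) \<in> s" if t: "t \<ge> 1 + \<bar>D\<bar> * \<bar>C\<bar>" and f: "f \<in> B" for t f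
    proof -
      have t0: "t > 0" using t by (smt (verit) mult_nonneg_nonneg abs_ge_zero)
      have fV: "f \<in> step_union \<omega> m" using n f by auto
      have nn: "0 \<le> O_norm \<omega> m n f"
        using O_weighted_le_O_norm[of f \<omega> m n "\<lambda>_. 0" 0] n(2)[OF f] deriv_weight_pos[OF W(2)]
        by (smt (verit) O_weighted_alt exp_gt_zero mult_nonneg_nonneg norm_ge_zero)
      have "p f \<le> \<bar>D\<bar> * O_norm \<omega> m n f"
        using D n(2)[OF f] nn by (smt (verit) mult_right_mono)
      also have "\<dots> \<le> \<bar>D\<bar> * \<bar>C\<bar>" using n(2)[OF f] by (intro mult_left_mono) auto
      finally have "p f < t" using t by simp
      moreover have "p (\<lambda>x. inverse (complex_of_real t) * f x) = cmod (inverse (complex_of_real t)) * p f"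
        using ind_seminorm_scale[OF p(1) fV] .
      then have "p (\<lambda>x. f x / complex_of_real t) = p f / t"
        using t0 by (simp add: divide_inverse mult.commute norm_inverse)
      ultimately have "p (\<lambda>x. f x / complex_of_real t - 0) < 1" using t0 by simp
      moreover have OM: "(\<lambda>x. f x / complex_of_real t) \<in> OM_space \<omega>" using sc sub f by auto
      ultimately have "(\<lambda>x. f x / complex_of_real t) \<in> {g \<in> step_union \<omega> m. p (\<lambda>x. g x - 0) < 1}"
        using OM_spaceD[OF OM W(2)] by simp
      then show ?thesis using p(2) OM unfolding W(1) by (intro IntI subsetD[OF p(2)])
    qed
    then show ?case by (intro exI[of _ "1 + \<bar>D\<bar> * \<bar>C\<bar>"]) (auto intro: add_pos_nonneg)
  qed
qed

end

section \<open>Hermite polynomials\<close>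

text \<open>The probabilists' Hermite polynomials, at complex points because the Gaussians below
  have complex parameters.\<close>

fun hermite :: "nat \<Rightarrow> complex \<Rightarrow> complex" where
  "hermite 0 z = 1"
| "hermite (Suc 0) z = z"
| "hermite (Suc (Suc n)) z = z * hermite (Suc n) z - of_nat (Suc n) * hermite n z"

text \<open>At \<open>n = 0\<close> the truncated index is harmless, its coefficient being
  0.\<close>

lemma hermite_Suc: "hermite (Suc n) z = z * hermite n z - of_nat n * hermite (n - 1) z"
  by (cases n) auto

text \<open>Differentiate the recurrence, then apply it once more to \<open>z * hermite n z\<close>;
  the lower terms cancel.\<close>

lemma has_field_derivative_hermite:
  "(hermite n has_field_derivative of_nat n * hermite (n - 1) z) (at z)"
proof (induction n rule: induct_nat_012)
  case 0
  show ?case by (simp add: hermite.simps(1)[abs_def])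
next
  case 1
  have "hermite (Suc 0) = (\<lambda>z. z)" by auto
  then show ?case by simp
next
  case (ge2 n)
  have eq: "hermite (Suc (Suc n)) = (\<lambda>z. z * hermite (Suc n) z - of_nat (Suc n) * hermite n z)"
    by auto
  have "((\<lambda>z. z * hermite (Suc n) z - of_nat (Suc n) * hermite n z) has_field_derivative
      (1 * hermite (Suc n) z + of_nat (Suc n) * hermite n z * z)
        - of_nat (Suc n) * (of_nat n * hermite (n - 1) z)) (at z)"
    using ge2 by (intro DERIV_diff DERIV_mult DERIV_cmult DERIV_ident) simp_all
  moreover have "(1 * hermite (Suc n) z + of_nat (Suc n) * hermite n z * z)
        - of_nat (Suc n) * (of_nat n * hermite (n - 1) z) = of_nat (Suc (Suc n)) * hermite (Suc n) z"
  proof -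
    have "of_nat (Suc n) * hermite n z * z = of_nat (Suc n) * (hermite (Suc n) z + of_nat n * hermite (n - 1) z)"
      by (simp add: hermite_Suc mult_ac)
    then show ?thesis by (simp only:) (simp add: algebra_simps)
  qed
  ultimately show ?case unfolding eq by simp
qed

text \<open>With \<open>r = |z|\<close> and \<open>s^2 = m\<close>, the recurrence reduces the
  induction to \<open>r * (r + s) + s * s \<le> (r + s)^2\<close>. Keeping \<open>sqrt n\<close>
  inside the base lets the packet estimate treat it like a distance.\<close>

lemma norm_hermite_le: "cmod (hermite n z) \<le> (cmod z + sqrt (real n)) ^ n"
proof (induction n rule: less_induct)
  case (less n)
  show ?case
  proof (cases n)
    case (Suc m)
    let ?r = "cmod z" and ?s = "sqrt (real m)"
    have s: "?s \<ge> 0" "?r \<ge> 0" by auto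
    have 1: "cmod (hermite m z) \<le> (?r + ?s) ^ m" using less Suc by simp
    have 2: "real m * cmod (hermite (m - 1) z) \<le> real m * (?r + ?s) ^ (m - 1)"
    proof (cases m)
      case (Suc l)
      have "cmod (hermite l z) \<le> (?r + sqrt (real l)) ^ l" using less \<open>n = Suc m\<close> Suc by simp
      also have "\<dots> \<le> (?r + ?s) ^ l" using Suc by (intro power_mono) auto
      finally show ?thesis using Suc by (intro mult_left_mono) auto
    qed simp
    have "cmod (hermite n z) \<le> ?r * cmod (hermite m z) + real m * cmod (hermite (m - 1) z)"
      unfolding Suc hermite_Suc by (rule order_trans[OF norm_triangle_ineq4]) (simp add: norm_mult)
    also have "\<dots> \<le> ?r * (?r + ?s) ^ m + real m * (?r + ?s) ^ (m - 1)"
      using mult_left_mono[OF 1 s(2)] 2 by linarith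
    also have "\<dots> \<le> (?r + ?s) ^ Suc m"
    proof (cases m)
      case (Suc l)
      have "?r * (?r + ?s) ^ m + real m * (?r + ?s) ^ (m - 1) = (?r + ?s) ^ l * (?r * (?r + ?s) + ?s * ?s)"
        using Suc by (simp add: algebra_simps)
      also have "\<dots> \<le> (?r + ?s) ^ l * ((?r + ?s) * (?r + ?s))"
        using s by (intro mult_left_mono) (auto simp: algebra_simps)
      also have "\<dots> = (?r + ?s) ^ Suc m" using Suc by simp
      finally show ?thesis .
    qed simp
    also have "\<dots> \<le> (?r + sqrt (real n)) ^ n" unfolding Suc by (intro power_mono) auto
    finally show ?thesis .
  qed simp
qed

text \<open>On the imaginary axis all terms of a Hermite polynomial have the same phase.\<close>

lemma norm_hermite_imaginary_ge:
  assumes "a \<ge> 0"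
  shows "a ^ n \<le> cmod (hermite n (\<i> * complex_of_real a))"
proof -
  have "\<exists>r\<ge>a ^ n. hermite n (\<i> * complex_of_real a) = \<i> ^ n * complex_of_real r"
  proof (induction n rule: induct_nat_012)
    case 0
    show ?case by (intro exI[of _ 1]) auto
  next
    case 1
    show ?case by (intro exI[of _ a]) auto
  next
    case (ge2 m)
    then obtain r r' where r: "r \<ge> a ^ Suc m" "hermite (Suc m) (\<i> * complex_of_real a) = \<i> ^ Suc m * complex_of_real r"
      and r': "r' \<ge> a ^ m" "hermite m (\<i> * complex_of_real a) = \<i> ^ m * complex_of_real r'"
      by auto
    have "hermite (Suc (Suc m)) (\<i> * complex_of_real a) = \<i> ^ Suc (Suc m) * complex_of_real (a * r + real (Suc m) * r')"
      by (simp add: r(2) r'(2) algebra_simps)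
    moreover have "a * a ^ Suc m \<le> a * r" using r assms by (intro mult_left_mono) auto
    moreover have "0 \<le> real (Suc m) * r'"
      using order_trans[OF zero_le_power[OF assms] r'(1)] by simp
    ultimately show ?case by (intro exI[of _ "a * r + real (Suc m) * r'"]) simp
  qed
  then show ?thesis by (auto simp: norm_mult norm_power)
qed

section \<open>A family of Gaussians closed under derivatives and Fourier transform\<close>

text \<open>The \<open>n\<close>-th derivative of \<open>exp (c * w - w^2 / 2)\<close> in
  \<open>w\<close>. On the real line, the real part of \<open>c\<close> is the centre of the
  Gaussian and the imaginary part its frequency.\<close>

definition gauss_factor :: "nat \<Rightarrow> complex \<Rightarrow> complex \<Rightarrow> complex" where
  "gauss_factor n c w = hermite n (c - w) * exp (c * w - w\<^sup>2 / 2)"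

text \<open>The scalar \<kappa> keeps the Fourier transform within the family.\<close>

definition gauss :: "complex \<Rightarrow> ('n \<Rightarrow> nat) \<Rightarrow> ('n \<Rightarrow> complex) \<Rightarrow> real ^ 'n::finite \<Rightarrow> complex" where
  "gauss \<kappa> n c x = \<kappa> * (\<Prod>i\<in>UNIV. gauss_factor (n i) (c i) (complex_of_real (x $ i)))"

text \<open>The product rule yields
  \<open>(c - w) * hermite n (c - w) - n * hermite (n - 1) (c - w)\<close>, which is the recurrence
  for the next index.\<close>

lemma has_field_derivative_gauss_factor:
  "(gauss_factor n c has_field_derivative gauss_factor (Suc n) c w) (at w)"
proof -
  have "((\<lambda>w. hermite n (c - w)) has_field_derivative of_nat n * hermite (n - 1) (c - w) * (0 - 1)) (at w)"
    by (rule DERIV_chain2[OF has_field_derivative_hermite]) (intro DERIV_diff DERIV_const DERIV_ident)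
  moreover have "((\<lambda>w. exp (c * w - w\<^sup>2 / 2)) has_field_derivative exp (c * w - w\<^sup>2 / 2) * (c - w)) (at w)"
    by (auto intro!: derivative_eq_intros simp: field_simps)
  ultimately have "((\<lambda>w. hermite n (c - w) * exp (c * w - w\<^sup>2 / 2)) has_field_derivative
      of_nat n * hermite (n - 1) (c - w) * (0 - 1) * exp (c * w - w\<^sup>2 / 2)
        + exp (c * w - w\<^sup>2 / 2) * (c - w) * hermite n (c - w)) (at w)"
    by (rule DERIV_mult)
  then show ?thesis
    unfolding gauss_factor_def[abs_def] hermite_Suc by (simp add: algebra_simps)
qed

lemma has_derivative_gauss:
  fixes x :: "real ^ 'n"
  shows "(gauss \<kappa> n c has_derivative
    (\<lambda>h. \<kappa> * (\<Sum>i\<in>UNIV. gauss_factor (Suc (n i)) (c i) (complex_of_real (x $ i)) * complex_of_real (h $ i) *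
      (\<Prod>j\<in>UNIV - {i}. gauss_factor (n j) (c j) (complex_of_real (x $ j)))))) (at x)"
proof -
  have "((\<lambda>x :: real ^ 'n. gauss_factor (n i) (c i) (complex_of_real (x $ i))) has_derivative
      (\<lambda>h. gauss_factor (Suc (n i)) (c i) (complex_of_real (x $ i)) * complex_of_real (h $ i))) (at x)" for i
  proof -
    have 1: "((\<lambda>x :: real ^ 'n. complex_of_real (x $ i)) has_derivative (\<lambda>h. complex_of_real (h $ i))) (at x)"
      by (intro bounded_linear.has_derivative[OF bounded_linear_of_real] bounded_linear_imp_has_derivative bounded_linear_vec_nth)
    have 2: "(gauss_factor (n i) (c i) has_derivative
        (*) (gauss_factor (Suc (n i)) (c i) (complex_of_real (x $ i)))) (at (complex_of_real (x $ i)))"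
      using has_field_derivative_gauss_factor by (simp add: has_field_derivative_def)
    from has_derivative_compose[OF 1 2] show ?thesis .
  qed
  then show ?thesis
    unfolding gauss_def[abs_def]
    by (intro has_derivative_mult_right has_derivative_prod)
qed

lemma partial_deriv_gauss: "partial_deriv j (gauss \<kappa> n c) = gauss \<kappa> (n(j := Suc (n j))) c"
proof
  fix x
  have "partial_deriv j (gauss \<kappa> n c) x = \<kappa> * (\<Sum>i\<in>UNIV. gauss_factor (Suc (n i)) (c i) (complex_of_real (x $ i)) *
      complex_of_real (axis j 1 $ i) * (\<Prod>j\<in>UNIV - {i}. gauss_factor (n j) (c j) (complex_of_real (x $ j))))"
    by (rule partial_deriv_eqI[OF has_derivative_gauss])
  also have "\<dots> = \<kappa> * (gauss_factor (Suc (n j)) (c j) (complex_of_real (x $ j)) *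
      (\<Prod>i\<in>UNIV - {j}. gauss_factor (n i) (c i) (complex_of_real (x $ i))))"
    by (subst sum.remove[of _ j]) (auto simp: axis_def)
  also have "\<dots> = gauss \<kappa> (n(j := Suc (n j))) c x"
    unfolding gauss_def by (subst prod.remove[of UNIV j]) (auto intro!: prod.cong)
  finally show "partial_deriv j (gauss \<kappa> n c) x = gauss \<kappa> (n(j := Suc (n j))) c x" .
qed

text \<open>Each partial derivative raises one Hermite index, so only the multiplicities in the list
  matter.\<close>

lemma pderivs_gauss: "pderivs is (gauss \<kappa> (\<lambda>_. 0) c) = gauss \<kappa> (count_list is) c"
proof (induction "is")
  case Nil
  show ?case by (simp add: count_list.simps(1)[abs_def])
next
  case (Cons j "is")
  have "(count_list is)(j := Suc (count_list is j)) = count_list (j # is)" by auto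
  then show ?case by (simp only: foldr.simps o_apply Cons partial_deriv_gauss)
qed

lemma smooth_gauss: "smooth (gauss \<kappa> (\<lambda>_. 0) c)"
  unfolding smooth_def pderivs_gauss using has_derivative_gauss differentiable_def by blast

text \<open>Completing the square; the imaginary parts of \<open>c\<close> affect only the
  phase.\<close>

lemma norm_gauss_0:
  fixes x :: "real ^ 'n" and c :: "'n \<Rightarrow> complex"
  defines "b \<equiv> \<chi> i. Re (c i)"
  shows "cmod (gauss \<kappa> (\<lambda>_. 0) c x) = cmod \<kappa> * exp (((norm b)\<^sup>2 - (norm (x - b))\<^sup>2) / 2)"
proof -
  have *: "cmod (gauss_factor 0 (c i) (complex_of_real (x $ i))) = exp (((b $ i)\<^sup>2 - ((x - b) $ i)\<^sup>2) / 2)" for i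
    by (simp add: gauss_factor_def b_def power2_eq_square algebra_simps diff_divide_distrib add_divide_distrib)
  have n: "(norm y)\<^sup>2 = (\<Sum>i\<in>UNIV. (y $ i)\<^sup>2)" for y :: "real ^ 'n"
    by (simp add: norm_vec_def L2_set_def sum_nonneg)
  show ?thesis
    unfolding gauss_def norm_mult prod_norm[symmetric] * n
    by (simp add: exp_sum[symmetric] sum_subtractf[symmetric] sum_divide_distrib[symmetric])
qed

lemma norm_gauss:
  "cmod (gauss \<kappa> n c x) =
    (\<Prod>i\<in>UNIV. cmod (hermite (n i) (c i - complex_of_real (x $ i)))) * cmod (gauss \<kappa> (\<lambda>_. 0) c x)"
  by (simp add: gauss_def gauss_factor_def prod.distrib norm_mult prod_norm)

lemma norm_gauss_le:
  fixes x :: "real ^ 'n"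
  assumes r: "\<And>i. cmod (c i - complex_of_real (x $ i)) \<le> r"
  shows "cmod (gauss \<kappa> n c x) \<le> (r + sqrt (real (\<Sum>i\<in>UNIV. n i))) ^ (\<Sum>i\<in>UNIV. n i) * cmod (gauss \<kappa> (\<lambda>_. 0) c x)"
proof -
  let ?k = "\<Sum>i\<in>UNIV. n i"
  let ?z = "\<lambda>i. c i - complex_of_real (x $ i)"
  have "cmod (gauss \<kappa> n c x) = (\<Prod>i\<in>UNIV. cmod (hermite (n i) (?z i))) * cmod (gauss \<kappa> (\<lambda>_. 0) c x)"
    by (rule norm_gauss)
  also have "\<dots> \<le> (\<Prod>i\<in>UNIV. (r + sqrt (real ?k)) ^ n i) * cmod (gauss \<kappa> (\<lambda>_. 0) c x)"
  proof (intro mult_right_mono prod_mono conjI)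
    fix i
    have "n i \<le> ?k" by (rule member_le_sum) auto
    then have "sqrt (real (n i)) \<le> sqrt (real ?k)" by (simp del: of_nat_sum)
    then have "(cmod (?z i) + sqrt (real (n i))) ^ n i \<le> (r + sqrt (real ?k)) ^ n i"
      using r[of i] by (intro power_mono add_mono) auto
    then show "cmod (hermite (n i) (?z i)) \<le> (r + sqrt (real ?k)) ^ n i"
      using norm_hermite_le order_trans by blast
  qed auto
  finally show ?thesis by (simp add: power_sum)
qed

lemma sum_count_list_UNIV: "(\<Sum>i\<in>UNIV. count_list is i) = length (is :: 'n::finite list)"
  by (rule sum_count_set) auto

lemma quadratic_le: "a + b * r - r\<^sup>2 / 2 \<le> a + b\<^sup>2 / (2 :: real)"
  using zero_le_power2[of "r - b"] by (simp add: power2_eq_square algebra_simps)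

lemma power_le_exp: "0 \<le> r \<Longrightarrow> r ^ k \<le> exp (real k * r :: real)"
  unfolding exp_of_nat_mult using exp_ge_add_one_self[of r] by (intro power_mono) linarith+

text \<open>In terms of \<open>|x - b|\<close>, the weight and the Hermite factors cost at most a
  linear exponent, which the quadratic one of the Gaussian dominates.\<close>

lemma (in weight) weighted_gauss_bounded:
  assumes l: "l > 0"
  shows "bounded (range (\<lambda>x :: real ^ 'n. exp (l * \<omega> (norm x)) *\<^sub>R gauss \<kappa> n c x))"
proof -
  obtain A where A: "A \<ge> 0" "\<And>t. 0 \<le> t \<Longrightarrow> \<omega> t \<le> A * (1 + t)" using linear_bound by blast
  define b :: "real ^ 'n" where "b = (\<chi> i. Re (c i))"
  define k where "k = (\<Sum>i\<in>UNIV. n i)"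
  define S where "S = (\<Sum>i\<in>UNIV. cmod (c i)) + norm b + sqrt (real k)"
  \<comment> \<open>Linear coefficient and, next, constant term of the exponent as a polynomial in
    \<open>|x - b|\<close>.\<close>
  define \<beta> where "\<beta> = real k + l * A"
  define \<alpha> where "\<alpha> = real k * S + l * A * (1 + norm b) + (norm b)\<^sup>2 / 2"
  have "norm (exp (l * \<omega> (norm x)) *\<^sub>R gauss \<kappa> n c x) \<le> cmod \<kappa> * exp (\<alpha> + \<beta>\<^sup>2 / 2)" for x :: "real ^ 'n"
  proof -
    let ?y = "norm (x - b)"
    have xy: "norm x \<le> norm b + ?y" using norm_triangle_ineq[of b "x - b"] by simp
    have S0: "S \<ge> 0" by (auto simp: S_def intro!: add_nonneg_nonneg sum_nonneg)
    have "cmod (c i - complex_of_real (x $ i)) \<le> (\<Sum>i\<in>UNIV. cmod (c i)) + norm x" for i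
    proof -
      have "cmod (c i) \<le> (\<Sum>i\<in>UNIV. cmod (c i))" by (rule member_le_sum) auto
      moreover have "\<bar>x $ i\<bar> \<le> norm x" by (rule component_le_norm_cart)
      ultimately show ?thesis
        using norm_triangle_ineq4[of "c i" "complex_of_real (x $ i)"] by simp
    qed
    then have "cmod (gauss \<kappa> n c x) \<le>
        ((\<Sum>i\<in>UNIV. cmod (c i)) + norm x + sqrt (real k)) ^ k * cmod (gauss \<kappa> (\<lambda>_. 0) c x)"
      unfolding k_def by (rule norm_gauss_le)
    also have "\<dots> \<le> (S + ?y) ^ k * cmod (gauss \<kappa> (\<lambda>_. 0) c x)"
      using xy unfolding S_def by (intro mult_right_mono power_mono) (auto intro!: add_nonneg_nonneg sum_nonneg)
    also have "\<dots> \<le> exp (real k * (S + ?y)) * cmod (gauss \<kappa> (\<lambda>_. 0) c x)"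
      using S0 by (intro mult_right_mono power_le_exp) auto
    finally have 1: "cmod (gauss \<kappa> n c x) \<le> exp (real k * (S + ?y)) * cmod (gauss \<kappa> (\<lambda>_. 0) c x)" .
    have "\<omega> (norm x) \<le> A * (1 + norm b + ?y)"
      using A(2)[of "norm x"] mult_left_mono[OF xy A(1)] by (simp add: algebra_simps)
    then have "l * \<omega> (norm x) \<le> l * (A * (1 + norm b + ?y))" using l by (intro mult_left_mono) auto
    then have "exp (l * \<omega> (norm x)) \<le> exp (l * (A * (1 + norm b + ?y)))" by simp
    from mult_mono[OF this 1]
    have "norm (exp (l * \<omega> (norm x)) *\<^sub>R gauss \<kappa> n c x) \<le>
       exp (l * (A * (1 + norm b + ?y))) * (exp (real k * (S + ?y)) * cmod (gauss \<kappa> (\<lambda>_. 0) c x))"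
      by simp
    also have "\<dots> = cmod \<kappa> * exp (\<alpha> + \<beta> * ?y - ?y\<^sup>2 / 2)"
      unfolding norm_gauss_0 b_def[symmetric] \<alpha>_def \<beta>_def
      by (simp add: exp_add[symmetric] exp_diff algebra_simps diff_divide_distrib)
    also have "\<dots> \<le> cmod \<kappa> * exp (\<alpha> + \<beta>\<^sup>2 / 2)"
      using quadratic_le by (intro mult_left_mono) auto
    finally show ?thesis .
  qed
  then show ?thesis unfolding bounded_iff by blast
qed

section \<open>Gaussian integrals\<close>

text \<open>For \<open>w = b + \<i> * q\<close> the real part becomes a translation and the
  imaginary part a frequency, so the characteristic function of the standard normal law gives the
  value without any shift of contour.\<close>

lemma gaussian_integral_1d:
  fixes w :: complex
  assumes s: "s > 0"
  shows "has_bochner_integral lborel (\<lambda>x. exp (w * complex_of_real x - complex_of_real (s\<^sup>2 * x\<^sup>2 / 2)))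
    (complex_of_real (sqrt (2 * pi) / s) * exp (w\<^sup>2 / complex_of_real (2 * s\<^sup>2)))"
proof -
  define b q where "b = Re w" "q = Im w"
  have w: "w = Complex b q" by (simp add: b_q_def)
  let ?f = "\<lambda>x. complex_of_real (std_normal_density x) * iexp (q / s * x)"
  \<comment> \<open>The constants left over from completing the square and from the normalisation of
    the density.\<close>
  let ?K = "complex_of_real (sqrt (2 * pi)) * exp (complex_of_real (b\<^sup>2 / (2 * s\<^sup>2)) + \<i> * complex_of_real (q * b / s\<^sup>2))"
  have "integrable lborel (\<lambda>x. std_normal_density x *\<^sub>R iexp (q / s * x))"
    by (rule Bochner_Integration.integrable_bound[of _ std_normal_density]) (auto simp: integrable_normal_density)
  moreover have "(LINT x|lborel. std_normal_density x *\<^sub>R iexp (q / s * x)) = char std_normal_distribution (q / s)"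
    unfolding char_def by (subst integral_density) auto
  ultimately have "has_bochner_integral lborel (\<lambda>x. std_normal_density x *\<^sub>R iexp (q / s * x))
      (complex_of_real (exp (- ((q / s)\<^sup>2) / 2)))"
    unfolding has_bochner_integral_iff char_std_normal_distribution by simp
  then have "has_bochner_integral lborel ?f (complex_of_real (exp (- ((q / s)\<^sup>2) / 2)))"
    by (simp add: scaleR_conv_of_real)
  then have "has_bochner_integral lborel (\<lambda>x. ?f (- b / s + s * x))
      (complex_of_real (exp (- ((q / s)\<^sup>2) / 2)) /\<^sub>R \<bar>s\<bar>)"
    using s by (subst (asm) lborel_has_bochner_integral_real_affine_iff[of s _ _ "- b / s"]) auto
  then have "has_bochner_integral lborel (\<lambda>x. ?K * ?f (- b / s + s * x))
      (?K * (complex_of_real (exp (- ((q / s)\<^sup>2) / 2)) /\<^sub>R \<bar>s\<bar>))"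
    by (intro has_bochner_integral_mult_right) auto
  moreover have "?K * ?f (- b / s + s * x) = exp (w * complex_of_real x - complex_of_real (s\<^sup>2 * x\<^sup>2 / 2))" for x
  proof -
    have "?K * ?f (- b / s + s * x) = exp (complex_of_real (b\<^sup>2 / (2 * s\<^sup>2)) + \<i> * complex_of_real (q * b / s\<^sup>2)
        + complex_of_real (- (- b / s + s * x)\<^sup>2 / 2) + \<i> * complex_of_real (q / s * (- b / s + s * x)))"
    proof -
      let ?y = "- b / s + s * x"
      have sd: "complex_of_real (sqrt (2 * pi)) * complex_of_real (std_normal_density ?y) =
          exp (complex_of_real (- ?y\<^sup>2 / 2))"
      proof -
        have "sqrt (2 * pi) * std_normal_density ?y = exp (- ?y\<^sup>2 / 2)"
          by (simp add: std_normal_density_def)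
        then show ?thesis by (simp only: of_real_mult[symmetric] exp_of_real)
      qed
      have rearrange: "(p * e) * (d * z) = e * (p * d) * z" for p e d z :: complex
        by simp
      show ?thesis by (subst rearrange) (simp only: sd exp_add)
    qed
    also have "complex_of_real (b\<^sup>2 / (2 * s\<^sup>2)) + \<i> * complex_of_real (q * b / s\<^sup>2)
        + complex_of_real (- (- b / s + s * x)\<^sup>2 / 2) + \<i> * complex_of_real (q / s * (- b / s + s * x)) =
        w * complex_of_real x - complex_of_real (s\<^sup>2 * x\<^sup>2 / 2)"
      using s by (intro complex_eqI) (simp_all add: w power2_eq_square field_simps)
    finally show ?thesis .
  qed
  moreover have "?K * (complex_of_real (exp (- ((q / s)\<^sup>2) / 2)) /\<^sub>R \<bar>s\<bar>) =
      complex_of_real (sqrt (2 * pi) / s) * exp (w\<^sup>2 / complex_of_real (2 * s\<^sup>2))"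
  proof -
    have "?K * (complex_of_real (exp (- ((q / s)\<^sup>2) / 2)) /\<^sub>R \<bar>s\<bar>) =
      complex_of_real (sqrt (2 * pi) / s) * exp (complex_of_real (b\<^sup>2 / (2 * s\<^sup>2)) + \<i> * complex_of_real (q * b / s\<^sup>2)
        + complex_of_real (- ((q / s)\<^sup>2) / 2))"
    proof -
      have rearrange: "(complex_of_real p * e) * (d /\<^sub>R \<bar>s\<bar>) = complex_of_real (p / s) * (e * d)" for p e d
        using s by (simp add: scaleR_conv_of_real divide_inverse)
      show ?thesis by (subst rearrange) (simp only: exp_add exp_of_real[symmetric])
    qed
    also have "complex_of_real (b\<^sup>2 / (2 * s\<^sup>2)) + \<i> * complex_of_real (q * b / s\<^sup>2)
        + complex_of_real (- ((q / s)\<^sup>2) / 2) = w\<^sup>2 / complex_of_real (2 * s\<^sup>2)"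
      using s by (intro complex_eqI) (simp_all add: w power2_eq_square field_simps)
    finally show ?thesis .
  qed
  ultimately show ?thesis by simp
qed

text \<open>Lebesgue measure on \<open>real ^ 'n\<close> is the image of the product measure indexed
  by basis vectors; \<open>axis\<close> matches these with the coordinates, and Fubini for products
  applies.\<close>

lemma has_bochner_integral_prod_vec:
  fixes g :: "'n::finite \<Rightarrow> real \<Rightarrow> 'b::{real_normed_field,banach,second_countable_topology}"
  assumes g: "\<And>i. has_bochner_integral lborel (g i) (I i)"
  shows "has_bochner_integral lborel (\<lambda>x :: real ^ 'n. \<Prod>i\<in>UNIV. g i (x $ i)) (\<Prod>i\<in>UNIV. I i)"
proof -
  interpret product_sigma_finite "\<lambda>_ :: real ^ 'n. lborel :: real measure" by standard
  let ?P = "\<Pi>\<^sub>M b\<in>(Basis :: (real ^ 'n) set). (lborel :: real measure)"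
  let ?T = "\<lambda>f. \<Sum>b\<in>(Basis :: (real ^ 'n) set). f b *\<^sub>R b"
  let ?ax = "\<lambda>i :: 'n. axis i (1 :: real)"
  have B: "bij_betw ?ax UNIV (Basis :: (real ^ 'n) set)"
    by (auto simp: bij_betw_def inj_on_def axis_eq_axis Basis_vec_def)
  define ix where "ix = inv_into UNIV ?ax"
  have ix: "ix (?ax i) = i" for i unfolding ix_def by (rule inv_into_f_f) (use B in \<open>auto simp: bij_betw_def\<close>)
  have T: "?T f $ i = f (?ax i)" for f and i :: 'n
  proof -
    have "?T f = (\<Sum>j\<in>UNIV. f (?ax j) *\<^sub>R ?ax j)" by (rule sum.reindex_bij_betw[OF B, symmetric])
    then show ?thesis by (simp add: axis_def if_distrib[of "(*) _"] cong: if_cong)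
  qed
  have gm [measurable]: "g i \<in> borel_measurable borel" for i
    using g[of i] borel_measurable_integrable by (fastforce simp: has_bochner_integral_iff)
  have prod: "(\<Prod>i\<in>UNIV. g i (?T f $ i)) = (\<Prod>b\<in>(Basis :: (real ^ 'n) set). g (ix b) (f b))" for f
    unfolding T by (subst prod.reindex_bij_betw[OF B, symmetric]) (simp add: ix)
  have int: "\<And>b. integrable lborel (g (ix b))" "\<And>b. integral\<^sup>L lborel (g (ix b)) = I (ix b)"
    using g by (simp_all add: has_bochner_integral_iff)
  have "has_bochner_integral ?P (\<lambda>f. \<Prod>b\<in>(Basis :: (real ^ 'n) set). g (ix b) (f b)) (\<Prod>b\<in>(Basis :: (real ^ 'n) set). I (ix b))"
    unfolding has_bochner_integral_iff using int
    by (subst product_integral_prod) (auto intro!: product_integrable_prod)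
  then have "has_bochner_integral ?P (\<lambda>f. \<Prod>i\<in>UNIV. g i (?T f $ i)) (\<Prod>i\<in>UNIV. I i)"
    unfolding prod by (subst (asm) prod.reindex_bij_betw[OF B, symmetric]) (simp add: ix)
  then have "has_bochner_integral (distr ?P borel ?T) (\<lambda>x :: real ^ 'n. \<Prod>i\<in>UNIV. g i (x $ i)) (\<Prod>i\<in>UNIV. I i)"
    by (intro has_bochner_integral_distr) auto
  then show ?thesis by (subst lborel_eq)
qed

lemma gaussian_integral:
  fixes w :: "'n::finite \<Rightarrow> complex"
  assumes s: "s > 0"
  shows "has_bochner_integral lborel
    (\<lambda>x :: real ^ 'n. \<Prod>i\<in>UNIV. exp (w i * complex_of_real (x $ i) - complex_of_real (s\<^sup>2 * (x $ i)\<^sup>2 / 2)))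
    (\<Prod>i\<in>UNIV. complex_of_real (sqrt (2 * pi) / s) * exp ((w i)\<^sup>2 / complex_of_real (2 * s\<^sup>2)))"
  by (intro has_bochner_integral_prod_vec gaussian_integral_1d s)

lemma cis_inner_prod: "cis (- (x \<bullet> \<xi>)) = (\<Prod>i\<in>UNIV. exp (- \<i> * complex_of_real (\<xi> $ i) * complex_of_real (x $ i)))"
  for x \<xi> :: "real ^ 'n"
  by (simp add: cis_conv_exp exp_sum[symmetric] inner_vec_def sum_distrib_left sum_negf mult_ac)

lemma gauss_integral:
  fixes c :: "'n::finite \<Rightarrow> complex"
  shows "has_bochner_integral lborel (gauss \<kappa> (\<lambda>_. 0) c)
    (\<kappa> * (\<Prod>i\<in>UNIV. complex_of_real (sqrt (2 * pi)) * exp ((c i)\<^sup>2 / 2)))"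
  unfolding gauss_def[abs_def] gauss_factor_def
  using has_bochner_integral_mult_right[OF gaussian_integral[of 1 c], of \<kappa>] by simp

text \<open>The character only shifts each \<open>c i\<close> by an imaginary amount, so the
  Gaussian integral applies; expanding the shifted square splits off a constant from a new
  Gaussian.\<close>

lemma fourier_gauss:
  fixes c :: "'n::finite \<Rightarrow> complex"
  shows "fourier (gauss \<kappa> (\<lambda>_. 0) c) =
    gauss (\<kappa> * (\<Prod>i\<in>UNIV. complex_of_real (sqrt (2 * pi)) * exp ((c i)\<^sup>2 / 2))) (\<lambda>_. 0) (\<lambda>i. - \<i> * c i)"
proof
  fix \<xi> :: "real ^ 'n"
  have "(\<lambda>x. cis (- (x \<bullet> \<xi>)) * gauss \<kappa> (\<lambda>_. 0) c x) = gauss \<kappa> (\<lambda>_. 0) (\<lambda>i. c i - \<i> * complex_of_real (\<xi> $ i))"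
    unfolding cis_inner_prod gauss_def gauss_factor_def
    by (simp add: fun_eq_iff prod.distrib[symmetric] mult.left_commute[of _ \<kappa>] exp_add[symmetric] algebra_simps)
  then have "fourier (gauss \<kappa> (\<lambda>_. 0) c) \<xi> =
      \<kappa> * (\<Prod>i\<in>UNIV. complex_of_real (sqrt (2 * pi)) * exp ((c i - \<i> * complex_of_real (\<xi> $ i))\<^sup>2 / 2))"
    using gauss_integral[of \<kappa> "\<lambda>i. c i - \<i> * complex_of_real (\<xi> $ i)"]
    unfolding fourier_def has_bochner_integral_iff by simp
  also have "\<dots> = \<kappa> * (\<Prod>i\<in>UNIV. (complex_of_real (sqrt (2 * pi)) * exp ((c i)\<^sup>2 / 2)) *
      exp (- \<i> * c i * complex_of_real (\<xi> $ i) - (complex_of_real (\<xi> $ i))\<^sup>2 / 2))"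
  proof -
    have "exp ((a - \<i> * b)\<^sup>2 / 2) = exp (a\<^sup>2 / 2) * exp (- \<i> * a * b - b\<^sup>2 / 2)" for a b :: complex
      by (simp add: exp_add[symmetric] power2_eq_square algebra_simps diff_divide_distrib add_divide_distrib)
    then show ?thesis by (simp only: mult.assoc)
  qed
  finally show "fourier (gauss \<kappa> (\<lambda>_. 0) c) \<xi> =
    gauss (\<kappa> * (\<Prod>i\<in>UNIV. complex_of_real (sqrt (2 * pi)) * exp ((c i)\<^sup>2 / 2))) (\<lambda>_. 0) (\<lambda>i. - \<i> * c i) \<xi>"
    by (simp add: gauss_def gauss_factor_def prod.distrib mult.assoc)
qed

text \<open>The function and its Fourier transform lie in the same family, so one weighted estimate
  serves both.\<close>

lemma (in weight) gauss_in_S_space: "gauss \<kappa> (\<lambda>_. 0) c \<in> S_space \<omega>"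
  unfolding S_space_def mem_Collect_eq fourier_gauss multi_deriv_word pderivs_gauss
  using gauss_integral[of \<kappa> c] smooth_gauss weighted_gauss_bounded
  by (auto simp: has_bochner_integral_iff)

section \<open>Fourier inversion\<close>

lemma lborel_integral_affine:
  fixes h :: "'a::euclidean_space \<Rightarrow> complex"
  assumes h [measurable]: "h \<in> borel_measurable borel" and s: "s > 0"
  shows "(LINT y|lborel. h y) = (LINT u|lborel. complex_of_real (s ^ DIM('a)) * h (t + s *\<^sub>R u))"
proof -
  have "(LINT y|lborel. h y) = (LINT y|density (distr lborel borel (\<lambda>x. t + s *\<^sub>R x)) (\<lambda>_. \<bar>s\<bar> ^ DIM('a)). h y)"
    using s by (subst lborel_affine[of s t]) auto
  also have "\<dots> = (LINT u|lborel. complex_of_real (s ^ DIM('a)) * h (t + s *\<^sub>R u))"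
    using s by (subst integral_density) (auto simp: integral_distr scaleR_conv_of_real)
  finally show ?thesis .
qed

lemma real_gaussian_prod:
  "exp (- (s\<^sup>2 * (norm \<xi>)\<^sup>2 / 2)) = (\<Prod>i\<in>UNIV. exp (- (s\<^sup>2 * (\<xi> $ i)\<^sup>2 / 2)))" for \<xi> :: "real ^ 'n"
proof -
  have "(norm \<xi>)\<^sup>2 = (\<Sum>i\<in>UNIV. (\<xi> $ i)\<^sup>2)" by (simp add: norm_vec_def L2_set_def sum_nonneg)
  then show ?thesis
    by (simp add: exp_sum[symmetric] sum_distrib_left sum_negf sum_divide_distrib)
qed

lemma gaussian_fourier:
  fixes z :: "real ^ 'n"
  assumes s: "s > 0"
  shows "has_bochner_integral lborel
    (\<lambda>\<xi> :: real ^ 'n. cis (z \<bullet> \<xi>) * complex_of_real (exp (- (s\<^sup>2 * (norm \<xi>)\<^sup>2 / 2))))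
    (complex_of_real ((sqrt (2 * pi) / s) ^ CARD('n) * exp (- ((norm z)\<^sup>2 / (2 * s\<^sup>2)))))"
proof -
  have 1: "cis (z \<bullet> \<xi>) * complex_of_real (exp (- (s\<^sup>2 * (norm \<xi>)\<^sup>2 / 2))) =
      (\<Prod>i\<in>UNIV. exp (\<i> * complex_of_real (z $ i) * complex_of_real (\<xi> $ i) - complex_of_real (s\<^sup>2 * (\<xi> $ i)\<^sup>2 / 2)))"
    for \<xi> :: "real ^ 'n"
  proof -
    have "cis (z \<bullet> \<xi>) = (\<Prod>i\<in>UNIV. exp (\<i> * complex_of_real (z $ i) * complex_of_real (\<xi> $ i)))"
      by (simp add: cis_conv_exp exp_sum[symmetric] inner_vec_def sum_distrib_left mult_ac)
    then show ?thesis
      unfolding real_gaussian_prod of_real_prod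
      by (simp only: prod.distrib[symmetric] exp_of_real[symmetric] exp_add[symmetric] of_real_minus add_uminus_conv_diff)
  qed
  have 2: "(\<Prod>i\<in>UNIV. complex_of_real (sqrt (2 * pi) / s) * exp ((\<i> * complex_of_real (z $ i))\<^sup>2 / complex_of_real (2 * s\<^sup>2))) =
      complex_of_real ((sqrt (2 * pi) / s) ^ CARD('n) * exp (- ((norm z)\<^sup>2 / (2 * s\<^sup>2))))"
  proof -
    have "exp ((\<i> * complex_of_real (z $ i))\<^sup>2 / complex_of_real (2 * s\<^sup>2)) =
        complex_of_real (exp (- ((1 / s)\<^sup>2 * (z $ i)\<^sup>2 / 2)))" for i
      unfolding exp_of_real[symmetric] by (simp add: power_mult_distrib power_divide mult.commute)
    moreover have "exp (- ((norm z)\<^sup>2 / (2 * s\<^sup>2))) = exp (- ((1 / s)\<^sup>2 * (norm z)\<^sup>2 / 2))"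
      by (simp add: power_divide mult.commute)
    ultimately show ?thesis
      unfolding real_gaussian_prod by (simp only: prod.distrib prod_constant of_real_mult of_real_power of_real_prod)
  qed
  show ?thesis
    using gaussian_integral[OF s, of "\<lambda>i. \<i> * complex_of_real (z $ i)"] unfolding 1 2 .
qed

lemma borel_measurable_cis_inner [measurable]: "(\<lambda>\<xi>. cis (z \<bullet> \<xi>)) \<in> borel_measurable borel"
  by (intro borel_measurable_continuous_onI continuous_intros)

text \<open>The Gaussian damping makes the double integral absolutely convergent; once the
  integrations are exchanged, the inner one is a Gaussian Fourier integral at
  \<open>x - y\<close>.\<close>

lemma fourier_multiplication:
  fixes f :: "real ^ 'n \<Rightarrow> complex"
  assumes f: "integrable lborel f" and s: "s > 0"
  shows "(LINT \<xi>|lborel. cis (x \<bullet> \<xi>) * complex_of_real (exp (- (s\<^sup>2 * (norm \<xi>)\<^sup>2 / 2))) * fourier f \<xi>) =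
    (LINT y|lborel. f y * complex_of_real ((sqrt (2 * pi) / s) ^ CARD('n) * exp (- ((norm (x - y))\<^sup>2 / (2 * s\<^sup>2)))))"
proof -
  let ?\<psi> = "\<lambda>\<xi> :: real ^ 'n. exp (- (s\<^sup>2 * (norm \<xi>)\<^sup>2 / 2))"
  let ?g = "\<lambda>y \<xi>. (cis ((x - y) \<bullet> \<xi>) * complex_of_real (?\<psi> \<xi>)) * f y"
  have fm [measurable]: "f \<in> borel_measurable borel" using f by auto
  have \<psi>: "integrable lborel ?\<psi>"
  proof -
    have "integrable lborel (\<lambda>\<xi> :: real ^ 'n. cis (0 \<bullet> \<xi>) * complex_of_real (?\<psi> \<xi>))"
      using gaussian_fourier[OF s, of "0 :: real ^ 'n"] by (simp only: has_bochner_integral_iff)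
    then have "integrable lborel (\<lambda>\<xi> :: real ^ 'n. norm (complex_of_real (?\<psi> \<xi>)))"
      by (intro integrable_norm) (simp only: inner_zero_left cis_zero mult_1)
    then show ?thesis by (simp only: norm_of_real abs_exp_cancel)
  qed
  have split: "?g y \<xi> = cis (x \<bullet> \<xi>) * complex_of_real (?\<psi> \<xi>) * (cis (- (y \<bullet> \<xi>)) * f y)" for y \<xi>
  proof -
    have "cis ((x - y) \<bullet> \<xi>) = cis (x \<bullet> \<xi>) * cis (- (y \<bullet> \<xi>))"
      by (simp add: cis_mult inner_diff_left)
    then show ?thesis by (simp only: mult_ac)
  qed
  have int: "integrable (lborel \<Otimes>\<^sub>M lborel) (case_prod ?g)"
  proof (rule lborel_pair.Fubini_integrable)
    have "continuous_on UNIV (\<lambda>p :: (real ^ 'n) \<times> (real ^ 'n). cis ((x - fst p) \<bullet> snd p) * complex_of_real (?\<psi> (snd p)))"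
      by (intro continuous_intros) auto
    then have "(\<lambda>p :: (real ^ 'n) \<times> (real ^ 'n). cis ((x - fst p) \<bullet> snd p) * complex_of_real (?\<psi> (snd p))) \<in> borel_measurable borel"
      by (rule borel_measurable_continuous_onI)
    then have [measurable]: "(\<lambda>p :: (real ^ 'n) \<times> (real ^ 'n). cis ((x - fst p) \<bullet> snd p) * complex_of_real (?\<psi> (snd p)))
        \<in> borel_measurable (lborel \<Otimes>\<^sub>M lborel)"
      unfolding lborel_prod by simp
    show "case_prod ?g \<in> borel_measurable (lborel \<Otimes>\<^sub>M lborel)"
      unfolding case_prod_beta' by measurable
    have "(\<lambda>y. LINT \<xi>|lborel. norm (case (y, \<xi>) of (y, \<xi>) \<Rightarrow> ?g y \<xi>)) = (\<lambda>y. (LINT \<xi>|lborel. ?\<psi> \<xi>) * norm (f y))"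
      by (simp add: norm_mult)
    then show "integrable lborel (\<lambda>y. LINT \<xi>|lborel. norm (case (y, \<xi>) of (y, \<xi>) \<Rightarrow> ?g y \<xi>))"
      using f by simp
    show "AE y in lborel. integrable lborel (\<lambda>\<xi>. case (y, \<xi>) of (y, \<xi>) \<Rightarrow> ?g y \<xi>)"
      using gaussian_fourier[OF s] by (auto simp: has_bochner_integral_iff intro!: AE_I2 integrable_mult_left)
  qed
  have "(LINT \<xi>|lborel. cis (x \<bullet> \<xi>) * complex_of_real (?\<psi> \<xi>) * fourier f \<xi>) = (LINT \<xi>|lborel. LINT y|lborel. ?g y \<xi>)"
    unfolding split fourier_def by simp
  also have "\<dots> = (LINT y|lborel. LINT \<xi>|lborel. ?g y \<xi>)"
    by (rule lborel_pair.Fubini_integral[OF int])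
  also have "\<dots> = (LINT y|lborel. f y * complex_of_real ((sqrt (2 * pi) / s) ^ CARD('n) * exp (- ((norm (x - y))\<^sup>2 / (2 * s\<^sup>2)))))"
  proof (rule Bochner_Integration.integral_cong[OF refl])
    fix y :: "real ^ 'n"
    have "(LINT \<xi>|lborel. ?g y \<xi>) = (LINT \<xi>|lborel. cis ((x - y) \<bullet> \<xi>) * complex_of_real (?\<psi> \<xi>)) * f y"
      by (rule integral_mult_left_zero)
    then show "(LINT \<xi>|lborel. ?g y \<xi>) = f y * complex_of_real ((sqrt (2 * pi) / s) ^ CARD('n) * exp (- ((norm (x - y))\<^sup>2 / (2 * s\<^sup>2))))"
      using gaussian_fourier[OF s, of "x - y"] by (simp only: has_bochner_integral_iff mult.commute)
  qed
  finally show ?thesis .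
qed

text \<open>The damped identity is evaluated on both sides as \<open>s n\<close> tends to 0. On the
  frequency side \<open>cmod (fourier f \<xi>)\<close> dominates; on the other side the substitution
  \<open>y = x + s n * u\<close> freezes the Gaussian and moves the limit into \<open>f\<close>,
  which is bounded and continuous. The constant is the square of \<open>?C\<close>.\<close>

lemma fourier_inversion:
  fixes f :: "real ^ 'n \<Rightarrow> complex"
  assumes f: "integrable lborel f" and cont: "continuous_on UNIV f" and bdd: "bounded (range f)"
    and ff: "integrable lborel (fourier f)"
  shows "(LINT \<xi>|lborel. cis (x \<bullet> \<xi>) * fourier f \<xi>) = complex_of_real ((2 * pi) ^ CARD('n)) * f x"
proof -
  obtain B where B: "\<And>y. cmod (f y) \<le> B" "B > 0" using bdd by (auto simp: bounded_pos)
  have fm [measurable]: "f \<in> borel_measurable borel" and ffm [measurable]: "fourier f \<in> borel_measurable borel"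
    using f ff by auto
  define s where "s n = 1 / real (Suc n)" for n
  have s: "s n > 0" for n by (simp add: s_def)
  have s0: "s \<longlonglongrightarrow> 0" unfolding s_def by (rule LIMSEQ_Suc[OF lim_1_over_n])
  let ?I = "\<lambda>n. (LINT \<xi>|lborel. cis (x \<bullet> \<xi>) * complex_of_real (exp (- ((s n)\<^sup>2 * (norm \<xi>)\<^sup>2 / 2))) * fourier f \<xi>)"
  let ?C = "complex_of_real ((sqrt (2 * pi)) ^ CARD('n))"
  have gauss: "has_bochner_integral lborel (\<lambda>u :: real ^ 'n. complex_of_real (exp (- ((norm u)\<^sup>2 / 2)))) ?C"
    using gaussian_fourier[of 1 "0 :: real ^ 'n"] by simp
  have lim1: "?I \<longlonglongrightarrow> (LINT \<xi>|lborel. cis (x \<bullet> \<xi>) * fourier f \<xi>)"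
  proof (rule integral_dominated_convergence[where w = "\<lambda>\<xi>. cmod (fourier f \<xi>)"])
    show "AE \<xi> in lborel. (\<lambda>n. cis (x \<bullet> \<xi>) * complex_of_real (exp (- ((s n)\<^sup>2 * (norm \<xi>)\<^sup>2 / 2))) * fourier f \<xi>)
        \<longlonglongrightarrow> cis (x \<bullet> \<xi>) * fourier f \<xi>"
    proof (rule AE_I2)
      fix \<xi> :: "real ^ 'n"
      have "(\<lambda>n. cis (x \<bullet> \<xi>) * complex_of_real (exp (- ((s n)\<^sup>2 * (norm \<xi>)\<^sup>2 / 2))) * fourier f \<xi>)
        \<longlonglongrightarrow> cis (x \<bullet> \<xi>) * complex_of_real (exp (- (0\<^sup>2 * (norm \<xi>)\<^sup>2 / 2))) * fourier f \<xi>"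
        by (intro tendsto_intros s0) auto
      then show "(\<lambda>n. cis (x \<bullet> \<xi>) * complex_of_real (exp (- ((s n)\<^sup>2 * (norm \<xi>)\<^sup>2 / 2))) * fourier f \<xi>)
        \<longlonglongrightarrow> cis (x \<bullet> \<xi>) * fourier f \<xi>" by simp
    qed
    show "AE \<xi> in lborel. norm (cis (x \<bullet> \<xi>) * complex_of_real (exp (- ((s n)\<^sup>2 * (norm \<xi>)\<^sup>2 / 2))) * fourier f \<xi>)
        \<le> cmod (fourier f \<xi>)" for n
      by (intro AE_I2) (auto simp: norm_mult intro!: mult_left_le_one_le)
    show "integrable lborel (\<lambda>\<xi>. cmod (fourier f \<xi>))" using ff by (rule integrable_norm)
  qed measurable
  have eq: "?I n = (LINT u|lborel. ?C * (f (x + s n *\<^sub>R u) * complex_of_real (exp (- ((norm u)\<^sup>2 / 2)))))" for n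
  proof -
    have "?I n = (LINT y|lborel. f y * complex_of_real ((sqrt (2 * pi) / s n) ^ CARD('n) * exp (- ((norm (x - y))\<^sup>2 / (2 * (s n)\<^sup>2)))))"
      by (rule fourier_multiplication[OF f s])
    also have "\<dots> = (LINT u|lborel. complex_of_real (s n ^ DIM(real ^ 'n)) * (f (x + s n *\<^sub>R u) *
        complex_of_real ((sqrt (2 * pi) / s n) ^ CARD('n) * exp (- ((norm (x - (x + s n *\<^sub>R u)))\<^sup>2 / (2 * (s n)\<^sup>2))))))"
      by (rule lborel_integral_affine[OF _ s]) measurable
    also have "\<dots> = (LINT u|lborel. ?C * (f (x + s n *\<^sub>R u) * complex_of_real (exp (- ((norm u)\<^sup>2 / 2)))))"
      using s[of n] by (intro Bochner_Integration.integral_cong refl) (simp add: power_mult_distrib power_divide)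
    finally show ?thesis .
  qed
  have lim2: "(\<lambda>n. LINT u|lborel. ?C * (f (x + s n *\<^sub>R u) * complex_of_real (exp (- ((norm u)\<^sup>2 / 2)))))
      \<longlonglongrightarrow> (LINT u|lborel. ?C * (f x * complex_of_real (exp (- ((norm (u :: real ^ 'n))\<^sup>2 / 2)))))"
  proof (rule integral_dominated_convergence[where w = "\<lambda>u. cmod ?C * (B * exp (- ((norm u)\<^sup>2 / 2)))"])
    have fc: "isCont f x" using cont by (simp add: continuous_on_eq_continuous_at)
    show "AE u in lborel. (\<lambda>n. ?C * (f (x + s n *\<^sub>R u) * complex_of_real (exp (- ((norm u)\<^sup>2 / 2)))))
        \<longlonglongrightarrow> ?C * (f x * complex_of_real (exp (- ((norm u)\<^sup>2 / 2))))"
    proof (rule AE_I2)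
      fix u :: "real ^ 'n"
      have "(\<lambda>n. x + s n *\<^sub>R u) \<longlonglongrightarrow> x + 0 *\<^sub>R u" by (intro tendsto_intros s0)
      then have "(\<lambda>n. f (x + s n *\<^sub>R u)) \<longlonglongrightarrow> f x" by (intro isCont_tendsto_compose[OF fc]) simp
      then show "(\<lambda>n. ?C * (f (x + s n *\<^sub>R u) * complex_of_real (exp (- ((norm u)\<^sup>2 / 2)))))
        \<longlonglongrightarrow> ?C * (f x * complex_of_real (exp (- ((norm u)\<^sup>2 / 2))))" by (intro tendsto_intros)
    qed
    show "AE u in lborel. norm (?C * (f (x + s n *\<^sub>R u) * complex_of_real (exp (- ((norm u)\<^sup>2 / 2)))))
        \<le> cmod ?C * (B * exp (- ((norm u)\<^sup>2 / 2)))" for n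
    proof (rule AE_I2)
      fix u :: "real ^ 'n"
      have "cmod (f (x + s n *\<^sub>R u)) * exp (- ((norm u)\<^sup>2 / 2)) \<le> B * exp (- ((norm u)\<^sup>2 / 2))"
        using B(1) by (rule mult_right_mono) simp
      then show "norm (?C * (f (x + s n *\<^sub>R u) * complex_of_real (exp (- ((norm u)\<^sup>2 / 2)))))
        \<le> cmod ?C * (B * exp (- ((norm u)\<^sup>2 / 2)))"
        unfolding norm_mult norm_of_real abs_exp_cancel by (rule mult_left_mono) (rule abs_ge_zero)
    qed
    have "integrable lborel (\<lambda>u :: real ^ 'n. norm (complex_of_real (exp (- ((norm u)\<^sup>2 / 2)))))"
      using gauss by (intro integrable_norm) (simp only: has_bochner_integral_iff)
    then show "integrable lborel (\<lambda>u :: real ^ 'n. cmod ?C * (B * exp (- ((norm u)\<^sup>2 / 2))))"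
      by (intro integrable_mult_right) simp
  qed measurable
  have val: "(LINT u|lborel. ?C * (f x * complex_of_real (exp (- ((norm (u :: real ^ 'n))\<^sup>2 / 2))))) =
      complex_of_real ((2 * pi) ^ CARD('n)) * f x"
  proof -
    have "(LINT u|lborel. ?C * (f x * complex_of_real (exp (- ((norm (u :: real ^ 'n))\<^sup>2 / 2))))) = ?C * (f x * ?C)"
      using gauss unfolding has_bochner_integral_iff by (simp only: integral_mult_right_zero)
    also have "\<dots> = complex_of_real ((sqrt (2 * pi) * sqrt (2 * pi)) ^ CARD('n)) * f x"
      by (simp only: power_mult_distrib of_real_mult mult_ac)
    finally show ?thesis by simp
  qed
  show ?thesis using LIMSEQ_unique[OF lim1[unfolded eq] lim2] unfolding val .
qed

text \<open>As \<open>g\<close> is known to be differentiable, its derivative can be read off along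
  the single sequence \<open>1 / (n + 1)\<close>, to which dominated convergence applies.\<close>

lemma partial_deriv_fourier_integral:
  fixes k :: "real ^ 'n \<Rightarrow> complex"
  assumes k: "integrable lborel k" and k1: "integrable lborel (\<lambda>\<xi>. (1 + norm \<xi>) * cmod (k \<xi>))"
    and g: "\<And>x. g x = (LINT \<xi>|lborel. cis (x \<bullet> \<xi>) * k \<xi>)" and diff: "g differentiable (at x)"
  shows "partial_deriv j g x = (LINT \<xi>|lborel. cis (x \<bullet> \<xi>) * (\<i> * complex_of_real (\<xi> $ j) * k \<xi>))"
proof -
  have km [measurable]: "k \<in> borel_measurable borel" using k by auto
  define t where "t n = 1 / real (Suc n)" for n
  have t: "t n \<noteq> 0" for n by (simp add: t_def)
  have "t \<longlonglongrightarrow> 0" unfolding t_def by (rule LIMSEQ_Suc[OF lim_1_over_n])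
  then have t0: "filterlim t (at 0) sequentially" using t by (simp add: filterlim_at)
  have quotient: "(\<lambda>n. (h (t n) - h 0) / complex_of_real (t n)) \<longlonglongrightarrow> h'" if "(h has_vector_derivative h') (at 0)" for h h'
  proof -
    have "((\<lambda>y. norm (h y - h 0 - (y - 0) *\<^sub>R h') / norm (y - 0)) \<longlongrightarrow> 0) (at 0)"
      using that unfolding has_vector_derivative_def has_derivative_iff_norm by (rule conjunct2)
    from filterlim_compose[OF this t0]
    have "(\<lambda>n. norm (h (t n) - h 0 - (t n - 0) *\<^sub>R h') / norm (t n - 0)) \<longlonglongrightarrow> 0" .
    moreover have "norm (h (t n) - h 0 - (t n - 0) *\<^sub>R h') / norm (t n - 0) = norm ((h (t n) - h 0) / complex_of_real (t n) - h')" for n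
    proof -
      have "(h (t n) - h 0) / complex_of_real (t n) - h' = (h (t n) - h 0 - complex_of_real (t n) * h') / complex_of_real (t n)"
        using t[of n] by (simp add: diff_divide_distrib)
      then show ?thesis by (simp only: norm_divide norm_of_real scaleR_conv_of_real diff_zero real_norm_def)
    qed
    ultimately have "(\<lambda>n. norm ((h (t n) - h 0) / complex_of_real (t n) - h')) \<longlonglongrightarrow> 0" by (simp only:)
    then show ?thesis by (rule LIM_zero_cancel[OF tendsto_norm_zero_cancel])
  qed
  let ?q = "\<lambda>n. (g (x + t n *\<^sub>R axis j 1) - g x) / complex_of_real (t n)"
  have "((\<lambda>r. g (x + r *\<^sub>R axis j 1)) has_vector_derivative partial_deriv j g x) (at 0)"
  proof -
    have 1: "(g has_derivative frechet_derivative g (at x)) (at (x + 0 *\<^sub>R axis j 1))"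
      using diff unfolding frechet_derivative_works by (simp only: scaleR_zero_left add_0_right)
    have 2: "((\<lambda>r. x + r *\<^sub>R axis j 1) has_derivative (\<lambda>r. r *\<^sub>R axis j 1)) (at (0 :: real))"
      by (rule has_derivative_eq_rhs[OF has_derivative_add[OF has_derivative_const has_derivative_scaleR_left[OF has_derivative_ident]]]) simp
    have "((\<lambda>r. g (x + r *\<^sub>R axis j 1)) has_derivative (\<lambda>r. frechet_derivative g (at x) (r *\<^sub>R axis j 1))) (at 0)"
      by (rule has_derivative_compose[OF 2 1])
    moreover have "frechet_derivative g (at x) (r *\<^sub>R axis j 1) = r *\<^sub>R partial_deriv j g x" for r
      unfolding partial_deriv_def using linear_frechet_derivative[OF diff] by (rule linear_scale)
    ultimately show ?thesis unfolding has_vector_derivative_def by (simp only:)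
  qed
  from quotient[OF this] have 1: "?q \<longlonglongrightarrow> partial_deriv j g x"
    by (simp only: scaleR_zero_left add_0_right)
  have int: "integrable lborel (\<lambda>\<xi>. cis (y \<bullet> \<xi>) * k \<xi>)" for y
    by (rule Bochner_Integration.integrable_bound[OF k]) (auto simp: norm_mult)
  have q: "?q n = (LINT \<xi>|lborel. (cis (x \<bullet> \<xi>) * k \<xi>) * ((cis (t n * \<xi> $ j) - 1) / complex_of_real (t n)))" for n
  proof -
    have "?q n = (LINT \<xi>|lborel. (cis ((x + t n *\<^sub>R axis j 1) \<bullet> \<xi>) * k \<xi> - cis (x \<bullet> \<xi>) * k \<xi>) / complex_of_real (t n))"
      unfolding g by (simp only: integral_divide_zero Bochner_Integration.integral_diff[OF int int])
    also have "\<dots> = (LINT \<xi>|lborel. (cis (x \<bullet> \<xi>) * k \<xi>) * ((cis (t n * \<xi> $ j) - 1) / complex_of_real (t n)))"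
    proof (intro Bochner_Integration.integral_cong refl)
      fix \<xi> :: "real ^ 'n"
      have c: "cis ((x + t n *\<^sub>R axis j 1) \<bullet> \<xi>) = cis (x \<bullet> \<xi>) * cis (t n * \<xi> $ j)"
        by (simp add: inner_add_left inner_axis' cis_mult)
      have "(a * b * k - a * k) / r = (a * k) * ((b - 1) / r)" for a b k r :: complex
      proof -
        have "a * b * k - a * k = (a * k) * (b - 1)" by (simp add: algebra_simps)
        then show ?thesis by (simp only: times_divide_eq_right)
      qed
      then show "(cis ((x + t n *\<^sub>R axis j 1) \<bullet> \<xi>) * k \<xi> - cis (x \<bullet> \<xi>) * k \<xi>) / complex_of_real (t n) =
          (cis (x \<bullet> \<xi>) * k \<xi>) * ((cis (t n * \<xi> $ j) - 1) / complex_of_real (t n))"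
        unfolding c .
    qed
    finally show ?thesis .
  qed
  have "?q \<longlonglongrightarrow> (LINT \<xi>|lborel. (cis (x \<bullet> \<xi>) * k \<xi>) * (\<i> * complex_of_real (\<xi> $ j)))"
    unfolding q
  proof (rule integral_dominated_convergence[where w = "\<lambda>\<xi>. (1 + norm \<xi>) * cmod (k \<xi>)"])
    show "AE \<xi> in lborel. (\<lambda>n. (cis (x \<bullet> \<xi>) * k \<xi>) * ((cis (t n * \<xi> $ j) - 1) / complex_of_real (t n)))
        \<longlonglongrightarrow> (cis (x \<bullet> \<xi>) * k \<xi>) * (\<i> * complex_of_real (\<xi> $ j))"
    proof (intro AE_I2 tendsto_mult tendsto_const)
      fix \<xi> :: "real ^ 'n"
      have "((\<lambda>r. cis (r * \<xi> $ j)) has_vector_derivative \<i> * complex_of_real (\<xi> $ j)) (at 0)"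
      proof -
        have 1: "((\<lambda>r :: real. r * \<xi> $ j) has_derivative (\<lambda>r. r * \<xi> $ j)) (at 0)"
          by (rule bounded_linear_imp_has_derivative[OF bounded_linear_mult_left])
        have 2: "(r * \<xi> $ j) *\<^sub>R (\<i> * cis (0 * \<xi> $ j)) = r *\<^sub>R (\<i> * complex_of_real (\<xi> $ j))" for r
          by (simp add: scaleR_conv_of_real)
        from has_derivative_cis[OF 1] show ?thesis
          unfolding has_vector_derivative_def 2 .
      qed
      from quotient[OF this]
      show "(\<lambda>n. (cis (t n * \<xi> $ j) - 1) / complex_of_real (t n)) \<longlonglongrightarrow> \<i> * complex_of_real (\<xi> $ j)"
        by (simp only: mult_zero_left cis_zero)
    qed
    show "AE \<xi> in lborel. norm ((cis (x \<bullet> \<xi>) * k \<xi>) * ((cis (t n * \<xi> $ j) - 1) / complex_of_real (t n)))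
        \<le> (1 + norm \<xi>) * cmod (k \<xi>)" for n
    proof (rule AE_I2)
      fix \<xi> :: "real ^ 'n"
      \<comment> \<open>The chord is at most as long as the arc, so the difference quotients are
        bounded by \<open>norm \<xi>\<close> for all \<open>n\<close>; hence the moment assumption
        on \<open>k\<close>.\<close>
      have "cmod (cis (t n * \<xi> $ j) - 1) \<le> \<bar>t n * \<xi> $ j\<bar>"
        using iexp_approx1[of "t n * \<xi> $ j" 0] by (simp add: cis_conv_exp)
      also have "\<dots> \<le> \<bar>t n\<bar> * norm \<xi>"
        unfolding abs_mult by (intro mult_left_mono component_le_norm_cart) auto
      finally have "cmod (cis (t n * \<xi> $ j) - 1) / \<bar>t n\<bar> \<le> norm \<xi>"
        using t[of n] by (simp add: pos_divide_le_eq mult.commute)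
      then have le: "cmod (cis (t n * \<xi> $ j) - 1) / \<bar>t n\<bar> \<le> 1 + norm \<xi>" by linarith
      show "norm ((cis (x \<bullet> \<xi>) * k \<xi>) * ((cis (t n * \<xi> $ j) - 1) / complex_of_real (t n)))
        \<le> (1 + norm \<xi>) * cmod (k \<xi>)"
        using mult_right_mono[OF le, of "cmod (k \<xi>)"]
        by (simp only: norm_mult norm_divide norm_cis norm_of_real mult_1 mult.commute norm_ge_zero)
    qed
    show "integrable lborel (\<lambda>\<xi>. (1 + norm \<xi>) * cmod (k \<xi>))" by (rule k1)
    have [measurable]: "(\<lambda>\<xi> :: real ^ 'n. \<xi> $ j) \<in> borel_measurable borel"
      by (intro borel_measurable_continuous_onI continuous_intros)
    have [measurable]: "(\<lambda>\<xi> :: real ^ 'n. cis (r * \<xi> $ j)) \<in> borel_measurable borel" for r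
      by (intro borel_measurable_continuous_onI continuous_intros)
    show "(\<lambda>\<xi>. (cis (x \<bullet> \<xi>) * k \<xi>) * (\<i> * complex_of_real (\<xi> $ j))) \<in> borel_measurable lborel" by measurable
    show "(\<lambda>\<xi>. (cis (x \<bullet> \<xi>) * k \<xi>) * ((cis (t n * \<xi> $ j) - 1) / complex_of_real (t n))) \<in> borel_measurable lborel" for n
      by measurable
  qed
  from LIMSEQ_unique[OF 1 this] show ?thesis by (simp only: mult_ac)
qed

section \<open>Test functions are multipliers\<close>

text \<open>Comparison with the product of the kernels \<open>1 / (1 + x_i^2)\<close>: since
  \<open>1 + x_i^2 \<le> (1 + |x|)^2\<close>, the exponent is twice the dimension.\<close>

lemma integrable_inverse_power_norm:
  "integrable lborel (\<lambda>x :: real ^ 'n. inverse ((1 + norm x) ^ (2 * CARD('n))))"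
proof (rule Bochner_Integration.integrable_bound)
  have "integrable lborel (\<lambda>x :: real. inverse (1 + x\<^sup>2))"
    using integrable_inverse_1_plus_square by (simp add: set_integrable_def)
  then have "has_bochner_integral lborel (\<lambda>x :: real. inverse (1 + x\<^sup>2)) (LINT x|lborel. inverse (1 + x\<^sup>2))"
    by (rule has_bochner_integral_integrable)
  from has_bochner_integral_prod_vec[of "\<lambda>_ :: 'n. \<lambda>x. inverse (1 + x\<^sup>2)", OF this]
  show "integrable lborel (\<lambda>x :: real ^ 'n. \<Prod>i\<in>UNIV. inverse (1 + (x $ i)\<^sup>2))"
    by (simp add: has_bochner_integral_iff)
  show "AE x in lborel. norm (inverse ((1 + norm x) ^ (2 * CARD('n)))) \<le> norm (\<Prod>i\<in>UNIV. inverse (1 + ((x :: real ^ 'n) $ i)\<^sup>2))"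
  proof (rule AE_I2)
    fix x :: "real ^ 'n"
    have "(\<Prod>i\<in>UNIV. 1 + (x $ i)\<^sup>2) \<le> (\<Prod>i\<in>(UNIV :: 'n set). (1 + norm x)\<^sup>2)"
    proof (intro prod_mono conjI)
      fix i
      have "(\<bar>x $ i\<bar>)\<^sup>2 \<le> (norm x)\<^sup>2" by (intro power_mono component_le_norm_cart) auto
      then show "1 + (x $ i)\<^sup>2 \<le> (1 + norm x)\<^sup>2" by (simp add: power2_sum add_increasing2)
    qed auto
    then have "inverse ((1 + norm x) ^ (2 * CARD('n))) \<le> inverse (\<Prod>i\<in>UNIV. 1 + (x $ i)\<^sup>2)"
      by (intro le_imp_inverse_le) (auto simp: power_mult intro!: prod_pos add_pos_nonneg)
    also have "\<dots> = (\<Prod>i\<in>UNIV. inverse (1 + (x $ i)\<^sup>2))" by (simp add: prod_inversef[symmetric] o_def)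
    finally show "norm (inverse ((1 + norm x) ^ (2 * CARD('n)))) \<le> norm (\<Prod>i\<in>UNIV. inverse (1 + (x $ i)\<^sup>2))"
      by (simp add: abs_of_nonneg prod_nonneg)
  qed
qed measurable

text \<open>The Fourier symbol of \<open>pderivs is\<close>.\<close>

definition frequency_monomial :: "'n list \<Rightarrow> real ^ 'n \<Rightarrow> complex" where
  "frequency_monomial is \<xi> = prod_list (map (\<lambda>i. \<i> * complex_of_real (\<xi> $ i)) is)"

lemma norm_frequency_monomial_le: "cmod (frequency_monomial is \<xi>) \<le> norm \<xi> ^ length is"
  by (induction "is")
    (auto simp: frequency_monomial_def norm_mult intro!: mult_mono component_le_norm_cart)

lemma borel_measurable_frequency_monomial [measurable]: "frequency_monomial is \<in> borel_measurable borel"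
proof (intro borel_measurable_continuous_onI)
  show "continuous_on UNIV (frequency_monomial is)"
    by (induction "is") (auto simp: frequency_monomial_def[abs_def] intro!: continuous_intros)
qed

context weight
begin

section \<open>Fourier decay and derivative bounds of test functions\<close>

lemma S_space_zero_order:
  assumes f: "f \<in> S_space \<omega>" and l: "l > 0"
  shows "bounded (range (\<lambda>x. exp (l * \<omega> (norm x)) *\<^sub>R f x))"
    and "bounded (range (\<lambda>\<xi>. exp (l * \<omega> (norm \<xi>)) *\<^sub>R fourier f \<xi>))"
proof -
  have "word (\<lambda>_. 0) = ([] :: 'a list)" by (simp add: word_def)
  then have "multi_deriv (\<lambda>_. 0) g = g" for g :: "real ^ 'a \<Rightarrow> complex"
    by (simp add: multi_deriv_word)
  moreover have "bounded (range (\<lambda>x. exp (l * \<omega> (norm x)) *\<^sub>R multi_deriv (\<lambda>_. 0) f x)) \<and>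
      bounded (range (\<lambda>\<xi>. exp (l * \<omega> (norm \<xi>)) *\<^sub>R multi_deriv (\<lambda>_. 0) (fourier f) \<xi>))"
    using f l unfolding S_space_def by blast
  ultimately show "bounded (range (\<lambda>x. exp (l * \<omega> (norm x)) *\<^sub>R f x))"
    "bounded (range (\<lambda>\<xi>. exp (l * \<omega> (norm \<xi>)) *\<^sub>R fourier f \<xi>))"
    by (simp_all only:)
qed

lemma fourier_decay:
  assumes f: "f \<in> S_space \<omega>"
  obtains C where "C > 0" "\<And>\<xi>. (1 + norm \<xi>) ^ p * cmod (fourier f \<xi>) \<le> C * exp (- (real m * \<omega> (norm \<xi>)))"
proof -
  obtain C q where C: "C > 0" "\<And>t. 0 \<le> t \<Longrightarrow> (1 + t) ^ p \<le> C * exp (real q * \<omega> t)"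
    using power_bound by blast
  \<comment> \<open>\<open>q\<close> pays for the polynomial, \<open>m\<close> is the decay that
    remains, and 1 keeps \<open>l\<close> positive.\<close>
  define l where "l = real q + real m + 1"
  have "bounded (range (\<lambda>\<xi>. exp (l * \<omega> (norm \<xi>)) *\<^sub>R fourier f \<xi>))"
    by (rule S_space_zero_order(2)[OF f]) (simp add: l_def)
  then obtain B where B: "B > 0" "\<And>\<xi>. exp (l * \<omega> (norm \<xi>)) * cmod (fourier f \<xi>) \<le> B"
    by (auto simp: bounded_pos)
  have "(1 + norm \<xi>) ^ p * cmod (fourier f \<xi>) \<le> (C * B) * exp (- (real m * \<omega> (norm \<xi>)))" for \<xi>
  proof -
    let ?w = "\<omega> (norm \<xi>)"
    have w: "?w \<ge> 0" by (simp add: nonneg)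
    have "(1 + norm \<xi>) ^ p * cmod (fourier f \<xi>) \<le> (C * exp (real q * ?w)) * (B * exp (- (l * ?w)))"
    proof (intro mult_mono C(2))
      show "cmod (fourier f \<xi>) \<le> B * exp (- (l * ?w))"
      proof -
        have "e * F \<le> B \<Longrightarrow> e > 0 \<Longrightarrow> F \<le> B * inverse e" for e F :: real
          by (simp add: field_simps)
        from this[OF B(2)[of \<xi>]] show ?thesis by (simp only: exp_minus exp_gt_zero)
      qed
    qed (use C in auto)
    also have "\<dots> = (C * B) * exp (real q * ?w - l * ?w)"
      by (simp add: exp_diff exp_minus divide_inverse)
    also have "\<dots> \<le> (C * B) * exp (- (real m * ?w))"
      using C(1) B(1) w by (intro mult_left_mono) (auto simp: l_def algebra_simps)
    finally show ?thesis .
  qed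
  then show ?thesis using that[of "C * B"] C(1) B(1) by simp
qed

lemma integrable_fourier_moment:
  fixes f :: "real ^ 'n \<Rightarrow> complex"
  assumes f: "f \<in> S_space \<omega>"
  shows "integrable lborel (\<lambda>\<xi>. (1 + norm \<xi>) ^ p * cmod (fourier f \<xi>))"
proof -
  \<comment> \<open>The extra \<open>2 * CARD('n)\<close> powers supply an integrable majorant, so
    decay of order 0 is enough.\<close>
  obtain C where C: "C > 0" "\<And>\<xi>. (1 + norm \<xi>) ^ (p + 2 * CARD('n)) * cmod (fourier f \<xi>) \<le> C * exp (- (real 0 * \<omega> (norm \<xi>)))"
    using fourier_decay[OF f] by blast
  have "continuous_on UNIV (fourier f)" using f by (auto simp: S_space_def intro: smooth_continuous)
  then have [measurable]: "fourier f \<in> borel_measurable borel" by (rule borel_measurable_continuous_onI)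
  show ?thesis
  proof (rule Bochner_Integration.integrable_bound)
    show "integrable lborel (\<lambda>\<xi> :: real ^ 'n. C * inverse ((1 + norm \<xi>) ^ (2 * CARD('n))))"
      by (intro integrable_mult_right integrable_inverse_power_norm)
    show "AE \<xi> in lborel. norm ((1 + norm \<xi>) ^ p * cmod (fourier f \<xi>)) \<le> norm (C * inverse ((1 + norm \<xi>) ^ (2 * CARD('n))))"
    proof (rule AE_I2)
      fix \<xi> :: "real ^ 'n"
      have pos: "(1 + norm \<xi>) ^ (2 * CARD('n)) > 0" by (simp add: add_pos_nonneg)
      have "(1 + norm \<xi>) ^ p * cmod (fourier f \<xi>) * (1 + norm \<xi>) ^ (2 * CARD('n)) \<le> C"
        using C(2)[of \<xi>] by (simp add: power_add mult_ac)
      then have "(1 + norm \<xi>) ^ p * cmod (fourier f \<xi>) \<le> C * inverse ((1 + norm \<xi>) ^ (2 * CARD('n)))"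
        using pos by (simp add: pos_le_divide_eq divide_inverse[symmetric])
      then show "norm ((1 + norm \<xi>) ^ p * cmod (fourier f \<xi>)) \<le> norm (C * inverse ((1 + norm \<xi>) ^ (2 * CARD('n))))"
        using C(1) by (simp add: abs_mult)
    qed
    show "(\<lambda>\<xi>. (1 + norm \<xi>) ^ p * cmod (fourier f \<xi>)) \<in> borel_measurable lborel" by measurable
  qed
qed

text \<open>The empty list is Fourier inversion; each further derivative passes under the integral
  because all moments of \<open>fourier f\<close> are finite.\<close>

lemma pderivs_S_space:
  fixes f :: "real ^ 'n \<Rightarrow> complex"
  assumes f: "f \<in> S_space \<omega>"
  shows "pderivs is f x = (LINT \<xi>|lborel. cis (x \<bullet> \<xi>) *
    (frequency_monomial is \<xi> * (fourier f \<xi> / complex_of_real ((2 * pi) ^ CARD('n)))))"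
proof -
  define K where "K = (2 * pi) ^ CARD('n)"
  have K1: "K \<ge> 1" using pi_ge_two unfolding K_def by (intro one_le_power) simp
  define k where "k is \<xi> = frequency_monomial is \<xi> * (fourier f \<xi> / complex_of_real K)" for "is" \<xi>
  have sm: "smooth f" and fint: "integrable lborel f" using f by (auto simp: S_space_def)
  have "continuous_on UNIV (fourier f)" using f by (auto simp: S_space_def intro: smooth_continuous)
  then have ffm [measurable]: "fourier f \<in> borel_measurable borel" by (rule borel_measurable_continuous_onI)
  have km [measurable]: "k is \<in> borel_measurable borel" for "is"
    unfolding k_def[abs_def] by measurable
  have kint: "integrable lborel (\<lambda>\<xi>. (1 + norm \<xi>) ^ p * cmod (k is \<xi>))" for p "is"
  proof (rule Bochner_Integration.integrable_bound[OF integrable_fourier_moment[OF f, of "p + length is"]])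
    show "AE \<xi> in lborel. norm ((1 + norm \<xi>) ^ p * cmod (k is \<xi>)) \<le> norm ((1 + norm \<xi>) ^ (p + length is) * cmod (fourier f \<xi>))"
    proof (rule AE_I2)
      fix \<xi> :: "real ^ 'n"
      have "cmod (fourier f \<xi> / complex_of_real K) \<le> cmod (fourier f \<xi>)"
        using K1 divide_left_mono[of 1 K "cmod (fourier f \<xi>)"] by (simp add: norm_divide)
      moreover have "cmod (frequency_monomial is \<xi>) \<le> (1 + norm \<xi>) ^ length is"
        by (rule order_trans[OF norm_frequency_monomial_le]) (simp add: power_mono)
      ultimately have "cmod (k is \<xi>) \<le> (1 + norm \<xi>) ^ length is * cmod (fourier f \<xi>)"
        unfolding k_def norm_mult by (intro mult_mono) auto
      then have "(1 + norm \<xi>) ^ p * cmod (k is \<xi>) \<le> (1 + norm \<xi>) ^ p * ((1 + norm \<xi>) ^ length is * cmod (fourier f \<xi>))"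
        by (rule mult_left_mono) simp
      then show "norm ((1 + norm \<xi>) ^ p * cmod (k is \<xi>)) \<le> norm ((1 + norm \<xi>) ^ (p + length is) * cmod (fourier f \<xi>))"
        by (simp add: abs_mult power_add mult.assoc)
    qed
  qed measurable
  have kint0: "integrable lborel (k is)" for "is"
    using kint[of 0 "is"] km[of "is"] integrable_norm_iff[of "k is" lborel] by simp
  have "pderivs is f x = (LINT \<xi>|lborel. cis (x \<bullet> \<xi>) * k is \<xi>)"
  proof (induction "is" arbitrary: x)
    case Nil
    have ffint: "integrable lborel (fourier f)"
      using integrable_fourier_moment[OF f, of 0] ffm integrable_norm_iff[of "fourier f" lborel] by simp
    have bdd: "bounded (range f)"
    proof -
      have "bounded (range (\<lambda>x. exp (1 * \<omega> (norm x)) *\<^sub>R f x))" by (rule S_space_zero_order(1)[OF f]) simp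
      then obtain B where B: "\<And>x. exp (\<omega> (norm x)) * cmod (f x) \<le> B" by (auto simp: bounded_pos)
      have "cmod (f x) \<le> B" for x
        using B[of x] mult_right_mono[of 1 "exp (\<omega> (norm x))" "cmod (f x)"] nonneg[of "norm x"] by simp
      then show ?thesis by (auto simp: bounded_iff)
    qed
    have inv: "(LINT \<xi>|lborel. cis (x \<bullet> \<xi>) * fourier f \<xi>) = complex_of_real K * f x"
      unfolding K_def by (rule fourier_inversion[OF fint smooth_continuous[OF sm] bdd ffint])
    have "(LINT \<xi>|lborel. cis (x \<bullet> \<xi>) * k [] \<xi>) = (LINT \<xi>|lborel. (cis (x \<bullet> \<xi>) * fourier f \<xi>) / complex_of_real K)"
      unfolding k_def frequency_monomial_def by (simp only: list.map prod_list.Nil mult_1 times_divide_eq_right)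
    also have "\<dots> = f x"
      unfolding integral_divide_zero inv using K1 by simp
    finally show ?case by simp
  next
    case (Cons j "is")
    have "partial_deriv j (pderivs is f) x = (LINT \<xi>|lborel. cis (x \<bullet> \<xi>) * (\<i> * complex_of_real (\<xi> $ j) * k is \<xi>))"
    proof (rule partial_deriv_fourier_integral[OF kint0 _ Cons])
      show "integrable lborel (\<lambda>\<xi>. (1 + norm \<xi>) * cmod (k is \<xi>))" using kint[of 1 "is"] by simp
      show "pderivs is f differentiable at x" using sm by (simp add: smooth_def)
    qed
    moreover have "\<i> * complex_of_real (\<xi> $ j) * k is \<xi> = k (j # is) \<xi>" for \<xi>
      by (simp add: k_def frequency_monomial_def)
    ultimately show ?case by simp
  qed
  then show ?thesis by (simp only: k_def K_def)
qed

text \<open>The symbol of \<open>is\<close> times \<open>deriv_weight\<close> is at most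
  \<open>exp (m * \<omega>)\<close>, for which the decay of \<open>fourier f\<close> pays uniformly
  in \<open>is\<close>. The fixed tail \<open>js\<close> costs only a polynomial; it is separated so
  that derivatives of test functions are covered too.\<close>

lemma S_space_pderivs_bound:
  fixes f :: "real ^ 'n \<Rightarrow> complex"
  assumes f: "f \<in> S_space \<omega>" and m: "m \<ge> 1"
  obtains C where "\<And>is x. cmod (pderivs (is @ js) f x) * deriv_weight \<omega> m (length is) \<le> C"
proof -
  define K where "K = (2 * pi) ^ CARD('n)"
  have K1: "K \<ge> 1" using pi_ge_two unfolding K_def by (intro one_le_power) simp
  then have K0: "K > 0" by linarith
  let ?N = "2 * CARD('n)"
  obtain C where C: "C > 0" "\<And>\<xi>. (1 + norm \<xi>) ^ (length js + ?N) * cmod (fourier f \<xi>) \<le> C * exp (- (real m * \<omega> (norm \<xi>)))"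
    using fourier_decay[OF f] by metis
  define I where "I = (LINT \<xi>|lborel. C * inverse ((1 + norm (\<xi> :: real ^ 'n)) ^ ?N))"
  have I: "integrable lborel (\<lambda>\<xi> :: real ^ 'n. C * inverse ((1 + norm \<xi>) ^ ?N))"
    by (intro integrable_mult_right integrable_inverse_power_norm)
  have "cmod (pderivs (is @ js) f x) * deriv_weight \<omega> m (length is) \<le> I" for "is" x
  proof -
    define d where "d = deriv_weight \<omega> m (length is)"
    have d: "d > 0" unfolding d_def by (rule deriv_weight_pos[OF m])
    define k where "k \<xi> = cis (x \<bullet> \<xi>) * (frequency_monomial (is @ js) \<xi> * (fourier f \<xi> / complex_of_real K))" for \<xi>
    have bound: "norm (complex_of_real d * k \<xi>) \<le> C * inverse ((1 + norm \<xi>) ^ ?N)" for \<xi>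
    proof -
      let ?a = "cmod (frequency_monomial is \<xi>)" and ?b = "cmod (frequency_monomial js \<xi>)" and ?F = "cmod (fourier f \<xi>)"
      let ?w = "real m * \<omega> (norm \<xi>)" and ?r = "1 + norm \<xi>"
      have "?a * d \<le> norm \<xi> ^ length is * d"
        using norm_frequency_monomial_le less_imp_le[OF d] by (rule mult_right_mono)
      also have "\<dots> \<le> exp ?w" unfolding d_def by (rule power_le_deriv_weight[OF m]) simp
      finally have 1: "?a * d \<le> exp ?w" .
      have 2: "?b \<le> ?r ^ length js"
        by (rule order_trans[OF norm_frequency_monomial_le]) (simp add: power_mono)
      have 3: "?F / K \<le> ?F" using K1 divide_left_mono[of 1 K ?F] by simp
      have pos: "?r ^ ?N > 0" by (simp add: add_pos_nonneg)
      have app: "frequency_monomial (is @ js) \<xi> = frequency_monomial is \<xi> * frequency_monomial js \<xi>"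
        by (simp add: frequency_monomial_def)
      have "norm (complex_of_real d * k \<xi>) = d * (1 * ((?a * ?b) * (?F / K)))"
        unfolding k_def app norm_mult norm_divide norm_cis norm_of_real
        using d K1 by (simp only: abs_of_pos[OF d] abs_of_pos[OF K0])
      also have "\<dots> = (?a * d) * (?b * (?F / K))"
        by (simp only: mult_1 mult_ac)
      also have "\<dots> \<le> exp ?w * (?r ^ length js * ?F)"
        using d K1 by (intro mult_mono 1 2 3) auto
      also have "\<dots> = exp ?w * (?r ^ (length js + ?N) * ?F) * inverse (?r ^ ?N)"
      proof -
        have "e * (p * F) = e * (p * q * F) * inverse q" if "q > 0" for e p q F :: real
          using that by (simp add: field_simps)
        from this[OF pos, of "exp ?w" "?r ^ length js" ?F] show ?thesis unfolding power_add .
      qed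
      also have "\<dots> \<le> exp ?w * (C * exp (- ?w)) * inverse (?r ^ ?N)"
        using C(2)[of \<xi>] less_imp_le[OF pos] by (intro mult_right_mono mult_left_mono) auto
      also have "\<dots> = C * inverse (?r ^ ?N)"
      proof -
        have "exp ?w * exp (- ?w) = 1" by (simp only: exp_add[symmetric]) simp
        then show ?thesis by (simp only: mult.left_commute[of "exp ?w"] mult_1_right)
      qed
      finally show ?thesis .
    qed
    have "continuous_on UNIV (fourier f)" using f by (auto simp: S_space_def intro: smooth_continuous)
    then have [measurable]: "fourier f \<in> borel_measurable borel" by (rule borel_measurable_continuous_onI)
    have km: "(\<lambda>\<xi>. complex_of_real d * k \<xi>) \<in> borel_measurable lborel"
      unfolding k_def by measurable
    have int: "integrable lborel (\<lambda>\<xi>. complex_of_real d * k \<xi>)"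
    proof (rule Bochner_Integration.integrable_bound[OF I km], rule AE_I2)
      fix \<xi> :: "real ^ 'n"
      show "norm (complex_of_real d * k \<xi>) \<le> norm (C * inverse ((1 + norm \<xi>) ^ ?N))"
        using bound[of \<xi>] unfolding real_norm_def by linarith
    qed
    have "cmod (pderivs (is @ js) f x) * d = norm (LINT \<xi>|lborel. complex_of_real d * k \<xi>)"
      unfolding pderivs_S_space[OF f] k_def K_def integral_mult_right_zero norm_mult norm_of_real abs_of_pos[OF d]
      by (rule mult.commute)
    also have "\<dots> \<le> I"
      unfolding I_def
      by (rule Bochner_Integration.integral_norm_bound_integral[OF int I bound])
    finally show ?thesis unfolding d_def .
  qed
  then show ?thesis by (rule that)
qed

text \<open>Functionals are extensional, so the convolution formula can be evaluated only where
  translates and derivatives of test functions are multipliers. The derivative bounds are uniform in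
  the point, so step 1 serves for every \<open>m\<close>.\<close>

lemma pderivs_translate_in_OM:
  assumes f: "f \<in> S_space \<omega>"
  shows "(\<lambda>y. pderivs js f (x + y)) \<in> OM_space \<omega>"
  unfolding OM_space_def
proof
  fix m :: nat assume "m \<in> {1..}"
  then have m: "m \<ge> 1" by simp
  have sm: "smooth (pderivs js f)" using f by (auto simp: S_space_def intro: smooth_pderivs)
  obtain C where C: "\<And>is x. cmod (pderivs (is @ js) f x) * deriv_weight \<omega> m (length is) \<le> C"
    using S_space_pderivs_bound[OF f m] by metis
  have "(\<lambda>y. pderivs js f (x + y)) \<in> O_step \<omega> m 1"
  proof (rule O_step_I(1)[OF smooth_translate[OF sm]])
    fix "is" y
    have "cmod (pderivs is (\<lambda>y. pderivs js f (x + y)) y) = cmod (pderivs (is @ js) f (x + y))"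
      by (simp add: pderivs_translate[OF sm])
    moreover have "cmod (pderivs (is @ js) f (x + y)) * exp (- real 1 * \<omega> (norm y)) * deriv_weight \<omega> m (length is) \<le>
        cmod (pderivs (is @ js) f (x + y)) * 1 * deriv_weight \<omega> m (length is)"
      using nonneg[of "norm y"] deriv_weight_pos[OF m, of "length is"] by (intro mult_right_mono mult_left_mono) auto
    ultimately show "cmod (pderivs is (\<lambda>y. pderivs js f (x + y)) y) * exp (- real 1 * \<omega> (norm y)) * deriv_weight \<omega> m (length is) \<le> C"
      using C[of "is" "x + y"] by simp
  qed
  then show "(\<lambda>y. pderivs js f (x + y)) \<in> (\<Union>n\<in>{1..}. O_step \<omega> m n)" by auto
qed

lemma pderivs_in_OM: "f \<in> S_space \<omega> \<Longrightarrow> pderivs js f \<in> OM_space \<omega>"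
  using pderivs_translate_in_OM[of f js 0] by simp

end

section \<open>A bounded family of test functions\<close>

text \<open>\<open>Complex v v\<close> places both centre and frequency at \<open>v\<close> in
  direction \<open>i\<close>; the prefactor normalises the modulus at the centre to 1.\<close>

definition packet :: "'n \<Rightarrow> real \<Rightarrow> real ^ 'n::finite \<Rightarrow> complex" where
  "packet i v = gauss (complex_of_real (exp (- v\<^sup>2 / 2))) (\<lambda>_. 0) (\<lambda>j. if j = i then Complex v v else 0)"

lemma norm_axis_real: "norm (axis i v :: real ^ 'n) = \<bar>v\<bar>"
  by (simp add: norm_eq_sqrt_inner inner_axis_axis)

lemma norm_packet_0:
  "cmod (gauss (complex_of_real (exp (- v\<^sup>2 / 2))) (\<lambda>_. 0) (\<lambda>j. if j = i then Complex v v else 0) x) =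
    exp (- (norm (x - axis i v))\<^sup>2 / 2)"
proof -
  have "(\<chi> j. Re (if j = i then Complex v v else 0)) = axis i v"
    by (simp add: vec_eq_iff axis_def)
  then show ?thesis
    by (simp add: norm_gauss_0 norm_axis_real exp_add[symmetric] diff_divide_distrib)
qed

text \<open>At the centre the Hermite argument in direction \<open>i\<close> is
  \<open>\<i> * v\<close>, so no cancellation occurs; the other coordinates have index 0 and
  contribute 1.\<close>

lemma norm_packet_deriv_ge:
  assumes v: "v \<ge> 0"
  shows "v ^ k \<le> cmod (pderivs (replicate k i) (packet i v) (axis i v))"
proof -
  have "cmod (pderivs (replicate k i) (packet i v) (axis i v)) =
      (\<Prod>j\<in>UNIV. cmod (hermite (count_list (replicate k i) j)
        ((if j = i then Complex v v else 0) - complex_of_real (axis i v $ j))))"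
    unfolding packet_def pderivs_gauss by (subst norm_gauss, subst norm_packet_0) simp
  also have "\<dots> = cmod (hermite k (\<i> * complex_of_real v)) *
      (\<Prod>j\<in>UNIV - {i}. cmod (hermite (count_list (replicate k i) j)
        ((if j = i then Complex v v else 0) - complex_of_real (axis i v $ j))))"
  proof -
    have "Complex v v - complex_of_real v = \<i> * complex_of_real v" by (simp add: complex_eq_iff)
    moreover have "count_list (replicate k i) i = k" by (induction k) auto
    ultimately show ?thesis by (subst prod.remove[of UNIV i]) auto
  qed
  also have "(\<Prod>j\<in>UNIV - {i}. cmod (hermite (count_list (replicate k i) j)
        ((if j = i then Complex v v else 0) - complex_of_real (axis i v $ j)))) = 1"
  proof (rule prod.neutral, rule ballI)
    fix j assume "j \<in> UNIV - {i}"
    then have "count_list (replicate k i) j = 0" by (simp add: count_list_0_iff)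
    then show "cmod (hermite (count_list (replicate k i) j)
        ((if j = i then Complex v v else 0) - complex_of_real (axis i v $ j))) = 1" by simp
  qed
  finally show ?thesis using norm_hermite_imaginary_ge[OF v, of k] by simp
qed

context weight
begin

lemma packet_in_S_space: "packet i v \<in> S_space \<omega>"
  unfolding packet_def by (rule gauss_in_S_space)

text \<open>Derivatives of order \<open>k\<close> are at most \<open>T ^ k * exp (- y^2 / 2)\<close>
  with \<open>T = y + v + sqrt k\<close>. As \<open>v \<le> |x| + y\<close>, the weight at
  \<open>4 * T\<close> costs a multiple of \<open>\<omega> (norm x)\<close>, absorbed by
  \<open>n\<close>, and terms linear in \<open>y\<close> and \<open>sqrt k\<close>, absorbed by the
  Gaussian and a spare \<open>exp (- k)\<close>. Nothing depends on \<open>v\<close>.\<close>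

lemma packet_bound:
  assumes m: "m \<ge> 1"
  shows "\<exists>n\<ge>1. \<exists>C. \<forall>f\<in>packet i ` {1..}. f \<in> O_step \<omega> m n \<and> O_norm \<omega> m n f \<le> C"
proof -
  obtain A where A: "A \<ge> 0" "\<And>t. 0 \<le> t \<Longrightarrow> \<omega> t \<le> A * (1 + t)" using linear_bound by metis
  obtain K where K: "K \<ge> 1" "\<And>t. 0 \<le> t \<Longrightarrow> \<omega> (16 * t) \<le> K * (1 + \<omega> t)" using dilation_bound by metis
  \<comment> \<open>Dilation multiplies the order \<open>m\<close> by \<open>K\<close>, so growth of
    order at least \<open>m * K\<close> has to be allowed.\<close>
  define M where "M = real m * K"
  have M: "M \<ge> 1" using mult_mono[of 1 "real m" 1 K] m K(1) by (simp add: M_def)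
  define L where "L = M * A"
  obtain n :: nat where n: "M \<le> real n" using real_arch_simple by blast
  have n1: "n \<ge> 1" using n M by linarith
  \<comment> \<open>The quadratics in \<open>y\<close> and in \<open>s\<close> contribute
    \<open>L^2 / 2\<close> each.\<close>
  define C where "C = exp (M + 2 * L + L\<^sup>2)"
  have bound: "cmod (pderivs is (packet i v) x) * exp (- real n * \<omega> (norm x)) * deriv_weight \<omega> m (length is) \<le> C"
    if v: "v \<ge> 1" for v x "is"
  proof -
    define k where "k = length is"
    define b where "b = (axis i v :: real ^ 'a)"
    define y where "y = norm (x - b)"
    define s where "s = sqrt (real k)"
    define T where "T = y + v + s"
    have nb: "norm b = v" using v by (simp add: b_def norm_axis_real)
    have nn: "y \<ge> 0" "s \<ge> 0" by (auto simp: y_def s_def)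
    have T1: "T \<ge> 1" using v nn by (simp add: T_def)
    have s2: "s\<^sup>2 = real k" by (simp add: s_def)
    let ?c = "\<lambda>j. if j = i then Complex v v else 0"
    have "cmod (?c j - complex_of_real (x $ j)) \<le> y + v" for j
    proof -
      have "?c j - complex_of_real (x $ j) = complex_of_real ((b - x) $ j) + (if j = i then \<i> * complex_of_real v else 0)"
        by (simp add: b_def axis_def complex_eq_iff)
      then have "cmod (?c j - complex_of_real (x $ j)) \<le> \<bar>(b - x) $ j\<bar> + cmod (if j = i then \<i> * complex_of_real v else 0)"
        by (metis norm_triangle_ineq norm_of_real)
      moreover have "\<bar>(b - x) $ j\<bar> \<le> norm (b - x)" by (rule component_le_norm_cart)
      moreover have "cmod (if j = i then \<i> * complex_of_real v else 0) \<le> v" using v by (simp add: norm_mult)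
      ultimately show ?thesis unfolding y_def norm_minus_commute[of x b] by linarith
    qed
    from norm_gauss_le[OF this, of "complex_of_real (exp (- v\<^sup>2 / 2))" "count_list is"]
    have pd: "cmod (pderivs is (packet i v) x) \<le> T ^ k * exp (- y\<^sup>2 / 2)"
      unfolding packet_def pderivs_gauss norm_packet_0 sum_count_list_UNIV
      by (simp add: k_def T_def s_def y_def b_def)
    \<comment> \<open>Evaluating at \<open>4 * T\<close> instead of \<open>T\<close> gains
      \<open>4 ^ k \<ge> exp k\<close>; this is the source of the spare \<open>exp (- k)\<close>,
      which is \<open>exp (- s^2)\<close>.\<close>
    have W0: "(4 * T) ^ k * deriv_weight \<omega> m k \<le> exp (real m * \<omega> (4 * T))"
      using T1 by (intro deriv_weight_upper[OF m]) simp
    have "\<omega> (4 * T) \<le> K * (1 + \<omega> (norm x)) + K * A * (2 + y + s)"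
    proof -
      define X where "X = max (norm x) (max y s)"
      have "v \<le> norm x + y" using norm_triangle_ineq4[of x "x - b"] nb by (simp add: y_def)
      then have "4 * T \<le> 16 * X" by (auto simp: T_def X_def)
      then have "\<omega> (4 * T) \<le> \<omega> (16 * X)" using T1 by (intro mono) auto
      also have "\<dots> \<le> K * (1 + \<omega> X)" using nn by (intro K(2)) (simp add: X_def)
      also have "\<omega> X \<le> \<omega> (norm x) + \<omega> y + \<omega> s"
        using nn nonneg[of "norm x"] nonneg[of y] nonneg[of s] by (auto simp: X_def max_def)
      also have "\<dots> \<le> \<omega> (norm x) + A * (1 + y) + A * (1 + s)" using A(2) nn by (intro add_mono) auto
      finally have "\<omega> (4 * T) \<le> K * (1 + (\<omega> (norm x) + A * (1 + y) + A * (1 + s)))" using K(1) by simp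
      then show ?thesis by (simp add: algebra_simps)
    qed
    then have "real m * \<omega> (4 * T) \<le> real m * (K * (1 + \<omega> (norm x)) + K * A * (2 + y + s))"
      by (rule mult_left_mono) simp
    moreover have "real m * (K * (1 + \<omega> (norm x)) + K * A * (2 + y + s)) = M + M * \<omega> (norm x) + L * (2 + y + s)"
      by (simp add: M_def L_def algebra_simps)
    moreover have "M * \<omega> (norm x) \<le> real n * \<omega> (norm x)" using n nonneg by (intro mult_right_mono) auto
    ultimately have "real m * \<omega> (4 * T) \<le> M + real n * \<omega> (norm x) + L * (2 + y + s)" by linarith
    then have W: "(4 * T) ^ k * deriv_weight \<omega> m k \<le> exp (M + real n * \<omega> (norm x) + L * (2 + y + s))"
      using W0 by (meson exp_le_cancel_iff order_trans)
    have e4: "exp (real k) * T ^ k \<le> (4 * T) ^ k"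
    proof -
      have "exp (1::real) \<le> 4" using exp_le by linarith
      then have "exp 1 ^ k * T ^ k \<le> 4 ^ k * T ^ k" using T1 by (intro mult_right_mono power_mono) auto
      then show ?thesis by (simp add: power_mult_distrib exp_of_nat_mult[symmetric])
    qed
    let ?d = "deriv_weight \<omega> m k"
    have d: "?d > 0" by (rule deriv_weight_pos[OF m])
    have "exp (real k) * T ^ k * ?d \<le> exp (M + real n * \<omega> (norm x) + L * (2 + y + s))"
      using mult_right_mono[OF e4 less_imp_le[OF d]] W by linarith
    then have Td: "T ^ k * ?d \<le> exp (M + real n * \<omega> (norm x) + L * (2 + y + s) - real k)"
    proof -
      have "E * P * D \<le> Q \<Longrightarrow> E > 0 \<Longrightarrow> P * D \<le> Q / E" for E P D Q :: real
        by (simp add: field_simps)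
      then show ?thesis using \<open>exp (real k) * T ^ k * ?d \<le> _\<close> unfolding exp_diff by (meson exp_gt_zero)
    qed
    have "cmod (pderivs is (packet i v) x) * exp (- real n * \<omega> (norm x)) * ?d
        \<le> (T ^ k * exp (- y\<^sup>2 / 2)) * exp (- real n * \<omega> (norm x)) * ?d"
      using pd d by (intro mult_right_mono) auto
    also have "\<dots> = exp (- y\<^sup>2 / 2) * exp (- real n * \<omega> (norm x)) * (T ^ k * ?d)"
      by (simp only: mult.assoc mult.commute mult.left_commute)
    also have "\<dots> \<le> exp (- y\<^sup>2 / 2) * exp (- real n * \<omega> (norm x)) * exp (M + real n * \<omega> (norm x) + L * (2 + y + s) - real k)"
      using Td by (intro mult_left_mono) auto
    also have "\<dots> = exp ((M + 2 * L) + (L * y - y\<^sup>2 / 2) + (L * s - s\<^sup>2))"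
      unfolding exp_add[symmetric] s2 by (simp add: algebra_simps)
    also have "\<dots> \<le> C"
    proof -
      have "L * y - y\<^sup>2 / 2 \<le> L\<^sup>2 / 2" using quadratic_le[of 0 L y] by simp
      moreover have "L * s - s\<^sup>2 \<le> L\<^sup>2 / 2" using quadratic_le[of 0 L s] zero_le_power2[of s] by linarith
      ultimately show ?thesis unfolding C_def by simp
    qed
    finally show ?thesis unfolding k_def .
  qed
  have sm: "smooth (packet i v)" for v unfolding packet_def by (rule smooth_gauss)
  have "packet i v \<in> O_step \<omega> m n \<and> O_norm \<omega> m n (packet i v) \<le> C" if "v \<ge> 1" for v
    using O_step_I[OF sm bound[OF that]] by (rule conjI)
  then show ?thesis using n1 by (intro exI[of _ n] exI[of _ C] conjI ballI) auto
qed

lemma vn_bounded_packets: "vn_bounded (OM_topology \<omega>) (packet i ` {1..})"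
proof (rule vn_boundedI[OF _ packet_bound])
  show "packet i ` {1..} \<subseteq> OM_space \<omega>"
    using pderivs_in_OM[OF packet_in_S_space, of "[]"] by auto
qed

section \<open>Point functionals and their convolution\<close>

lemma norm_point_le:
  assumes m: "m \<ge> 1" and f: "f \<in> O_step \<omega> m n"
  shows "deriv_weight \<omega> m k * cmod (pderivs (replicate k i) f x) \<le> exp (real n * \<omega> (norm x)) * O_norm \<omega> m n f"
proof -
  have "cmod (pderivs (replicate k i) f x) * exp (- real n * \<omega> (norm x)) * deriv_weight \<omega> m k \<le> O_norm \<omega> m n f"
    using O_weighted_le_O_norm[OF f, of "\<lambda>j. if j = i then k else 0" x] unfolding O_weighted_alt word_single by simp
  from mult_left_mono[OF this, of "exp (real n * \<omega> (norm x))"] show ?thesis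
    by (simp add: exp_minus field_simps)
qed

lemma linear_on_point: "linear_on (step_union \<omega> m) (\<lambda>f. c * pderivs is f x)"
  by (rule linear_on_pderivs) (rule step_union_smooth)

definition point_functional :: "complex \<Rightarrow> 'n list \<Rightarrow> real ^ 'n::finite \<Rightarrow> (real ^ 'n \<Rightarrow> complex) \<Rightarrow> complex" where
  "point_functional c is x = restrict (\<lambda>f. c * pderivs is f x) (OM_space \<omega>)"

lemma point_functional_in_OM_dual: "point_functional c (replicate k i) x \<in> OM_dual \<omega>"
  unfolding point_functional_def
proof (rule restrict_in_OM_dual[OF order_refl linear_on_point])
  fix n :: nat
  let ?d = "deriv_weight \<omega> 1 k"
  have d: "?d > 0" by (rule deriv_weight_pos) simp
  have "cmod (c * pderivs (replicate k i) f x) \<le> (cmod c * exp (real n * \<omega> (norm x)) / ?d) * O_norm \<omega> 1 n f"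
    if "f \<in> O_step \<omega> 1 n" for f
  proof -
    have "cmod (pderivs (replicate k i) f x) \<le> exp (real n * \<omega> (norm x)) * O_norm \<omega> 1 n f / ?d"
      using norm_point_le[OF order_refl that, of k i x] d by (simp add: pos_le_divide_eq mult.commute)
    from mult_left_mono[OF this, of "cmod c"] show ?thesis by (simp add: norm_mult mult.assoc)
  qed
  then show "\<exists>C. \<forall>f\<in>O_step \<omega> 1 n. cmod (c * pderivs (replicate k i) f x) \<le> C * O_norm \<omega> 1 n f" by blast
qed

text \<open>The two reflections cancel: \<open>convol_fun (reflect T) f\<close> at a point applies
  \<open>T\<close> to a translate of \<open>f\<close>, giving a multiple of the derivative there.
  The functional with coefficient \<open>a * b\<close> witnesses that the choice in
  \<open>convol\<close> can be met, so the chosen one obeys the formula on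
  \<open>S_space \<omega>\<close>.\<close>

lemma convol_point_functionals:
  fixes a b :: complex and i :: "'n::finite" and x :: "real ^ 'n" and k :: nat
  defines "R \<equiv> convol \<omega> (point_functional a (replicate k i) 0) (point_functional b [] x)"
  shows "R \<in> OM_dual \<omega>" and "f \<in> S_space \<omega> \<Longrightarrow> R f = a * b * pderivs (replicate k i) f x"
proof -
  let ?T = "point_functional a (replicate k i) 0" and ?S = "point_functional b [] x"
  let ?R = "point_functional (a * b) (replicate k i) x"
  have eq: "?R f = ?S (convol_fun (reflect ?T) f)" if f: "f \<in> S_space \<omega>" for f
  proof -
    have sm: "smooth f" using f by (simp add: S_space_def)
    have "convol_fun (reflect ?T) f = (\<lambda>x. a * pderivs (replicate k i) f x)"
    proof
      fix x
      have "(\<lambda>y. f (x + y)) \<in> OM_space \<omega>" using pderivs_translate_in_OM[OF f, of "[]" x] by simp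
      then have "?T (\<lambda>y. f (x + y)) = a * pderivs (replicate k i) (\<lambda>y. f (x + y)) 0"
        by (simp add: point_functional_def)
      moreover have "convol_fun (reflect ?T) f x = ?T (\<lambda>y. f (x + y))"
        by (simp add: convol_fun_def reflect_def)
      ultimately show "convol_fun (reflect ?T) f x = a * pderivs (replicate k i) f x"
        by (simp only: pderivs_translate[OF sm] add_0_right)
    qed
    then show ?thesis
      using pderivs_in_OM[OF f, of "[]"] pderivs_in_OM[OF f, of "replicate k i"]
      by (simp add: point_functional_def OM_scale)
  qed
  have "\<exists>R. R \<in> OM_dual \<omega> \<and> (\<forall>f\<in>S_space \<omega>. R f = ?S (convol_fun (reflect ?T) f))"
    by (intro exI[of _ ?R] conjI ballI point_functional_in_OM_dual eq)
  from someI_ex[OF this]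
  have R: "R \<in> OM_dual \<omega> \<and> (\<forall>f\<in>S_space \<omega>. R f = ?S (convol_fun (reflect ?T) f))"
    unfolding R_def convol_def .
  then show "R \<in> OM_dual \<omega>" by (rule conjunct1)
  show "R f = a * b * pderivs (replicate k i) f x" if f: "f \<in> S_space \<omega>"
  proof -
    have "R f = ?R f" unfolding eq[OF f] by (rule bspec[OF conjunct2[OF R] f])
    also have "\<dots> = a * b * pderivs (replicate k i) f x"
      using pderivs_in_OM[OF f, of "[]"] by (simp add: point_functional_def)
    finally show ?thesis .
  qed
qed

section \<open>Necessary conditions for bounded sets\<close>

text \<open>If every \<open>n\<close> failed, there would be points \<open>p j\<close> violating
  order \<open>j\<close>. Evaluations at \<open>p j\<close>, scaled by
  \<open>exp (- j * \<omega>)\<close>, are uniformly bounded on step \<open>n\<close>, because from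
  \<open>j = n\<close> on the scaling outweighs the growth; so they are bounded on \<open>D\<close>,
  against the choice of the points.\<close>

lemma bounded_pointwise:
  assumes D: "vn_bounded (OM_topology \<omega>) D"
  shows "\<exists>n. \<exists>C>0. \<forall>f\<in>D. \<forall>x. cmod (f x) \<le> C * exp (real n * \<omega> (norm x))"
proof (rule ccontr)
  assume neg: "\<not> ?thesis"
  \<comment> \<open>One index serves as growth order and, increased by 1 to be positive, as
    constant.\<close>
  have "\<exists>f x. f \<in> D \<and> real (Suc n) * exp (real n * \<omega> (norm x)) < cmod (f x)" for n
    using neg by (metis not_le of_nat_0_less_iff zero_less_Suc)
  then obtain f p where fp: "\<And>n. f n \<in> D" "\<And>n. real (Suc n) * exp (real n * \<omega> (norm (p n))) < cmod (f n (p n))"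
    by metis
  define L where "L j = (\<lambda>f. complex_of_real (exp (- (real j * \<omega> (norm (p j))))) * pderivs [] f (p j))" for j :: nat
  have "\<exists>C>0. \<forall>f\<in>D. \<forall>j\<in>UNIV. cmod (L j f) \<le> C"
  proof (rule vn_bounded_family[OF order_refl _ _ _ D])
    show "linear_on (step_union \<omega> 1) (L j)" for j unfolding L_def by (rule linear_on_point)
    fix n :: nat
    \<comment> \<open>The 1 covers all \<open>j > n\<close>, the sum the finitely many
      others.\<close>
    define C where "C = 1 + (\<Sum>j\<le>n. exp (real n * \<omega> (norm (p j))))"
    have "cmod (L j f) \<le> C * O_norm \<omega> 1 n f" if f: "f \<in> O_step \<omega> 1 n" for j f
    proof -
      have le: "cmod (f (p j)) \<le> exp (real n * \<omega> (norm (p j))) * O_norm \<omega> 1 n f"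
        using norm_point_le[OF order_refl f, of 0 undefined "p j"] by (simp add: deriv_weight_0)
      have O: "0 \<le> O_norm \<omega> 1 n f"
        using le norm_ge_zero[of "f (p j)"] by (meson exp_gt_zero order_trans zero_le_mult_iff not_le)
      have "exp (- (real j * \<omega> (norm (p j)))) * exp (real n * \<omega> (norm (p j))) \<le> C"
      proof (cases "j \<le> n")
        case True
        have "exp (- (real j * \<omega> (norm (p j)))) * exp (real n * \<omega> (norm (p j))) \<le> 1 * exp (real n * \<omega> (norm (p j)))"
          using nonneg[of "norm (p j)"] by (intro mult_right_mono) auto
        also have "\<dots> \<le> (\<Sum>j\<le>n. exp (real n * \<omega> (norm (p j))))"
          using True member_le_sum[of j "{..n}" "\<lambda>j. exp (real n * \<omega> (norm (p j)))"] by simp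
        finally show ?thesis by (simp add: C_def)
      next
        case False
        then have "real n * \<omega> (norm (p j)) \<le> real j * \<omega> (norm (p j))"
          using nonneg[of "norm (p j)"] by (intro mult_right_mono) auto
        then have "exp (- (real j * \<omega> (norm (p j)))) * exp (real n * \<omega> (norm (p j))) \<le> 1"
          unfolding exp_add[symmetric] by simp
        moreover have "0 \<le> (\<Sum>j\<le>n. exp (real n * \<omega> (norm (p j))))" by (intro sum_nonneg) simp
        ultimately show ?thesis by (simp add: C_def)
      qed
      from mult_right_mono[OF this O]
      have "exp (- (real j * \<omega> (norm (p j)))) * (exp (real n * \<omega> (norm (p j))) * O_norm \<omega> 1 n f) \<le> C * O_norm \<omega> 1 n f"
        by (simp only: mult.assoc)
      moreover have "cmod (L j f) \<le> exp (- (real j * \<omega> (norm (p j)))) * (exp (real n * \<omega> (norm (p j))) * O_norm \<omega> 1 n f)"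
        unfolding L_def using mult_left_mono[OF le, of "exp (- (real j * \<omega> (norm (p j))))"] by (simp add: norm_mult)
      ultimately show ?thesis by linarith
    qed
    then show "\<exists>C. \<forall>j\<in>UNIV. \<forall>f\<in>O_step \<omega> 1 n. cmod (L j f) \<le> C * O_norm \<omega> 1 n f" by blast
  qed simp
  then obtain C where C: "\<And>f j. f \<in> D \<Longrightarrow> cmod (L j f) \<le> C" by blast
  obtain n :: nat where n: "C \<le> real n" using real_arch_simple by blast
  have "cmod (L n (f n)) = exp (- (real n * \<omega> (norm (p n)))) * cmod (f n (p n))"
    by (simp add: L_def norm_mult)
  moreover have "real (Suc n) < exp (- (real n * \<omega> (norm (p n)))) * cmod (f n (p n))"
    using fp(2)[of n] unfolding less_mult_exp_minus by (simp only: mult.commute)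
  ultimately show False using C[OF fp(1), of n n] n by simp
qed

text \<open>At the origin \<omega> vanishes, so the growth weights of all steps equal 1 and one
  constant serves every \<open>n\<close>; this leaves \<open>m\<close> free.\<close>

lemma bounded_derivs_at_0:
  assumes D: "vn_bounded (OM_topology \<omega>) D" and m: "m \<ge> 1"
  shows "\<exists>C>0. \<forall>f\<in>D. \<forall>k. deriv_weight \<omega> m k * cmod (pderivs (replicate k i) f 0) \<le> C"
proof -
  define L where "L k = (\<lambda>f. complex_of_real (deriv_weight \<omega> m k) * pderivs (replicate k i) f 0)" for k
  have norm_L: "cmod (L k f) = deriv_weight \<omega> m k * cmod (pderivs (replicate k i) f 0)" for k f
    using deriv_weight_pos[OF m, of k] by (simp add: L_def norm_mult)
  have "\<exists>C>0. \<forall>f\<in>D. \<forall>k\<in>UNIV. cmod (L k f) \<le> C"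
  proof (rule vn_bounded_family[OF m _ _ _ D])
    show "linear_on (step_union \<omega> m) (L k)" for k unfolding L_def by (rule linear_on_point)
    fix n :: nat
    have "\<forall>k\<in>UNIV. \<forall>f\<in>O_step \<omega> m n. cmod (L k f) \<le> 1 * O_norm \<omega> m n f"
      unfolding norm_L using norm_point_le[OF m, of _ n _ i 0] by (simp add: eq_0)
    then show "\<exists>C. \<forall>k\<in>UNIV. \<forall>f\<in>O_step \<omega> m n. cmod (L k f) \<le> C * O_norm \<omega> m n f" by blast
  qed simp
  then show ?thesis unfolding norm_L by simp
qed

section \<open>Failure of continuity at the zero pair\<close>

lemma convolution_discontinuous:
  "\<not> continuous_map
     (prod_topology (OM_dual_topology \<omega>) (OM_dual_topology \<omega>))
     (OM_dual_topology \<omega> :: ((real ^ 'n \<Rightarrow> complex) \<Rightarrow> complex) topology)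
     (\<lambda>(T, S). convol \<omega> T S)"
proof
  let ?X = "OM_topology \<omega> :: (real ^ 'n \<Rightarrow> complex) topology"
  let ?Y = "OM_dual_topology \<omega> :: ((real ^ 'n \<Rightarrow> complex) \<Rightarrow> complex) topology"
  assume cont: "continuous_map (prod_topology ?Y ?Y) ?Y (\<lambda>(T, S). convol \<omega> T S)"
  define i :: 'n where "i = undefined"
  define B where "B = packet i ` {1..}"
  have B: "vn_bounded ?X B" "B \<subseteq> S_space \<omega>"
    unfolding B_def using vn_bounded_packets packet_in_S_space by auto
  \<comment> \<open>The uniform \<open>\<delta> < 1\<close> leaves room \<open>1 - \<delta>\<close>
    for perturbations, which makes \<open>U\<close> open.\<close>
  define U where "U = {R \<in> OM_dual \<omega>. \<exists>\<delta><1. \<forall>f\<in>B. cmod (R f) \<le> \<delta>}"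
  have topY: "topspace ?Y = OM_dual \<omega>" by (simp add: OM_dual_topology_def OM_dual_def)
  have openY: "openin ?Y V \<longleftrightarrow> V \<subseteq> OM_dual \<omega> \<and>
     (\<forall>T\<in>V. \<exists>D e. vn_bounded ?X D \<and> 0 < e \<and> {S \<in> OM_dual \<omega>. \<forall>f\<in>D. cmod (S f - T f) \<le> e} \<subseteq> V)" for V
    unfolding OM_dual_topology_def OM_dual_def by (rule openin_strong_dual_topology)
  have "openin ?Y U"
    unfolding openY
  proof (intro conjI ballI)
    show "U \<subseteq> OM_dual \<omega>" by (auto simp: U_def)
    fix R assume "R \<in> U"
    then obtain \<delta> where \<delta>: "\<delta> < 1" "\<And>f. f \<in> B \<Longrightarrow> cmod (R f) \<le> \<delta>" by (auto simp: U_def)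
    have "{S \<in> OM_dual \<omega>. \<forall>f\<in>B. cmod (S f - R f) \<le> (1 - \<delta>) / 2} \<subseteq> U"
    proof
      fix S assume S: "S \<in> {S \<in> OM_dual \<omega>. \<forall>f\<in>B. cmod (S f - R f) \<le> (1 - \<delta>) / 2}"
      have "cmod (S f) \<le> (1 + \<delta>) / 2" if "f \<in> B" for f
      proof -
        have "cmod (S f - R f) \<le> (1 - \<delta>) / 2" using S that by blast
        then show ?thesis using norm_triangle_ineq[of "S f - R f" "R f"] \<delta>(2)[OF that] by (simp add: field_simps)
      qed
      moreover have "(1 + \<delta>) / 2 < 1" using \<delta>(1) by simp
      ultimately show "S \<in> U" using S unfolding U_def by blast
    qed
    then show "\<exists>D e. vn_bounded ?X D \<and> 0 < e \<and> {S \<in> OM_dual \<omega>. \<forall>f\<in>D. cmod (S f - R f) \<le> e} \<subseteq> U"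
      using B(1) \<delta>(1) by (intro exI[of _ B] exI[of _ "(1 - \<delta>) / 2"]) auto
  qed
  from openin_continuous_map_preimage[OF cont this]
  have pre: "openin (prod_topology ?Y ?Y) {p \<in> topspace (prod_topology ?Y ?Y). (case p of (T, S) \<Rightarrow> convol \<omega> T S) \<in> U}" .
  \<comment> \<open>The zero functional in the form of a point functional, so that its convolution
    with itself is computed by the same lemma.\<close>
  define Z :: "(real ^ 'n \<Rightarrow> complex) \<Rightarrow> complex" where "Z = point_functional 0 (replicate 0 i) 0"
  have Z: "Z \<in> OM_dual \<omega>" unfolding Z_def by (rule point_functional_in_OM_dual)
  have Z0: "Z f = 0" if "f \<in> OM_space \<omega>" for f using that by (simp add: Z_def point_functional_def)
  have "convol \<omega> Z Z \<in> OM_dual \<omega>" "\<And>f. f \<in> S_space \<omega> \<Longrightarrow> convol \<omega> Z Z f = 0"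
    using convol_point_functionals[where a = 0 and b = 0 and i = i and x = 0 and k = 0]
    by (simp_all add: Z_def)
  then have "convol \<omega> Z Z \<in> U" using B(2) unfolding U_def by (auto intro!: exI[of _ 0])
  then have "(Z, Z) \<in> {p \<in> topspace (prod_topology ?Y ?Y). (case p of (T, S) \<Rightarrow> convol \<omega> T S) \<in> U}"
    using Z by (simp add: topY)
  then obtain V W where VW: "openin ?Y V" "openin ?Y W" "Z \<in> V" "Z \<in> W"
    "V \<times> W \<subseteq> {p \<in> topspace (prod_topology ?Y ?Y). (case p of (T, S) \<Rightarrow> convol \<omega> T S) \<in> U}"
    using pre unfolding openin_prod_topology_alt by meson
  obtain D d where D: "vn_bounded ?X D" "d > 0" "{S \<in> OM_dual \<omega>. \<forall>f\<in>D. cmod (S f - Z f) \<le> d} \<subseteq> V"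
    using VW(1,3) unfolding openY by meson
  obtain E e where E: "vn_bounded ?X E" "e > 0" "{S \<in> OM_dual \<omega>. \<forall>f\<in>E. cmod (S f - Z f) \<le> e} \<subseteq> W"
    using VW(2,4) unfolding openY by meson
  have sub: "D \<subseteq> OM_space \<omega>" "E \<subseteq> OM_space \<omega>" using D(1) E(1) by (auto simp: vn_bounded_def)
  obtain n C where C: "C > 0" "\<And>f x. f \<in> E \<Longrightarrow> cmod (f x) \<le> C * exp (real n * \<omega> (norm x))"
    using bounded_pointwise[OF E(1)] by metis
  \<comment> \<open>The order \<open>Suc n\<close> for \<open>D\<close> is fixed only now that
    \<open>E\<close> has revealed \<open>n\<close>.\<close>
  obtain C' where C': "C' > 0" "\<And>f k. f \<in> D \<Longrightarrow> deriv_weight \<omega> (Suc n) k * cmod (pderivs (replicate k i) f 0) \<le> C'"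
    using bounded_derivs_at_0[OF D(1), of "Suc n" i] by (metis le_numeral_extra(4) Suc_leI zero_less_Suc One_nat_def)
  \<comment> \<open>The constant is what remains of \<open>1 / (a * b)\<close> below when the weight
    and the growth factor are split off.\<close>
  obtain k t where kt: "t \<ge> 1" "(C * C') / (d * e) * exp (real n * \<omega> t) < t ^ k * deriv_weight \<omega> (Suc n) k"
    using deriv_weight_growth[of "(C * C') / (d * e)" n] by auto
  let ?w = "deriv_weight \<omega> (Suc n) k"
  have w: "?w > 0" by (rule deriv_weight_pos) simp
  define x :: "real ^ 'n" where "x = axis i t"
  have nx: "norm x = t" using kt(1) by (simp add: x_def norm_axis_real)
  \<comment> \<open>\<open>a\<close> and \<open>b\<close> are the largest multiples that the bounds
    on \<open>D\<close> and \<open>E\<close> allow without leaving \<open>V\<close> and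
    \<open>W\<close>.\<close>
  define a where "a = d / C' * ?w"
  define b where "b = e / (C * exp (real n * \<omega> t))"
  have ab: "a > 0" "b > 0" using D(2) E(2) C(1) C'(1) w by (auto simp: a_def b_def)
  let ?T = "point_functional (complex_of_real a) (replicate k i) 0"
  let ?S = "point_functional (complex_of_real b) [] x"
  have "cmod (?T f - Z f) \<le> d" if f: "f \<in> D" for f
  proof -
    have "f \<in> OM_space \<omega>" using f sub by blast
    then have "cmod (?T f - Z f) = a * cmod (pderivs (replicate k i) f 0)"
      using ab(1) by (simp add: Z0 point_functional_def norm_mult)
    also have "\<dots> = d / C' * (?w * cmod (pderivs (replicate k i) f 0))" by (simp add: a_def)
    also have "\<dots> \<le> d / C' * C'" using C'(2)[OF f] D(2) C'(1) by (intro mult_left_mono) auto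
    finally show ?thesis using C'(1) by simp
  qed
  then have TV: "?T \<in> V" using D(3) point_functional_in_OM_dual by blast
  have "cmod (?S f - Z f) \<le> e" if f: "f \<in> E" for f
  proof -
    have "f \<in> OM_space \<omega>" using f sub by blast
    then have "cmod (?S f - Z f) = b * cmod (f x)"
      using ab(2) by (simp add: Z0 point_functional_def norm_mult)
    also have "\<dots> \<le> b * (C * exp (real n * \<omega> t))"
      using C(2)[OF f, of x] ab(2) by (intro mult_left_mono) (auto simp: nx)
    finally show ?thesis using C(1) by (simp add: b_def)
  qed
  moreover have "?S \<in> OM_dual \<omega>" using point_functional_in_OM_dual[of _ 0 i] by simp
  ultimately have SW: "?S \<in> W" using E(3) by blast
  have "convol \<omega> ?T ?S \<in> U" using VW(5) TV SW by auto
  moreover have f: "packet i t \<in> B" using kt(1) by (simp add: B_def)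
  ultimately have "cmod (convol \<omega> ?T ?S (packet i t)) < 1" unfolding U_def by fastforce
  moreover have "convol \<omega> ?T ?S (packet i t) = complex_of_real a * complex_of_real b * pderivs (replicate k i) (packet i t) x"
    by (rule convol_point_functionals(2)[OF packet_in_S_space])
  ultimately have "a * b * cmod (pderivs (replicate k i) (packet i t) x) < 1"
    using ab by (simp add: norm_mult)
  moreover have "a * b * t ^ k \<le> a * b * cmod (pderivs (replicate k i) (packet i t) x)"
    using norm_packet_deriv_ge[of t k i] kt(1) ab unfolding x_def by (intro mult_left_mono) auto
  ultimately have "a * b * t ^ k < 1" by linarith
  moreover have "a * b * t ^ k = (t ^ k * ?w) / ((C * C') / (d * e) * exp (real n * \<omega> t))"
    using D(2) E(2) C(1) C'(1) by (simp add: a_def b_def mult_ac)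
  moreover have "(C * C') / (d * e) * exp (real n * \<omega> t) > 0" using D(2) E(2) C(1) C'(1) by simp
  ultimately have "t ^ k * ?w < (C * C') / (d * e) * exp (real n * \<omega> t)"
    by (simp only: pos_divide_less_eq mult_1)
  then show False using kt(2) by simp
qed

end

theorem proposition4p12:
  fixes \<omega> :: "real \<Rightarrow> real"
  assumes "nonquasianalytic_weight \<omega>"
    and "(\<lambda>t. ln (1 + t)) \<in> o[at_top](\<omega>)"
  shows "\<not> continuous_map
           (prod_topology (OM_dual_topology \<omega>) (OM_dual_topology \<omega>))
           (OM_dual_topology \<omega> :: ((real ^ 'n \<Rightarrow> complex) \<Rightarrow> complex) topology)
           (\<lambda>(T, S). convol \<omega> T S)"
proof -
  interpret weight \<omega> using assms by unfold_locales
  show ?thesis by (rule convolution_discontinuous)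
qed

end
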